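(* Let $p\in(0,\infty)$ with $p\neq2$, let $\mathfrak N$ be a $\mathrm{II}_1$ factor, and let $\psi$ be a surjective $L^p$-isometry on $\mathscr U(\mathfrak N)$ such that $\psi(U)=U$ for every self-adjoint unitary $U\in\mathfrak N$ and $\psi(e^{i\theta}I)=e^{i\theta}I$ for every $\theta\in\mathbb R$. Then $$\psi(e^{i\theta}U_1\cdots U_n)=e^{i\theta}U_1\cdots U_n$$ for every $n\ge1$, all self-adjoint unitaries $U_1,\dots,U_n\in\mathfrak N$ and every $\theta\in\mathbb R$.
   Context: $\mathscr U(\mathfrak N)$ is the unitary group of $\mathfrak N$; with $\tau$ the tracial state of $\mathfrak N$, $\|A\|_p:=\tau(|A|^p)^{1/p}$. A map $\psi:\mathscr U(\mathfrak N)\to\mathscr U(\mathfrak N)$ is an $L^p$-isometry if $\|U-V\|_p=\|\psi(U)-\psi(V)\|_p$ for all $U,V\in\mathscr U(\mathfrak N)$. *)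

theory Defs
  imports "HOL-Analysis.Analysis" "HOL-Computational_Algebra.Polynomial"
begin

section \<open>Complex Hilbert spaces\<close>

text \<open>The inner product is linear in its first argument.\<close>

class complex_hilbert = banach +
  fixes scaleC :: "complex \<Rightarrow> 'a \<Rightarrow> 'a"
    and cinner :: "'a \<Rightarrow> 'a \<Rightarrow> complex"
  assumes scaleC_add_right: "scaleC c (x + y) = scaleC c x + scaleC c y"
    and scaleC_add_left: "scaleC (c + d) x = scaleC c x + scaleC d x"
    and scaleC_scaleC: "scaleC c (scaleC d x) = scaleC (c * d) x"
    and scaleR_eq_scaleC: "scaleR r x = scaleC (complex_of_real r) x"
    and cinner_commute: "cinner x y = cnj (cinner y x)"
    and cinner_add_left: "cinner (x + y) z = cinner x z + cinner y z"
    and cinner_scaleC_left: "cinner (scaleC c x) y = c * cinner x y"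
    and cinner_self_nonneg: "0 \<le> Re (cinner x x)"
    and norm_eq_sqrt_cinner: "norm x = sqrt (Re (cinner x x))"

section \<open>Bounded operators\<close>

text \<open>The library type of bounded \<^emph>\<open>real\<close>-linear maps supplies composition, the operator
  norm and its topology; \<open>B(H)\<close> is the subset of complex-linear maps.\<close>

definition bounded_ops :: "('h::complex_hilbert \<Rightarrow>\<^sub>L 'h) set" where
  "bounded_ops = {T. \<forall>c x. blinfun_apply T (scaleC c x) = scaleC c (blinfun_apply T x)}"

text \<open>The scalar operator \<open>c I\<close>. The multiple \<open>c T\<close> is written \<open>scalar_op c o\<^sub>L T\<close>.\<close>

definition scalar_op :: "complex \<Rightarrow> ('h::complex_hilbert \<Rightarrow>\<^sub>L 'h)" where
  "scalar_op c = Blinfun (scaleC c)"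

definition op_adj :: "('h::complex_hilbert \<Rightarrow>\<^sub>L 'h) \<Rightarrow> ('h \<Rightarrow>\<^sub>L 'h)" where
  "op_adj T = (THE S. \<forall>x y. cinner (blinfun_apply T x) y = cinner x (blinfun_apply S y))"

definition self_adjoint :: "('h::complex_hilbert \<Rightarrow>\<^sub>L 'h) \<Rightarrow> bool" where
  "self_adjoint T \<longleftrightarrow> T \<in> bounded_ops \<and> op_adj T = T"

definition positive_op :: "('h::complex_hilbert \<Rightarrow>\<^sub>L 'h) \<Rightarrow> bool" where
  "positive_op T \<longleftrightarrow> T \<in> bounded_ops \<and> (\<forall>x. cinner (blinfun_apply T x) x \<in> \<real>\<^sub>\<ge>\<^sub>0)"

definition op_le :: "('h::complex_hilbert \<Rightarrow>\<^sub>L 'h) \<Rightarrow> ('h \<Rightarrow>\<^sub>L 'h) \<Rightarrow> bool" where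
  "op_le S T \<longleftrightarrow> positive_op (T - S)"

definition op_spectrum :: "('h::complex_hilbert \<Rightarrow>\<^sub>L 'h) \<Rightarrow> complex set" where
  "op_spectrum T = {z. \<not> (\<exists>S\<in>bounded_ops.
     S o\<^sub>L (T - scalar_op z) = id_blinfun \<and> (T - scalar_op z) o\<^sub>L S = id_blinfun)}"

definition op_poly :: "real poly \<Rightarrow> ('h::complex_hilbert \<Rightarrow>\<^sub>L 'h) \<Rightarrow> ('h \<Rightarrow>\<^sub>L 'h)" where
  "op_poly q T = (\<Sum>i\<le>degree q. coeff q i *\<^sub>R (((o\<^sub>L) T ^^ i) id_blinfun))"

text \<open>Continuous functional calculus \<open>f(T)\<close> for self-adjoint \<open>T\<close> (whose spectrum is real) and
  \<open>f\<close> continuous on the spectrum: the norm limit of \<open>q\<^sub>n(T)\<close> for polynomials \<open>q\<^sub>n\<close>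
  converging to \<open>f\<close> uniformly on the spectrum.\<close>

definition op_fun :: "(real \<Rightarrow> real) \<Rightarrow> ('h::complex_hilbert \<Rightarrow>\<^sub>L 'h) \<Rightarrow> ('h \<Rightarrow>\<^sub>L 'h)" where
  "op_fun f T = (THE S. \<exists>q :: nat \<Rightarrow> real poly.
     uniform_limit {t. complex_of_real t \<in> op_spectrum T} (\<lambda>n. poly (q n)) f sequentially \<and>
     (\<lambda>n. op_poly (q n) T) \<longlonglongrightarrow> S)"

definition op_abs :: "('h::complex_hilbert \<Rightarrow>\<^sub>L 'h) \<Rightarrow> ('h \<Rightarrow>\<^sub>L 'h)" where
  "op_abs A = op_fun sqrt (op_adj A o\<^sub>L A)"

text \<open>\<open>|A|\<^sup>p\<close>, for \<open>p > 0\<close> (note that \<open>0 powr p = 0\<close>).\<close>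

definition op_abs_powr :: "('h::complex_hilbert \<Rightarrow>\<^sub>L 'h) \<Rightarrow> real \<Rightarrow> ('h \<Rightarrow>\<^sub>L 'h)" where
  "op_abs_powr A p = op_fun (\<lambda>t. t powr p) (op_abs A)"

section \<open>Von Neumann algebras and factors of type \<open>II\<^sub>1\<close>\<close>

definition commutant :: "('h::complex_hilbert \<Rightarrow>\<^sub>L 'h) set \<Rightarrow> ('h \<Rightarrow>\<^sub>L 'h) set" where
  "commutant N = {T \<in> bounded_ops. \<forall>S\<in>N. T o\<^sub>L S = S o\<^sub>L T}"

definition von_neumann_algebra :: "('h::complex_hilbert \<Rightarrow>\<^sub>L 'h) set \<Rightarrow> bool" where
  "von_neumann_algebra N \<longleftrightarrow>
     N \<subseteq> bounded_ops \<and> id_blinfun \<in> N \<and>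
     (\<forall>A\<in>N. \<forall>B\<in>N. A + B \<in> N \<and> A o\<^sub>L B \<in> N) \<and>
     (\<forall>c. \<forall>A\<in>N. scalar_op c o\<^sub>L A \<in> N) \<and>
     (\<forall>A\<in>N. op_adj A \<in> N) \<and>
     commutant (commutant N) = N"

definition factor :: "('h::complex_hilbert \<Rightarrow>\<^sub>L 'h) set \<Rightarrow> bool" where
  "factor N \<longleftrightarrow> von_neumann_algebra N \<and> (id_blinfun :: 'h \<Rightarrow>\<^sub>L 'h) \<noteq> 0 \<and>
     N \<inter> commutant N = range scalar_op"

definition projections :: "('h::complex_hilbert \<Rightarrow>\<^sub>L 'h) set \<Rightarrow> ('h \<Rightarrow>\<^sub>L 'h) set" where
  "projections N = {P \<in> N. self_adjoint P \<and> P o\<^sub>L P = P}"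

definition minimal_projection ::
    "('h::complex_hilbert \<Rightarrow>\<^sub>L 'h) set \<Rightarrow> ('h \<Rightarrow>\<^sub>L 'h) \<Rightarrow> bool" where
  "minimal_projection N P \<longleftrightarrow> P \<in> projections N \<and> P \<noteq> 0 \<and>
     (\<forall>Q\<in>projections N. op_le Q P \<longrightarrow> Q = 0 \<or> Q = P)"

text \<open>Murray--von Neumann equivalence of projections of \<open>N\<close>.\<close>

definition mvn_equiv ::
    "('h::complex_hilbert \<Rightarrow>\<^sub>L 'h) set \<Rightarrow> ('h \<Rightarrow>\<^sub>L 'h) \<Rightarrow> ('h \<Rightarrow>\<^sub>L 'h) \<Rightarrow> bool" where
  "mvn_equiv N P Q \<longleftrightarrow> (\<exists>V\<in>N. op_adj V o\<^sub>L V = P \<and> V o\<^sub>L op_adj V = Q)"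

definition finite_projection ::
    "('h::complex_hilbert \<Rightarrow>\<^sub>L 'h) set \<Rightarrow> ('h \<Rightarrow>\<^sub>L 'h) \<Rightarrow> bool" where
  "finite_projection N P \<longleftrightarrow> P \<in> projections N \<and>
     (\<forall>Q\<in>projections N. op_le Q P \<and> mvn_equiv N P Q \<longrightarrow> Q = P)"

definition II1_factor :: "('h::complex_hilbert \<Rightarrow>\<^sub>L 'h) set \<Rightarrow> bool" where
  "II1_factor N \<longleftrightarrow> factor N \<and> (\<nexists>P. minimal_projection N P) \<and> finite_projection N id_blinfun"

section \<open>The trace and the \<open>L\<^sup>p\<close>-distance\<close>

definition tracial_state ::
    "('h::complex_hilbert \<Rightarrow>\<^sub>L 'h) set \<Rightarrow> (('h \<Rightarrow>\<^sub>L 'h) \<Rightarrow> complex) \<Rightarrow> bool" where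
  "tracial_state N \<tau> \<longleftrightarrow>
     (\<forall>A\<in>N. \<forall>B\<in>N. \<tau> (A + B) = \<tau> A + \<tau> B) \<and>
     (\<forall>c. \<forall>A\<in>N. \<tau> (scalar_op c o\<^sub>L A) = c * \<tau> A) \<and>
     (\<forall>A\<in>N. positive_op A \<longrightarrow> \<tau> A \<in> \<real>\<^sub>\<ge>\<^sub>0) \<and>
     \<tau> id_blinfun = 1 \<and>
     (\<forall>A\<in>N. \<forall>B\<in>N. \<tau> (A o\<^sub>L B) = \<tau> (B o\<^sub>L A))"

definition faithful_on ::
    "('h::complex_hilbert \<Rightarrow>\<^sub>L 'h) set \<Rightarrow> (('h \<Rightarrow>\<^sub>L 'h) \<Rightarrow> complex) \<Rightarrow> bool" where
  "faithful_on N \<tau> \<longleftrightarrow> (\<forall>A\<in>N. positive_op A \<and> \<tau> A = 0 \<longrightarrow> A = 0)"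

definition op_lub ::
    "('h::complex_hilbert \<Rightarrow>\<^sub>L 'h) set \<Rightarrow> ('h \<Rightarrow>\<^sub>L 'h) set \<Rightarrow> ('h \<Rightarrow>\<^sub>L 'h) \<Rightarrow> bool" where
  "op_lub N D S \<longleftrightarrow> S \<in> N \<and> self_adjoint S \<and> (\<forall>A\<in>D. op_le A S) \<and>
     (\<forall>B\<in>N. self_adjoint B \<and> (\<forall>A\<in>D. op_le A B) \<longrightarrow> op_le S B)"

text \<open>Normality: \<open>\<tau>\<close> preserves suprema of bounded upward directed sets of positive operators.\<close>

definition normal_on ::
    "('h::complex_hilbert \<Rightarrow>\<^sub>L 'h) set \<Rightarrow> (('h \<Rightarrow>\<^sub>L 'h) \<Rightarrow> complex) \<Rightarrow> bool" where
  "normal_on N \<tau> \<longleftrightarrow> (\<forall>D S. D \<subseteq> N \<and> D \<noteq> {} \<and> (\<forall>A\<in>D. positive_op A) \<and>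
     (\<forall>A\<in>D. \<forall>B\<in>D. \<exists>C\<in>D. op_le A C \<and> op_le B C) \<and> op_lub N D S
     \<longrightarrow> Re (\<tau> S) = (SUP A\<in>D. Re (\<tau> A)))"

text \<open>A \<open>II\<^sub>1\<close> factor has exactly one tracial state, and it is faithful and normal; following the
  usual convention these properties are part of what is meant by its trace.\<close>

definition is_trace_of ::
    "(('h::complex_hilbert \<Rightarrow>\<^sub>L 'h) \<Rightarrow> complex) \<Rightarrow> ('h \<Rightarrow>\<^sub>L 'h) set \<Rightarrow> bool" where
  "is_trace_of \<tau> N \<longleftrightarrow> tracial_state N \<tau> \<and> faithful_on N \<tau> \<and> normal_on N \<tau>"

text \<open>\<open>\<tau>(|A|\<^sup>p)\<close> is a nonnegative real, as \<open>|A|\<^sup>p\<close> is positive.\<close>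

definition Lp_norm ::
    "(('h::complex_hilbert \<Rightarrow>\<^sub>L 'h) \<Rightarrow> complex) \<Rightarrow> real \<Rightarrow> ('h \<Rightarrow>\<^sub>L 'h) \<Rightarrow> real" where
  "Lp_norm \<tau> p A = Re (\<tau> (op_abs_powr A p)) powr (1 / p)"

definition unitary_group :: "('h::complex_hilbert \<Rightarrow>\<^sub>L 'h) set \<Rightarrow> ('h \<Rightarrow>\<^sub>L 'h) set" where
  "unitary_group N = {U \<in> N. op_adj U o\<^sub>L U = id_blinfun \<and> U o\<^sub>L op_adj U = id_blinfun}"

definition Lp_isometry ::
    "(('h::complex_hilbert \<Rightarrow>\<^sub>L 'h) \<Rightarrow> complex) \<Rightarrow> real \<Rightarrow> ('h \<Rightarrow>\<^sub>L 'h) set \<Rightarrow>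
     (('h \<Rightarrow>\<^sub>L 'h) \<Rightarrow> ('h \<Rightarrow>\<^sub>L 'h)) \<Rightarrow> bool" where
  "Lp_isometry \<tau> p N \<psi> \<longleftrightarrow> \<psi> \<in> unitary_group N \<rightarrow> unitary_group N \<and>
     (\<forall>U\<in>unitary_group N. \<forall>V\<in>unitary_group N. Lp_norm \<tau> p (U - V) = Lp_norm \<tau> p (\<psi> U - \<psi> V))"

definition op_prod_list :: "('h::complex_hilbert \<Rightarrow>\<^sub>L 'h) list \<Rightarrow> ('h \<Rightarrow>\<^sub>L 'h)" where
  "op_prod_list Us = foldr (o\<^sub>L) Us id_blinfun"

end

theory Submission
  imports Defs "HOL-Computational_Algebra.Fundamental_Theorem_Algebra"
begin

text \<open>For unitaries \<open>U\<close>, \<open>V\<close> the operator \<open>|U - V|\<^sup>2 = 2 - 2 Re (U\<^sup>*V)\<close> lies between \<open>0\<close> and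
  \<open>4\<close>. Hence \<open>\<parallel>U - V\<parallel>\<^sub>p = 2\<close> exactly for \<open>V = -U\<close>, so \<open>\<psi>(-U) = -\<psi>(U)\<close>; and for \<open>p \<noteq> 2\<close> the
  equality \<open>\<parallel>U - V\<parallel>\<^sub>p\<^sup>p + \<parallel>U + V\<parallel>\<^sub>p\<^sup>p = 2\<^sup>p\<close> holds exactly when \<open>U\<^sup>*V\<close> is a symmetry (a self-adjoint
  unitary), so \<open>\<psi>\<close> preserves this relation. Thus \<open>\<psi>(zS) = zT\<close> with a symmetry \<open>T\<close>, for every
  symmetry \<open>S\<close> and \<open>|z| = 1\<close>, and a tangent line argument with the distances to \<open>\<plusminus>S\<close> gives
  \<open>T = S\<close>. For symmetries \<open>S\<close>, \<open>T\<close> the relation forces \<open>\<psi>(ST)\<close> to commute with \<open>ST\<close>, and commuting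
  unitaries having the same distances to all \<open>S\<close> and \<open>iS\<close> are equal. Longer products follow by
  induction, as \<open>V \<mapsto> U\<^sub>1\<psi>(U\<^sub>1V)\<close> satisfies the same assumptions as \<open>\<psi>\<close>.\<close>

section \<open>Geometry of complex Hilbert spaces\<close>

text \<open>The exponent enters as \<open>s = p / 2\<close>. For \<open>s = 1\<close> the function
  \<open>chord s\<close> is affine, so the sum of the distances to V and -V is the same for all
  pairs and detects nothing; for \<open>s \<noteq> 1\<close> the function
  \<open>chord s x + chord s (- x) - 4 powr s\<close> has one sign on [-1,1] and vanishes only at
  the endpoints. The recurring device is that a function of one sign on the spectrum whose trace is
  zero must vanish there, by faithfulness. The obstacle is that a distance is the trace of a
  function of one real part, and such traces do not compare two operators that fail to commute.
  Hence commutation of \<open>\<psi> (S T)\<close> with S T has to come first; only then can the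
  test symmetry be taken as 1 - 2P, where P is the support of the positive part of a difference of
  two functions and commutes with both unitaries. Distances to the iS are needed as well because a
  unitary is not determined by its real part. The tangent argument for zS sees \<open>\<tau>\<close>
  of S T only through the factor Re z, so it is blind to z = \<i> and that case is reached by
  translation.\<close>

lemma cinner_add_right: "cinner x (y + z) = cinner x y + cinner x (z :: 'h::complex_hilbert)"
  by (metis cinner_add_left cinner_commute complex_cnj_add)

lemma cinner_scaleC_right: "cinner x (scaleC c y) = cnj c * cinner x (y :: 'h::complex_hilbert)"
  by (metis cinner_scaleC_left cinner_commute complex_cnj_mult)

lemma cinner_self: "cinner x x = complex_of_real ((norm (x :: 'h::complex_hilbert))\<^sup>2)"
proof -
  have "Im (cinner x x) = 0"
    by (metis cinner_commute complex_cnj_cancel_iff complex_eq_iff cnj.simps(2) equal_neg_zero)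
  moreover have "Re (cinner x x) = (norm x)\<^sup>2"
    by (simp add: norm_eq_sqrt_cinner cinner_self_nonneg)
  ultimately show ?thesis by (simp add: complex_eq_iff)
qed

lemma norm_scaleC: "norm (scaleC c x) = cmod c * norm (x :: 'h::complex_hilbert)"
proof -
  have "complex_of_real ((norm (scaleC c x))\<^sup>2) = complex_of_real ((cmod c * norm x)\<^sup>2)"
  proof -
    have "cmod c * norm x * (cmod c * norm x) = (cmod c)\<^sup>2 * (norm x)\<^sup>2"
      by (simp add: power2_eq_square)
    then have "complex_of_real ((cmod c * norm x)\<^sup>2) = c * cnj c * complex_of_real ((norm x)\<^sup>2)"
      by (metis complex_norm_square of_real_mult power2_eq_square)
    then show ?thesis
      by (simp add: cinner_self[symmetric] cinner_scaleC_left cinner_scaleC_right mult_ac del: of_real_power)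
  qed
  then have "(norm (scaleC c x))\<^sup>2 = (cmod c * norm x)\<^sup>2" using of_real_eq_iff by blast
  then show ?thesis by (simp add: power2_eq_iff_nonneg)
qed

lemma bounded_linear_scaleC: "bounded_linear (scaleC c :: 'h::complex_hilbert \<Rightarrow> 'h)"
  by (rule bounded_linear_intro[where K = "cmod c"])
    (simp_all add: scaleC_add_right scaleR_eq_scaleC scaleC_scaleC norm_scaleC mult.commute)

lemma scalar_op_apply [simp]: "blinfun_apply (scalar_op c) x = scaleC c x"
  by (simp add: scalar_op_def bounded_linear_Blinfun_apply bounded_linear_scaleC)

lemma scaleC_zero_right [simp]: "scaleC c (0 :: 'h::complex_hilbert) = 0"
  using bounded_linear_scaleC linear_simps(3) by blast

lemma scaleC_diff_right: "scaleC c (x - y) = scaleC c x - scaleC c (y :: 'h::complex_hilbert)"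
  by (metis add_diff_cancel diff_add_cancel scaleC_add_right)

lemma scaleC_minus_right: "scaleC c (- y) = - scaleC c (y :: 'h::complex_hilbert)"
  by (metis diff_0 scaleC_diff_right scaleC_zero_right)

lemma scaleC_one [simp]: "scaleC 1 (x :: 'h::complex_hilbert) = x"
  by (metis of_real_1 scaleR_eq_scaleC scaleR_one)

lemma scaleC_zero_left [simp]: "scaleC 0 (x :: 'h::complex_hilbert) = 0"
  by (metis of_real_0 scaleR_eq_scaleC scaleR_zero_left)

lemma cmod_cinner_le: "cmod (cinner x y) \<le> norm x * norm (y :: 'h::complex_hilbert)"
proof (cases "y = 0")
  case True
  then have "cinner x y = 0" by (metis cinner_scaleC_right complex_cnj_zero mult_zero_left scaleC_zero_left)
  then show ?thesis by simp
next
  case False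
  define n where "n = (norm y)\<^sup>2"
  have n: "n > 0" using False by (simp add: n_def)
  \<comment> \<open>This \<open>c\<close> minimises the norm of \<open>x + scaleC c y\<close>: it
    subtracts the component of \<open>x\<close> along \<open>y\<close>.\<close>
  define c where "c = - cinner x y / n"
  have "cinner (x + scaleC c y) (x + scaleC c y)
      = cinner x x + cnj c * cinner x y + c * (cinner y x + cnj c * cinner y y)"
    by (simp add: cinner_add_left cinner_add_right cinner_scaleC_left cinner_scaleC_right algebra_simps)
  also have "cinner y x = cnj (cinner x y)" by (rule cinner_commute)
  also have "cinner x x + cnj c * cinner x y + c * (cnj (cinner x y) + cnj c * cinner y y)
      = (norm x)\<^sup>2 - (cinner x y * cnj (cinner x y)) / n"
    unfolding c_def cinner_self n_def[symmetric] using n by (simp add: field_simps)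
  also have "\<dots> = complex_of_real ((norm x)\<^sup>2 - (cmod (cinner x y))\<^sup>2 / n)"
    by (simp add: complex_norm_square del: of_real_power)
  finally have "0 \<le> (norm x)\<^sup>2 - (cmod (cinner x y))\<^sup>2 / n"
    using cinner_self_nonneg by (metis Re_complex_of_real)
  then have "(cmod (cinner x y))\<^sup>2 \<le> (norm x * norm y)\<^sup>2"
    using n by (simp add: n_def field_simps)
  then show ?thesis by (meson mult_nonneg_nonneg norm_ge_zero power2_le_imp_le)
qed

interpretation cinner: bounded_bilinear "cinner :: 'h::complex_hilbert \<Rightarrow> 'h \<Rightarrow> complex"
  by standard (auto simp: cinner_add_left cinner_add_right scaleR_eq_scaleC cinner_scaleC_left
      cinner_scaleC_right scaleR_conv_of_real intro!: exI[of _ 1] cmod_cinner_le)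

lemma cinner_ext_left: "(\<And>y. cinner x y = cinner x' y) \<Longrightarrow> x = (x' :: 'h::complex_hilbert)"
  using cinner_self[of "x - x'"] by (simp add: cinner.diff_left)

lemma cinner_ext_right: "(\<And>y. cinner y x = cinner y x') \<Longrightarrow> x = (x' :: 'h::complex_hilbert)"
  using cinner_self[of "x - x'"] by (simp add: cinner.diff_right)

lemma norm_add_sq:
  "(norm (x + y))\<^sup>2 = (norm x)\<^sup>2 + 2 * Re (cinner x y) + (norm (y :: 'h::complex_hilbert))\<^sup>2"
proof -
  have "complex_of_real ((norm (x + y))\<^sup>2)
      = (norm x)\<^sup>2 + (cinner x y + cnj (cinner x y)) + (norm y)\<^sup>2"
    unfolding cinner_self[symmetric]
    by (simp add: cinner_add_left cinner_add_right cinner_commute[of y x] algebra_simps)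
  also have "\<dots> = complex_of_real ((norm x)\<^sup>2 + 2 * Re (cinner x y) + (norm y)\<^sup>2)"
    by (simp add: complex_add_cnj)
  finally show ?thesis using of_real_eq_iff by blast
qed

section \<open>Closed complex subspaces and orthogonal components\<close>

definition csubspace :: "'h::complex_hilbert set \<Rightarrow> bool" where
  "csubspace M \<longleftrightarrow> 0 \<in> M \<and> (\<forall>x\<in>M. \<forall>y\<in>M. x + y \<in> M) \<and> (\<forall>c. \<forall>x\<in>M. scaleC c x \<in> M)"

lemma csubspace_scaleR: "csubspace M \<Longrightarrow> x \<in> M \<Longrightarrow> r *\<^sub>R x \<in> M"
  by (simp add: csubspace_def scaleR_eq_scaleC)

lemma csubspace_diff: "csubspace M \<Longrightarrow> x \<in> M \<Longrightarrow> y \<in> M \<Longrightarrow> x - y \<in> M"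
  using csubspace_scaleR[of M y "-1"] by (force simp: csubspace_def)

lemma parallelogram:
  "(norm (x + y))\<^sup>2 + (norm (x - y))\<^sup>2 = 2 * (norm x)\<^sup>2 + 2 * (norm (y :: 'h::complex_hilbert))\<^sup>2"
  using norm_add_sq[of x y] norm_add_sq[of x "- y"] by (simp add: cinner.minus_right)

text \<open>The midpoint of two near-minimisers lies in \<open>M\<close> again, so the parallelogram
  law makes a minimising sequence Cauchy.\<close>

lemma ex_nearest_point:
  fixes M :: "'h::complex_hilbert set"
  assumes M: "csubspace M" "closed M"
  shows "\<exists>m\<in>M. \<forall>y\<in>M. norm (x - m) \<le> norm (x - y)"
proof -
  have ne: "M \<noteq> {}" using M by (auto simp: csubspace_def)
  define d where "d = infdist x M"
  have d_le: "d \<le> norm (x - y)" if "y \<in> M" for y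
    using infdist_le[OF that, of x] by (simp add: d_def dist_norm)
  have d0: "d \<ge> 0" by (simp add: d_def infdist_nonneg)
  have "\<exists>y\<in>M. norm (x - y) < d + e" if "e > 0" for e
  proof (rule ccontr)
    assume "\<not> ?thesis"
    then have "d + e \<le> (INF a\<in>M. dist x a)"
      by (intro cINF_greatest ne) (auto simp: dist_norm not_less)
    then show False using that ne by (simp add: d_def infdist_def)
  qed
  then have "\<forall>n. \<exists>y\<in>M. norm (x - y) < d + inverse (real (Suc n))" by simp
  then obtain m where m: "\<And>n. m n \<in> M" "\<And>n. norm (x - m n) < d + inverse (real (Suc n))"
    by metis
  have lim: "(\<lambda>n. norm (x - m n)) \<longlonglongrightarrow> d"
  proof (rule tendsto_sandwich[of "\<lambda>_. d" _ _ "\<lambda>n. d + inverse (real (Suc n))"])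
    show "(\<lambda>n. d + inverse (real (Suc n))) \<longlonglongrightarrow> d"
      using tendsto_add[OF tendsto_const LIMSEQ_inverse_real_of_nat] by simp
  qed (use d_le m(1) less_imp_le[OF m(2)] in \<open>auto intro!: always_eventually\<close>)
  have sq: "(norm (m i - m j))\<^sup>2 \<le> 2 * ((norm (x - m i))\<^sup>2 - d\<^sup>2) + 2 * ((norm (x - m j))\<^sup>2 - d\<^sup>2)" for i j
  proof -
    have "(1/2) *\<^sub>R (m i + m j) \<in> M"
      using M m by (intro csubspace_scaleR) (auto simp: csubspace_def)
    then have "2 * d \<le> 2 * norm (x - (1/2) *\<^sub>R (m i + m j))" using d_le by fastforce
    also have "\<dots> = norm (2 *\<^sub>R (x - (1/2) *\<^sub>R (m i + m j)))" by (simp only: norm_scaleR)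
    also have "2 *\<^sub>R (x - (1/2) *\<^sub>R (m i + m j)) = (x - m i) + (x - m j)"
      by (simp add: algebra_simps scaleR_2)
    finally have "(2 * d)\<^sup>2 \<le> (norm ((x - m i) + (x - m j)))\<^sup>2"
      using d0 by (intro power_mono) auto
    moreover have "(x - m i) - (x - m j) = m j - m i" by simp
    ultimately show ?thesis
      using parallelogram[of "x - m i" "x - m j"] by (simp add: power_mult_distrib norm_minus_commute)
  qed
  have "Cauchy m"
  proof (rule metric_CauchyI)
    fix e :: real assume e: "e > 0"
    have "(\<lambda>n. 2 * ((norm (x - m n))\<^sup>2 - d\<^sup>2)) \<longlonglongrightarrow> 2 * (d\<^sup>2 - d\<^sup>2)"
      by (intro tendsto_intros lim)
    then have "eventually (\<lambda>n. 2 * ((norm (x - m n))\<^sup>2 - d\<^sup>2) < e\<^sup>2 / 2) sequentially"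
      using e by (intro order_tendstoD(2)) auto
    then obtain K where K: "\<And>n. n \<ge> K \<Longrightarrow> 2 * ((norm (x - m n))\<^sup>2 - d\<^sup>2) < e\<^sup>2 / 2"
      by (auto simp: eventually_sequentially)
    have "dist (m i) (m j) < e" if "i \<ge> K" "j \<ge> K" for i j
    proof -
      have "(norm (m i - m j))\<^sup>2 < e\<^sup>2" using sq[of i j] K[OF that(1)] K[OF that(2)] by linarith
      then show ?thesis using e by (simp add: dist_norm power_less_imp_less_base)
    qed
    then show "\<exists>K. \<forall>i\<ge>K. \<forall>j\<ge>K. dist (m i) (m j) < e" by blast
  qed
  then obtain l where l: "m \<longlonglongrightarrow> l" using Cauchy_convergent_iff convergent_def by blast
  have "l \<in> M" using M(2) m(1) l closed_sequentially by blast
  moreover have "(\<lambda>n. norm (x - m n)) \<longlonglongrightarrow> norm (x - l)" by (intro tendsto_intros l)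
  then have "norm (x - l) = d" using lim LIMSEQ_unique by blast
  ultimately show ?thesis using d_le by metis
qed

text \<open>Moving the nearest point along \<open>y\<close> cannot shorten the distance, which kills
  the real part of the inner product; the direction \<open>scaleC \<i> y\<close> kills the imaginary
  part.\<close>

lemma ex_orthogonal_component:
  fixes M :: "'h::complex_hilbert set"
  assumes M: "csubspace M" "closed M"
  shows "\<exists>m\<in>M. \<forall>y\<in>M. cinner (x - m) y = 0"
proof -
  obtain m where m: "m \<in> M" "\<And>y. y \<in> M \<Longrightarrow> norm (x - m) \<le> norm (x - y)"
    using ex_nearest_point[OF M] by metis
  have re: "Re (cinner (x - m) y) = 0" if y: "y \<in> M" for y
  proof (cases "y = 0")
    case False
    define a where "a = Re (cinner (x - m) y)"
    define n where "n = (norm y)\<^sup>2"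
    have n: "n > 0" using False by (simp add: n_def)
    \<comment> \<open>The minimiser of the quadratic \<open>2 * t * a + t\<^sup>2 * n\<close>, which
      has to stay nonnegative.\<close>
    define t where "t = - a / n"
    have "m - t *\<^sub>R y \<in> M" using M(1) m(1) y csubspace_diff csubspace_scaleR by metis
    then have "(norm (x - m))\<^sup>2 \<le> (norm ((x - m) + t *\<^sub>R y))\<^sup>2"
      using m(2)[of "m - t *\<^sub>R y"] by (intro power_mono) (auto simp: algebra_simps)
    also have "\<dots> = (norm (x - m))\<^sup>2 + 2 * t * a + t\<^sup>2 * n"
      by (simp add: norm_add_sq cinner.scaleR_right a_def n_def power_mult_distrib)
    finally have "0 \<le> 2 * t * a + t\<^sup>2 * n" by simp
    also have "\<dots> = - (a\<^sup>2 / n)" using n by (simp add: t_def field_simps power2_eq_square)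
    finally have "a\<^sup>2 \<le> 0" using n by (simp add: divide_le_0_iff)
    then show ?thesis by (simp add: a_def)
  qed (simp add: cinner.zero_right)
  have "cinner (x - m) y = 0" if y: "y \<in> M" for y
  proof -
    have "scaleC \<i> y \<in> M" using y M(1) by (auto simp: csubspace_def)
    from re[OF this] re[OF y] show ?thesis
      by (simp add: cinner_scaleC_right complex_eq_iff)
  qed
  then show ?thesis using m(1) by blast
qed

section \<open>Adjoints\<close>

lemma bounded_opsD: "T \<in> bounded_ops \<Longrightarrow> blinfun_apply T (scaleC c x) = scaleC c (blinfun_apply T x)"
  by (simp add: bounded_ops_def)

text \<open>The kernel of a nonzero \<open>f\<close> has codimension one, so a vector
  \<open>w\<close> orthogonal to it represents \<open>f\<close> up to a scalar, which the value
  \<open>f w\<close> fixes.\<close>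

lemma ex_riesz:
  fixes f :: "'h::complex_hilbert \<Rightarrow> complex"
  assumes f: "bounded_linear f" and fc: "\<And>c x. f (scaleC c x) = c * f x"
  shows "\<exists>z. \<forall>x. f x = cinner x z"
proof (cases "\<forall>x. f x = 0")
  case True
  then show ?thesis by (intro exI[of _ 0]) (simp add: cinner.zero_right)
next
  case False
  then obtain x0 where x0: "f x0 \<noteq> 0" by blast
  interpret f: bounded_linear f by fact
  have "closed (f -` {0})"
    by (intro closed_vimage closed_singleton) (simp add: f.continuous_on)
  moreover have "csubspace (f -` {0})"
    by (auto simp: csubspace_def f.add fc f.zero)
  ultimately obtain m where m: "f m = 0" "\<And>y. f y = 0 \<Longrightarrow> cinner (x0 - m) y = 0"
    using ex_orthogonal_component[of "f -` {0}" x0] by auto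
  define w where "w = x0 - m"
  have fw: "f w \<noteq> 0" using m(1) x0 by (simp add: w_def f.diff)
  then have w0: "w \<noteq> 0" by (auto simp: f.zero)
  have "f x = cinner x (scaleC (cnj (f w / cinner w w)) w)" for x
  proof -
    have "f (x - scaleC (f x / f w) w) = 0" using fw by (simp add: f.diff fc)
    then have "cinner w (x - scaleC (f x / f w) w) = 0" using m(2) by (simp add: w_def)
    then have "cinner (x - scaleC (f x / f w) w) w = 0"
      by (metis cinner_commute complex_cnj_zero)
    then have "cinner x w = f x / f w * cinner w w"
      by (simp add: cinner.diff_left cinner_scaleC_left)
    then show ?thesis using fw w0 by (simp add: cinner_scaleC_right cinner_self)
  qed
  then show ?thesis by blast
qed

lemma op_adj_unique:
  assumes "\<And>x y. cinner (blinfun_apply T x) y = cinner x (blinfun_apply S y)"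
  shows "op_adj T = S"
  unfolding op_adj_def
proof (rule the_equality)
  fix R assume "\<forall>x y. cinner (blinfun_apply T x) y = cinner x (blinfun_apply R y)"
  then show "R = S" using assms by (intro blinfun_eqI cinner_ext_right) metis
qed (use assms in blast)

text \<open>Riesz representation supplies the values of the adjoint \<open>S\<close>. Its bound
  comes from pairing \<open>T (S y)\<close> with \<open>y\<close>, which gives the squared norm of
  \<open>S y\<close>.\<close>

lemma cinner_op_adj:
  fixes T :: "'h::complex_hilbert \<Rightarrow>\<^sub>L 'h"
  assumes T: "T \<in> bounded_ops"
  shows "cinner (blinfun_apply T x) y = cinner x (blinfun_apply (op_adj T) y)"
proof -
  have "\<exists>z. \<forall>x. cinner (blinfun_apply T x) y = cinner x z" for y
  proof (rule ex_riesz)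
    show "bounded_linear (\<lambda>x. cinner (blinfun_apply T x) y)"
      by (rule bounded_linear_compose[OF cinner.bounded_linear_left blinfun.bounded_linear_right])
  qed (simp add: bounded_opsD[OF T] cinner_scaleC_left)
  then obtain S where S: "\<And>x y. cinner (blinfun_apply T x) y = cinner x (S y)" by metis
  have bl: "bounded_linear S"
  proof (rule bounded_linear_intro[where K = "norm T"])
    fix x y show "S (x + y) = S x + S y"
      by (rule cinner_ext_right) (simp add: S[symmetric] cinner_add_right)
  next
    fix r x show "S (r *\<^sub>R x) = r *\<^sub>R S x"
      by (rule cinner_ext_right) (simp add: S[symmetric] cinner.scaleR_right)
  next
    fix y
    have "(norm (S y))\<^sup>2 = Re (cinner (S y) (S y))" by (simp add: cinner_self)
    also have "\<dots> = Re (cinner (blinfun_apply T (S y)) y)" by (simp add: S)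
    also have "\<dots> \<le> norm (blinfun_apply T (S y)) * norm y"
      using complex_Re_le_cmod cmod_cinner_le order_trans by blast
    also have "\<dots> \<le> norm T * norm (S y) * norm y"
      by (intro mult_right_mono norm_blinfun) auto
    finally have "norm (S y) * norm (S y) \<le> norm (S y) * (norm y * norm T)"
      by (simp add: power2_eq_square mult_ac)
    then show "norm (S y) \<le> norm y * norm T"
      by (cases "S y = 0") auto
  qed
  have "op_adj T = Blinfun S"
    by (rule op_adj_unique) (simp add: S bounded_linear_Blinfun_apply[OF bl])
  then show ?thesis by (simp add: S bounded_linear_Blinfun_apply[OF bl])
qed

lemma op_adj_bounded_ops [simp]:
  assumes "T \<in> bounded_ops" shows "op_adj T \<in> bounded_ops"
proof -
  have "blinfun_apply (op_adj T) (scaleC c x) = scaleC c (blinfun_apply (op_adj T) x)" for c x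
    by (rule cinner_ext_right) (simp only: cinner_op_adj[OF assms, symmetric] cinner_scaleC_right)
  then show ?thesis by (simp add: bounded_ops_def)
qed

lemma cinner_op_adj_left:
  assumes "T \<in> bounded_ops"
  shows "cinner (blinfun_apply (op_adj T) x) y = cinner x (blinfun_apply T y)"
  by (subst (1 2) cinner_commute) (simp add: cinner_op_adj[OF assms])

lemma op_adj_adj [simp]: "T \<in> bounded_ops \<Longrightarrow> op_adj (op_adj T) = T"
  by (rule op_adj_unique) (simp add: cinner_op_adj_left)

lemma bounded_ops_intros [simp]:
  "id_blinfun \<in> bounded_ops" "0 \<in> bounded_ops" "scalar_op c \<in> bounded_ops"
  "S \<in> bounded_ops \<Longrightarrow> T \<in> bounded_ops \<Longrightarrow> S + T \<in> bounded_ops"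
  "S \<in> bounded_ops \<Longrightarrow> T \<in> bounded_ops \<Longrightarrow> S - T \<in> bounded_ops"
  "T \<in> bounded_ops \<Longrightarrow> - T \<in> bounded_ops"
  "T \<in> bounded_ops \<Longrightarrow> r *\<^sub>R T \<in> bounded_ops"
  "S \<in> bounded_ops \<Longrightarrow> T \<in> bounded_ops \<Longrightarrow> S o\<^sub>L T \<in> bounded_ops"
  by (simp_all add: bounded_ops_def blinfun.bilinear_simps scaleC_add_right scaleC_diff_right
      scaleC_minus_right scaleR_eq_scaleC scaleC_scaleC mult.commute)

lemma op_adj_id [simp]: "op_adj id_blinfun = id_blinfun"
  by (rule op_adj_unique) simp

lemma op_adj_zero [simp]: "op_adj 0 = 0"
  by (rule op_adj_unique) (simp add: cinner.zero_left cinner.zero_right)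

lemma op_adj_scalar [simp]: "op_adj (scalar_op c) = scalar_op (cnj c)"
  by (rule op_adj_unique) (simp add: cinner_scaleC_left cinner_scaleC_right)

lemma op_adj_add [simp]:
  "S \<in> bounded_ops \<Longrightarrow> T \<in> bounded_ops \<Longrightarrow> op_adj (S + T) = op_adj S + op_adj T"
  by (rule op_adj_unique) (simp add: blinfun.bilinear_simps cinner_add_left cinner_add_right cinner_op_adj)

lemma op_adj_diff [simp]:
  "S \<in> bounded_ops \<Longrightarrow> T \<in> bounded_ops \<Longrightarrow> op_adj (S - T) = op_adj S - op_adj T"
  by (rule op_adj_unique) (simp add: blinfun.bilinear_simps cinner.diff_left cinner.diff_right cinner_op_adj)

lemma op_adj_minus [simp]: "T \<in> bounded_ops \<Longrightarrow> op_adj (- T) = - op_adj T"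
  by (rule op_adj_unique) (simp add: blinfun.bilinear_simps cinner.minus_left cinner.minus_right cinner_op_adj)

lemma op_adj_scaleR [simp]: "T \<in> bounded_ops \<Longrightarrow> op_adj (r *\<^sub>R T) = r *\<^sub>R op_adj T"
  by (rule op_adj_unique) (simp add: blinfun.bilinear_simps cinner.scaleR_left cinner.scaleR_right cinner_op_adj)

lemma op_adj_compose [simp]:
  "S \<in> bounded_ops \<Longrightarrow> T \<in> bounded_ops \<Longrightarrow> op_adj (S o\<^sub>L T) = op_adj T o\<^sub>L op_adj S"
  by (rule op_adj_unique) (simp add: cinner_op_adj)

interpretation blinfun_compose:
  bounded_bilinear "(o\<^sub>L) :: ('b::real_normed_vector \<Rightarrow>\<^sub>L 'c::real_normed_vector)
    \<Rightarrow> ('a::real_normed_vector \<Rightarrow>\<^sub>L 'b) \<Rightarrow> 'a \<Rightarrow>\<^sub>L 'c"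
  by (rule bounded_bilinear_blinfun_compose)

lemma id_compose [simp]: "id_blinfun o\<^sub>L T = T" "T o\<^sub>L id_blinfun = T"
  by (auto intro: blinfun_eqI)

lemma scalar_op_commute: "T \<in> bounded_ops \<Longrightarrow> T o\<^sub>L scalar_op c = scalar_op c o\<^sub>L T"
  by (rule blinfun_eqI) (simp add: bounded_opsD)

lemma scalar_op_compose: "scalar_op c o\<^sub>L scalar_op d = scalar_op (c * d)"
  by (rule blinfun_eqI) (simp add: scaleC_scaleC)

lemma scalar_op_of_real: "scalar_op (complex_of_real r) = r *\<^sub>R id_blinfun"
  by (rule blinfun_eqI) (simp add: scaleR_eq_scaleC blinfun.bilinear_simps)

lemma scalar_op_add: "scalar_op (c + d) = scalar_op c + scalar_op d"
  by (rule blinfun_eqI) (simp add: scaleC_add_left blinfun.bilinear_simps)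

lemma scalar_op_one [simp]: "scalar_op 1 = id_blinfun"
  by (rule blinfun_eqI) simp

lemma scalar_op_zero [simp]: "scalar_op 0 = 0"
  by (rule blinfun_eqI) simp

lemma scalar_op_minus: "scalar_op (- c) = - scalar_op c"
  using scalar_op_add[of c "- c"] by (simp add: eq_neg_iff_add_eq_0 add.commute)

lemma blinfun_compose_assoc: "(A o\<^sub>L B) o\<^sub>L C = A o\<^sub>L (B o\<^sub>L C)"
  by (rule blinfun_eqI) simp

lemma scalar_op_left_commute:
  "T \<in> bounded_ops \<Longrightarrow> T o\<^sub>L (scalar_op c o\<^sub>L A) = scalar_op c o\<^sub>L (T o\<^sub>L A)"
  by (simp add: scalar_op_commute flip: blinfun_compose_assoc)

lemmas op_distribs = blinfun_compose.add_left blinfun_compose.add_right blinfun_compose.diff_left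
  blinfun_compose.diff_right blinfun_compose.minus_left blinfun_compose.minus_right
  blinfun_compose.scaleR_left blinfun_compose.scaleR_right blinfun_compose.zero_left
  blinfun_compose.zero_right blinfun_compose_assoc

lemma self_adjointD: "self_adjoint T \<Longrightarrow> T \<in> bounded_ops" "self_adjoint T \<Longrightarrow> op_adj T = T"
  by (simp_all add: self_adjoint_def)

lemma self_adjoint_cinner:
  "self_adjoint T \<Longrightarrow> cinner (blinfun_apply T x) y = cinner x (blinfun_apply T y)"
  using cinner_op_adj[of T x y] by (simp add: self_adjoint_def)

lemma op_adj_compose_self_eq_0:
  assumes "T \<in> bounded_ops" "op_adj T o\<^sub>L T = 0"
  shows "T = 0"
proof (rule blinfun_eqI)
  fix x
  have "cinner (blinfun_apply T x) (blinfun_apply T x) = cinner x (blinfun_apply (op_adj T o\<^sub>L T) x)"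
    by (simp add: cinner_op_adj assms(1))
  then show "blinfun_apply T x = blinfun_apply 0 x"
    by (simp add: assms(2) cinner.zero_right cinner_self)
qed

text \<open>Additivity, homogeneity and the identity on \<open>M\<close> all follow from uniqueness
  of the orthogonal component (\<open>uniq\<close>); Pythagoras bounds the norm by one.\<close>

lemma ex_projection_onto:
  fixes M :: "'h::complex_hilbert set"
  assumes M: "csubspace M" "closed M"
  shows "\<exists>Q. self_adjoint Q \<and> (\<forall>x. blinfun_apply Q x \<in> M) \<and> (\<forall>x\<in>M. blinfun_apply Q x = x)"
proof -
  obtain q where q: "\<And>x. q x \<in> M" "\<And>x y. y \<in> M \<Longrightarrow> cinner (x - q x) y = 0"
    using ex_orthogonal_component[OF M] by metis
  have uniq: "q x = m" if m: "m \<in> M" "\<And>y. y \<in> M \<Longrightarrow> cinner (x - m) y = 0" for x m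
  proof -
    have "m - q x \<in> M" using csubspace_diff M(1) m(1) q(1) by blast
    then have "cinner (x - q x) (m - q x) - cinner (x - m) (m - q x) = 0" using m q by simp
    then have "cinner (m - q x) (m - q x) = 0" by (simp add: cinner.diff_left)
    then show ?thesis by (simp add: cinner_self)
  qed
  have add: "q (x + y) = q x + q y" for x y
  proof (rule uniq)
    show "q x + q y \<in> M" using M(1) q(1) by (simp add: csubspace_def)
    fix z assume "z \<in> M"
    moreover have "x + y - (q x + q y) = (x - q x) + (y - q y)" by simp
    ultimately show "cinner (x + y - (q x + q y)) z = 0"
      using q(2) by (simp only: cinner_add_left) simp
  qed
  have scale: "q (scaleC c x) = scaleC c (q x)" for c x
  proof (rule uniq)
    show "scaleC c (q x) \<in> M" using M(1) q(1) by (simp add: csubspace_def)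
    fix z assume "z \<in> M"
    then show "cinner (scaleC c x - scaleC c (q x)) z = 0"
      using q(2) by (simp only: scaleC_diff_right[symmetric] cinner_scaleC_left) simp
  qed
  have bl: "bounded_linear q"
  proof (rule bounded_linear_intro[where K = 1])
    fix x
    have "cinner (q x) (x - q x) = 0"
      using q(2)[OF q(1)] by (metis cinner_commute complex_cnj_zero)
    then have "(norm (q x + (x - q x)))\<^sup>2 = (norm (q x))\<^sup>2 + (norm (x - q x))\<^sup>2"
      using norm_add_sq[of "q x" "x - q x"] by simp
    then have "(norm (q x))\<^sup>2 \<le> (norm x)\<^sup>2" by simp
    then show "norm (q x) \<le> norm x * 1" using power2_le_imp_le[of "norm (q x)" "norm x"] by simp
  qed (simp_all add: add scale scaleR_eq_scaleC)
  have app: "blinfun_apply (Blinfun q) = q" by (rule bounded_linear_Blinfun_apply[OF bl])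
  have sym: "cinner (q x) y = cinner x (q y)" for x y
  proof -
    have "cinner (q x) (y - q y) = 0"
      using q(2)[OF q(1)] by (metis cinner_commute complex_cnj_zero)
    moreover have "cinner (x - q x) (q y) = 0" by (rule q(2)[OF q(1)])
    ultimately show ?thesis by (simp add: cinner.diff_left cinner.diff_right)
  qed
  have "self_adjoint (Blinfun q)"
    unfolding self_adjoint_def bounded_ops_def by (simp add: app sym scale op_adj_unique)
  moreover have "q x = x" if "x \<in> M" for x
    by (rule uniq) (simp_all add: that cinner.zero_left)
  ultimately show ?thesis using app q(1) by metis
qed

section \<open>Spectrum and polynomial calculus\<close>

text \<open>The lower bound makes the range closed, and injectivity of the adjoint makes its
  orthogonal complement trivial, so the operator is bijective; the lower bound also bounds the
  inverse.\<close>

lemma ex_bounded_inverse: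
  fixes A :: "'h::complex_hilbert \<Rightarrow>\<^sub>L 'h"
  assumes A: "A \<in> bounded_ops" and d: "d > 0"
    and below: "\<And>x. d * norm x \<le> norm (blinfun_apply A x)"
    and adj_inj: "\<And>x. blinfun_apply (op_adj A) x = 0 \<Longrightarrow> x = 0"
  shows "\<exists>S\<in>bounded_ops. S o\<^sub>L A = id_blinfun \<and> A o\<^sub>L S = id_blinfun"
proof -
  let ?R = "range (blinfun_apply A)"
  have "complete ?R"
    using complete_isometric_image[OF d subspace_UNIV blinfun.bounded_linear_right[of A]] below
    by (simp add: complete_UNIV)
  then have "closed ?R" by (simp add: complete_eq_closed)
  moreover have "csubspace ?R"
    unfolding csubspace_def
    by (auto simp: bounded_opsD[OF A, symmetric] blinfun.add_right[symmetric] intro: image_eqI[of _ _ 0])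
  ultimately have surj: "y \<in> ?R" for y
  proof -
    obtain m where m: "m \<in> ?R" "\<And>z. z \<in> ?R \<Longrightarrow> cinner (y - m) z = 0"
      using ex_orthogonal_component[OF \<open>csubspace ?R\<close> \<open>closed ?R\<close>] by blast
    have "blinfun_apply (op_adj A) (y - m) = 0"
      by (rule cinner_ext_left) (simp add: cinner_op_adj_left[OF A] m cinner.zero_left)
    then have "y = m" using adj_inj by fastforce
    then show ?thesis using m by simp
  qed
  define g where "g = inv (blinfun_apply A)"
  have Ag: "blinfun_apply A (g y) = y" for y unfolding g_def using surj by (simp add: f_inv_into_f)
  have inj: "x = y" if "blinfun_apply A x = blinfun_apply A y" for x y
    using below[of "x - y"] that d by (simp add: blinfun.diff_right mult_le_0_iff)
  have bl: "bounded_linear g"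
  proof (rule bounded_linear_intro[where K = "1 / d"])
    show "norm (g x) \<le> norm x * (1 / d)" for x
      using below[of "g x"] d by (simp add: Ag field_simps)
  qed (rule inj; simp add: Ag blinfun.add_right blinfun.scaleR_right)+
  have app: "blinfun_apply (Blinfun g) = g" by (rule bounded_linear_Blinfun_apply[OF bl])
  have "g (scaleC c x) = scaleC c (g x)" for c x
    by (rule inj) (simp add: bounded_opsD[OF A] Ag)
  then have "Blinfun g \<in> bounded_ops" by (simp add: bounded_ops_def app)
  moreover have "Blinfun g o\<^sub>L A = id_blinfun"
    by (rule blinfun_eqI, rule inj) (simp add: app Ag)
  moreover have "A o\<^sub>L Blinfun g = id_blinfun"
    by (rule blinfun_eqI) (simp add: app Ag)
  ultimately show ?thesis by blast
qed

lemma bounded_below_of_not_in_spectrum: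
  fixes T :: "'h::complex_hilbert \<Rightarrow>\<^sub>L 'h"
  assumes "z \<notin> op_spectrum T"
  shows "\<exists>d>0. \<forall>x. d * norm x \<le> norm (blinfun_apply (T - scalar_op z) x)"
proof -
  obtain S where S: "S o\<^sub>L (T - scalar_op z) = id_blinfun"
    using assms by (auto simp: op_spectrum_def)
  \<comment> \<open>Adding 1 keeps the constant positive when \<open>S = 0\<close>, which happens on
    the zero space.\<close>
  have "norm x \<le> (norm S + 1) * norm (blinfun_apply (T - scalar_op z) x)" for x
  proof -
    have "norm x = norm (blinfun_apply S (blinfun_apply (T - scalar_op z) x))"
      by (metis S blinfun_apply_blinfun_compose id_blinfun.rep_eq id_apply)
    also have "\<dots> \<le> norm S * norm (blinfun_apply (T - scalar_op z) x)" by (rule norm_blinfun)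
    also have "\<dots> \<le> (norm S + 1) * norm (blinfun_apply (T - scalar_op z) x)"
      by (intro mult_right_mono) auto
    finally show ?thesis .
  qed
  then show ?thesis
    by (intro exI[of _ "1 / (norm S + 1)"])
      (simp add: field_simps add_pos_nonneg pos_add_strict add_nonneg_pos)
qed

text \<open>The form \<open>cinner (T x) x\<close> is real, so the imaginary part of the form of
  \<open>T - z\<close> is \<open>- Im z\<close> times the squared norm of \<open>x\<close>;
  Cauchy-Schwarz does the rest.\<close>

lemma self_adjoint_shift_below:
  assumes T: "self_adjoint T"
  shows "\<bar>Im z\<bar> * norm x \<le> norm (blinfun_apply (T - scalar_op z) x)"
proof -
  have "cinner (blinfun_apply T x) x = cnj (cinner (blinfun_apply T x) x)"
    using self_adjoint_cinner[OF T] cinner_commute by metis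
  then have "Im (cinner (blinfun_apply T x) x) = 0" by (metis Reals_cnj_iff complex_is_Real_iff)
  then have "\<bar>Im z\<bar> * (norm x)\<^sup>2 = \<bar>Im (cinner (blinfun_apply (T - scalar_op z) x) x)\<bar>"
    by (simp add: blinfun.diff_left cinner.diff_left cinner_scaleC_left cinner_self abs_mult
        del: of_real_power)
  also have "\<dots> \<le> norm (blinfun_apply (T - scalar_op z) x) * norm x"
    using abs_Im_le_cmod cmod_cinner_le order_trans by blast
  finally show ?thesis by (cases "x = 0") (simp_all add: power2_eq_square)
qed

lemma spectrum_self_adjoint_real:
  assumes T: "self_adjoint T" and z: "z \<in> op_spectrum T"
  shows "Im z = 0"
proof (rule ccontr)
  assume im: "Im z \<noteq> 0"
  have TB: "T \<in> bounded_ops" "op_adj T = T" using T by (auto simp: self_adjoint_def)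
  have "\<exists>S\<in>bounded_ops. S o\<^sub>L (T - scalar_op z) = id_blinfun \<and> (T - scalar_op z) o\<^sub>L S = id_blinfun"
  proof (rule ex_bounded_inverse)
    show "\<And>x. \<bar>Im z\<bar> * norm x \<le> norm (blinfun_apply (T - scalar_op z) x)"
      by (rule self_adjoint_shift_below[OF T])
    show "x = 0" if "blinfun_apply (op_adj (T - scalar_op z)) x = 0" for x
      using self_adjoint_shift_below[OF T, of "cnj z" x] that im TB by (simp add: mult_le_0_iff)
  qed (use im TB in auto)
  then show False using z by (auto simp: op_spectrum_def)
qed

abbreviation real_spectrum :: "('h::complex_hilbert \<Rightarrow>\<^sub>L 'h) \<Rightarrow> real set" where
  "real_spectrum T \<equiv> {t. complex_of_real t \<in> op_spectrum T}"

text \<open>\<open>T - t\<close> is its own adjoint for real \<open>t\<close>, so the lower bound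
  alone already gives invertibility. Read backwards: real spectral points are approximate
  eigenvalues.\<close>

lemma not_in_real_spectrum:
  assumes T: "self_adjoint T" and d: "d > 0"
    and below: "\<And>x. d * norm x \<le> norm (blinfun_apply T x - t *\<^sub>R x)"
  shows "t \<notin> real_spectrum T"
proof -
  have TB: "T \<in> bounded_ops" "op_adj T = T" using T by (auto simp: self_adjoint_def)
  have *: "d * norm x \<le> norm (blinfun_apply (T - scalar_op (complex_of_real t)) x)" for x
    using below[of x] by (simp add: blinfun.diff_left scaleR_eq_scaleC)
  have "\<exists>S\<in>bounded_ops. S o\<^sub>L (T - scalar_op t) = id_blinfun \<and> (T - scalar_op t) o\<^sub>L S = id_blinfun"
  proof (rule ex_bounded_inverse[OF _ d *])
    show "x = 0" if "blinfun_apply (op_adj (T - scalar_op (complex_of_real t))) x = 0" for x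
      using *[of x] that d TB by (simp add: mult_le_0_iff)
  qed (use TB in auto)
  then show ?thesis by (auto simp: op_spectrum_def)
qed

lemma real_spectrum_subset:
  assumes T: "self_adjoint T" and r: "norm (T - t0 *\<^sub>R id_blinfun) \<le> r"
  shows "real_spectrum T \<subseteq> {t0 - r..t0 + r}"
proof (rule ccontr)
  assume "\<not> ?thesis"
  then obtain t where t: "t \<in> real_spectrum T" "t \<notin> {t0 - r..t0 + r}" by blast
  then have "\<bar>t - t0\<bar> > r" by (auto simp: abs_if)
  have "(\<bar>t - t0\<bar> - r) * norm x \<le> norm (blinfun_apply T x - t *\<^sub>R x)" for x
  proof -
    have "\<bar>t - t0\<bar> * norm x = norm ((t - t0) *\<^sub>R x)" by simp
    also have "(t - t0) *\<^sub>R x = blinfun_apply (T - t0 *\<^sub>R id_blinfun) x - (blinfun_apply T x - t *\<^sub>R x)"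
      by (simp add: blinfun.diff_left blinfun.scaleR_left algebra_simps)
    also have "norm \<dots> \<le> norm (T - t0 *\<^sub>R id_blinfun) * norm x + norm (blinfun_apply T x - t *\<^sub>R x)"
      using norm_triangle_ineq4 norm_blinfun by (smt (verit, best))
    also have "norm (T - t0 *\<^sub>R id_blinfun) * norm x \<le> r * norm x" using r by (simp add: mult_right_mono)
    finally show ?thesis by (simp add: algebra_simps)
  qed
  then show False using not_in_real_spectrum[OF T, of "\<bar>t - t0\<bar> - r" t] t(1) \<open>\<bar>t - t0\<bar> > r\<close> by simp
qed

text \<open>Complex coefficients allow splitting into linear factors by the fundamental theorem of
  algebra; \<open>op_poly\<close> embeds through \<open>map_poly complex_of_real\<close>.\<close>

definition op_cpoly :: "complex poly \<Rightarrow> ('h::complex_hilbert \<Rightarrow>\<^sub>L 'h) \<Rightarrow> ('h \<Rightarrow>\<^sub>L 'h)" where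
  "op_cpoly q T = (\<Sum>i\<le>degree q. scalar_op (coeff q i) o\<^sub>L (((o\<^sub>L) T ^^ i) id_blinfun))"

lemma op_cpoly_alt:
  "degree q \<le> n \<Longrightarrow> op_cpoly q T = (\<Sum>i\<le>n. scalar_op (coeff q i) o\<^sub>L (((o\<^sub>L) T ^^ i) id_blinfun))"
  unfolding op_cpoly_def by (rule sum.mono_neutral_left) (auto simp: coeff_eq_0 op_distribs)

lemma op_cpoly_add: "op_cpoly (p + q) T = op_cpoly p T + op_cpoly q T"
proof -
  let ?n = "max (degree p) (degree q)"
  show ?thesis
    by (simp add: op_cpoly_alt[of _ ?n] degree_add_le scalar_op_add op_distribs sum.distrib)
qed

lemma op_cpoly_smult: "op_cpoly (smult c q) T = scalar_op c o\<^sub>L op_cpoly q T"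
  by (simp add: op_cpoly_alt[of _ "degree q"] degree_smult_le blinfun_compose.sum_right
      scalar_op_compose blinfun_compose_assoc[symmetric])

lemma op_cpoly_0 [simp]: "op_cpoly 0 T = 0"
  by (simp add: op_cpoly_def op_distribs)

lemma op_cpoly_pCons:
  assumes T: "T \<in> bounded_ops"
  shows "op_cpoly (pCons a q) T = scalar_op a + (T o\<^sub>L op_cpoly q T)"
proof -
  have "op_cpoly (pCons a q) T
      = (\<Sum>i\<le>Suc (degree q). scalar_op (coeff (pCons a q) i) o\<^sub>L (((o\<^sub>L) T ^^ i) id_blinfun))"
    by (rule op_cpoly_alt) (simp add: degree_pCons_le)
  also have "\<dots> = scalar_op a + (\<Sum>i\<le>degree q. scalar_op (coeff q i) o\<^sub>L (T o\<^sub>L (((o\<^sub>L) T ^^ i) id_blinfun)))"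
    unfolding sum.atMost_Suc_shift by simp
  also have "\<dots> = scalar_op a + (T o\<^sub>L op_cpoly q T)"
    unfolding op_cpoly_def blinfun_compose.sum_right blinfun_compose_assoc[symmetric]
      scalar_op_commute[OF T] ..
  finally show ?thesis .
qed

lemma op_cpoly_bounded_ops [simp]: "T \<in> bounded_ops \<Longrightarrow> op_cpoly q T \<in> bounded_ops"
  by (induction q) (auto simp: op_cpoly_pCons)

lemma op_cpoly_mult:
  assumes T: "T \<in> bounded_ops"
  shows "op_cpoly (p * q) T = op_cpoly p T o\<^sub>L op_cpoly q T"
proof (induction p)
  case (pCons a p)
  then show ?case
    by (simp add: T mult_pCons_left op_cpoly_add op_cpoly_smult op_cpoly_pCons op_distribs)
qed (simp add: op_distribs)

lemma op_poly_eq_op_cpoly: "op_poly q T = op_cpoly (map_poly complex_of_real q) T"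
proof -
  have "r *\<^sub>R S = scalar_op (complex_of_real r) o\<^sub>L S" for r and S :: "'a \<Rightarrow>\<^sub>L 'a"
    by (simp add: scalar_op_of_real op_distribs)
  then show ?thesis
    by (simp add: op_poly_def op_cpoly_def degree_map_poly coeff_map_poly)
qed

lemma op_poly_pCons:
  "T \<in> bounded_ops \<Longrightarrow> op_poly (pCons a q) T = a *\<^sub>R id_blinfun + (T o\<^sub>L op_poly q T)"
  by (simp add: op_poly_eq_op_cpoly map_poly_pCons op_cpoly_pCons scalar_op_of_real)

lemma op_poly_0 [simp]: "op_poly 0 T = 0"
  by (simp add: op_poly_eq_op_cpoly)

lemma map_poly_of_real_add:
  "map_poly complex_of_real (p + q) = map_poly complex_of_real p + map_poly complex_of_real q"
  by (rule poly_eqI) (simp add: coeff_map_poly)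

lemma map_poly_of_real_mult:
  "map_poly complex_of_real (p * q) = map_poly complex_of_real p * map_poly complex_of_real q"
  by (rule poly_eqI) (simp add: coeff_map_poly coeff_mult)

lemma poly_map_poly_of_real:
  "poly (map_poly complex_of_real p) (complex_of_real x) = complex_of_real (poly p x)"
  by (induction p) (simp_all add: map_poly_pCons)

lemma op_poly_add: "op_poly (p + q) T = op_poly p T + op_poly q T"
  by (simp add: op_poly_eq_op_cpoly map_poly_of_real_add op_cpoly_add)

lemma op_poly_mult: "T \<in> bounded_ops \<Longrightarrow> op_poly (p * q) T = op_poly p T o\<^sub>L op_poly q T"
  by (simp add: op_poly_eq_op_cpoly map_poly_of_real_mult op_cpoly_mult)

lemma op_poly_const: "op_poly [:a:] T = a *\<^sub>R id_blinfun"
  by (simp add: op_poly_def)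

lemma op_poly_diff: "T \<in> bounded_ops \<Longrightarrow> op_poly (p - q) T = op_poly p T - op_poly q T"
  using op_poly_add[of p "- q" T] op_poly_mult[of T "[:-1:]" q]
  by (simp add: op_poly_const op_distribs)

lemma op_poly_bounded_ops [simp]: "T \<in> bounded_ops \<Longrightarrow> op_poly q T \<in> bounded_ops"
  by (simp add: op_poly_eq_op_cpoly)

lemma op_poly_intertwine:
  assumes "X \<in> bounded_ops" "Y \<in> bounded_ops" "X o\<^sub>L B = B o\<^sub>L Y"
  shows "op_poly q X o\<^sub>L B = B o\<^sub>L op_poly q Y"
proof (induction q)
  case (pCons a q)
  have "op_poly (pCons a q) X o\<^sub>L B = a *\<^sub>R B + (X o\<^sub>L (op_poly q X o\<^sub>L B))"
    by (simp add: op_poly_pCons assms op_distribs)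
  also have "\<dots> = a *\<^sub>R B + ((X o\<^sub>L B) o\<^sub>L op_poly q Y)"
    by (simp only: pCons.IH blinfun_compose_assoc)
  also have "\<dots> = B o\<^sub>L op_poly (pCons a q) Y"
    by (simp add: op_poly_pCons assms op_distribs)
  finally show ?case .
qed (simp add: op_distribs)

lemma op_poly_self_adjoint:
  assumes "self_adjoint T"
  shows "self_adjoint (op_poly q T)"
proof -
  have T: "T \<in> bounded_ops" "op_adj T = T" using assms by (auto simp: self_adjoint_def)
  have "op_adj (op_poly q T) = op_poly q T"
  proof (induction q)
    case (pCons a q)
    have "op_poly q T o\<^sub>L T = T o\<^sub>L op_poly q T" by (rule op_poly_intertwine) (simp_all add: T)
    then show ?case using pCons.IH by (simp add: op_poly_pCons T)
  qed simp
  then show ?thesis by (simp add: self_adjoint_def T)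
qed

text \<open>A root \<mu> of \<open>r\<close> lies outside the spectrum, so \<open>T - \<mu>\<close>
  is bounded below; peeling off one linear factor at a time, the lower bounds multiply.\<close>

lemma op_cpoly_bounded_below:
  assumes T: "T \<in> bounded_ops" and r: "r \<noteq> 0"
    and nz: "\<And>z. z \<in> op_spectrum T \<Longrightarrow> poly r z \<noteq> 0"
  shows "\<exists>d>0. \<forall>x. d * norm x \<le> norm (blinfun_apply (op_cpoly r T) x)"
  using r nz
proof (induction "degree r" arbitrary: r)
  case 0
  then obtain c where c: "r = [:c:]" by (metis degree_eq_zeroE)
  then have "c \<noteq> 0" using 0 by auto
  then show ?case
    by (intro exI[of _ "cmod c"]) (simp add: c op_cpoly_def norm_scaleC)
next
  case (Suc n)
  have "\<not> constant (poly r)" using Suc.hyps(2) by (simp add: constant_degree)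
  then obtain \<mu> where \<mu>: "poly r \<mu> = 0" using fundamental_theorem_of_algebra by blast
  then obtain q where q: "r = [:-\<mu>, 1:] * q" using poly_eq_0_iff_dvd by (metis dvdE)
  have q0: "q \<noteq> 0" using Suc.prems(1) q by auto
  have "degree r = Suc (degree q)" unfolding q using q0 by (subst degree_mult_eq) auto
  then have "n = degree q" using Suc.hyps(2) by simp
  moreover have "poly q z \<noteq> 0" if "z \<in> op_spectrum T" for z
    using Suc.prems(2)[OF that] by (auto simp: q)
  ultimately obtain d where d: "d > 0" "\<And>x. d * norm x \<le> norm (blinfun_apply (op_cpoly q T) x)"
    using Suc.hyps(1) q0 by blast
  have "\<mu> \<notin> op_spectrum T" using \<mu> Suc.prems(2) by blast
  then obtain e where e: "e > 0" "\<And>x. e * norm x \<le> norm (blinfun_apply (T - scalar_op \<mu>) x)"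
    using bounded_below_of_not_in_spectrum by blast
  have eq: "op_cpoly r T = (T - scalar_op \<mu>) o\<^sub>L op_cpoly q T"
    unfolding q op_cpoly_mult[OF T] by (simp add: op_cpoly_pCons T op_distribs scalar_op_minus)
  have "e * d * norm x \<le> norm (blinfun_apply (op_cpoly r T) x)" for x
  proof -
    have "e * (d * norm x) \<le> e * norm (blinfun_apply (op_cpoly q T) x)"
      using d e by (intro mult_left_mono) auto
    also have "\<dots> \<le> norm (blinfun_apply (op_cpoly r T) x)" using e(2) by (simp add: eq)
    finally show ?thesis by (simp add: mult.assoc)
  qed
  then show ?case using d e by (intro exI[of _ "e * d"]) auto
qed

text \<open>The half of the spectral mapping theorem that the norm estimate needs. The spectrum is
  real, so a complex root that lies in it is a real root of \<open>r\<close>.\<close>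

lemma ex_root_in_real_spectrum:
  assumes T: "self_adjoint T" and r: "r \<noteq> 0"
    and nb: "\<And>d. d > 0 \<Longrightarrow> \<exists>x. norm (blinfun_apply (op_poly r T) x) < d * norm x"
  shows "\<exists>t\<in>real_spectrum T. poly r t = 0"
proof (rule ccontr)
  assume no: "\<not> ?thesis"
  have TB: "T \<in> bounded_ops" using T by (auto simp: self_adjoint_def)
  have "poly (map_poly complex_of_real r) z \<noteq> 0" if z: "z \<in> op_spectrum T" for z
  proof -
    have "z = complex_of_real (Re z)"
      using spectrum_self_adjoint_real[OF T z] by (simp add: complex_eq_iff)
    then obtain t where t: "z = complex_of_real t" by blast
    then show ?thesis using no z by (auto simp: poly_map_poly_of_real)
  qed
  moreover have "map_poly complex_of_real r \<noteq> 0" using r by (simp add: map_poly_eq_0_iff)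
  ultimately obtain d where "d > 0" "\<forall>x. d * norm x \<le> norm (blinfun_apply (op_poly r T) x)"
    using op_cpoly_bounded_below[OF TB] unfolding op_poly_eq_op_cpoly by blast
  then show False using nb[of d] by (meson not_less)
qed

text \<open>If it were bounded below by \<open>d\<close>, expanding the squared norm of
  \<open>S (S x) - L\<^sup>2 x\<close> would bound the squared norm of \<open>S x\<close> by
  \<open>c\<close> times that of \<open>x\<close> with \<open>c < L\<^sup>2\<close>, against
  \<open>L = norm S\<close>.\<close>

lemma square_minus_norm_not_bounded_below:
  fixes S :: "'h::complex_hilbert \<Rightarrow>\<^sub>L 'h"
  assumes S: "self_adjoint S" and ne: "\<exists>x::'h. x \<noteq> 0" and d: "d > 0"
  shows "\<exists>x. norm (blinfun_apply ((S o\<^sub>L S) - (norm S)\<^sup>2 *\<^sub>R id_blinfun) x) < d * norm x"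
proof (rule ccontr)
  assume no: "\<not> ?thesis"
  define L where "L = norm S"
  obtain x0 :: 'h where x0: "x0 \<noteq> 0" using ne by blast
  have "L \<noteq> 0"
  proof
    assume "L = 0"
    then have "S = 0" by (simp add: L_def)
    then have "\<not> 0 < d * norm x0" using no by (auto simp: not_less)
    then show False using d x0 by simp
  qed
  then have L: "L > 0" by (simp add: L_def)
  \<comment> \<open>This is \<open>L ^ 4 - d\<^sup>2 / 2\<close> divided by
    \<open>L\<^sup>2\<close>; what matters is that it is strictly below
    \<open>L\<^sup>2\<close>.\<close>
  define c where "c = L\<^sup>2 - d\<^sup>2 / (2 * L\<^sup>2)"
  have bound: "(norm (blinfun_apply S x))\<^sup>2 \<le> c * (norm x)\<^sup>2" for x
  proof -
    let ?y = "blinfun_apply S (blinfun_apply S x)"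
    have "(d * norm x)\<^sup>2 \<le> (norm (?y + (- (L\<^sup>2)) *\<^sub>R x))\<^sup>2"
      using no d by (intro power_mono) (auto simp: L_def blinfun.diff_left blinfun.scaleR_left not_less)
    also have "\<dots> = (norm ?y)\<^sup>2 - 2 * L\<^sup>2 * Re (cinner ?y x) + L ^ 4 * (norm x)\<^sup>2"
      unfolding norm_add_sq
      by (simp add: cinner.minus_right cinner.scaleR_right power_mult_distrib flip: power_mult)
    also have "cinner ?y x = (norm (blinfun_apply S x))\<^sup>2"
      by (simp add: self_adjoint_cinner[OF S] cinner_self del: of_real_power)
    also have "(norm ?y)\<^sup>2 \<le> (L * norm (blinfun_apply S x))\<^sup>2"
      unfolding L_def by (intro power_mono norm_blinfun) auto
    also have "(L * norm (blinfun_apply S x))\<^sup>2 - 2 * L\<^sup>2 * Re (complex_of_real ((norm (blinfun_apply S x))\<^sup>2))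
        + L ^ 4 * (norm x)\<^sup>2 = L ^ 4 * (norm x)\<^sup>2 - L\<^sup>2 * (norm (blinfun_apply S x))\<^sup>2"
      by (simp add: power_mult_distrib del: of_real_power)
    also have "(d * norm x)\<^sup>2 = d\<^sup>2 * (norm x)\<^sup>2" by (rule power_mult_distrib)
    finally have "L\<^sup>2 * (norm (blinfun_apply S x))\<^sup>2 \<le> (L ^ 4 - d\<^sup>2) * (norm x)\<^sup>2"
      by (simp add: algebra_simps)
    also have "\<dots> \<le> (L ^ 4 - d\<^sup>2 / 2) * (norm x)\<^sup>2" by (intro mult_right_mono) auto
    also have "\<dots> = L\<^sup>2 * (c * (norm x)\<^sup>2)"
      using L by (simp add: c_def field_simps power2_eq_square power4_eq_xxxx)
    finally show ?thesis using L by simp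
  qed
  have "c \<ge> 0" 
  proof -
    have "0 \<le> c * (norm x0)\<^sup>2" using bound[of x0] zero_le_power2 order_trans by blast
    then show ?thesis using x0 by (simp add: zero_le_mult_iff)
  qed
  have "norm S \<le> sqrt c"
  proof (rule norm_blinfun_bound)
    fix x
    have "norm (blinfun_apply S x) = sqrt ((norm (blinfun_apply S x))\<^sup>2)" by simp
    also have "\<dots> \<le> sqrt (c * (norm x)\<^sup>2)" using bound by (rule real_sqrt_le_mono)
    finally show "norm (blinfun_apply S x) \<le> sqrt c * norm x" by (simp add: real_sqrt_mult)
  qed (use \<open>c \<ge> 0\<close> in simp)
  then have "L\<^sup>2 \<le> (sqrt c)\<^sup>2" unfolding L_def by (intro power_mono) auto
  then have "L\<^sup>2 \<le> c" using \<open>c \<ge> 0\<close> by simp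
  then show False using d L by (simp add: c_def field_simps)
qed

lemma real_spectrum_nonempty:
  fixes T :: "'h::complex_hilbert \<Rightarrow>\<^sub>L 'h"
  assumes T: "self_adjoint T" and ne: "\<exists>x::'h. x \<noteq> 0"
  shows "real_spectrum T \<noteq> {}"
proof -
  have TB: "T \<in> bounded_ops" using T by (auto simp: self_adjoint_def)
  have "op_poly [:- (norm T)\<^sup>2, 0, 1:] T = (T o\<^sub>L T) - (norm T)\<^sup>2 *\<^sub>R id_blinfun"
    by (simp add: op_poly_pCons TB op_distribs)
  then have "\<exists>t\<in>real_spectrum T. poly [:- (norm T)\<^sup>2, 0, 1:] t = 0"
    by (intro ex_root_in_real_spectrum[OF T]) (simp_all add: square_minus_norm_not_bounded_below[OF T ne])
  then show ?thesis by blast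
qed

text \<open>With \<open>S = q(T)\<close> and \<open>L = \<parallel>S\<parallel>\<close>, the operator \<open>S\<^sup>2 - L\<^sup>2\<close> is not bounded below, so the
  polynomial \<open>q\<^sup>2 - L\<^sup>2\<close> has a root in the spectrum.\<close>

lemma norm_op_poly_le:
  fixes T :: "'h::complex_hilbert \<Rightarrow>\<^sub>L 'h"
  assumes T: "self_adjoint T" and e: "0 \<le> \<epsilon>" and le: "\<And>t. t \<in> real_spectrum T \<Longrightarrow> \<bar>poly q t\<bar> \<le> \<epsilon>"
  shows "norm (op_poly q T) \<le> \<epsilon>"
proof (cases "\<exists>x::'h. x \<noteq> 0")
  case False
  then have "op_poly q T = 0" by (intro blinfun_eqI) metis
  then show ?thesis using e by simp
next
  case True
  have TB: "T \<in> bounded_ops" using T by (auto simp: self_adjoint_def)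
  define S where "S = op_poly q T"
  have SA: "self_adjoint S" unfolding S_def by (rule op_poly_self_adjoint[OF T])
  define r where "r = q * q - [:(norm S)\<^sup>2:]"
  have rT: "op_poly r T = (S o\<^sub>L S) - (norm S)\<^sup>2 *\<^sub>R id_blinfun"
    by (simp add: r_def op_poly_diff op_poly_mult op_poly_const TB S_def)
  have "\<exists>t\<in>real_spectrum T. poly r t = 0"
  \<comment> \<open>If \<open>q * q\<close> is the constant \<open>(norm S)\<^sup>2\<close>, every
    number is a root and it is enough that the spectrum is nonempty.\<close>
  proof (cases "r = 0")
    case True
    then show ?thesis using real_spectrum_nonempty[OF T \<open>\<exists>x::'h. x \<noteq> 0\<close>] by auto
  next
    case False
    then show ?thesis
      using square_minus_norm_not_bounded_below[OF SA True] by (intro ex_root_in_real_spectrum[OF T]) (auto simp: rT)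
  qed
  then obtain t where t: "t \<in> real_spectrum T" "poly r t = 0" by blast
  then have "(poly q t)\<^sup>2 = (norm S)\<^sup>2" by (simp add: r_def power2_eq_square)
  then have "\<bar>poly q t\<bar> = norm S" by (metis abs_norm_cancel power2_eq_iff abs_minus_cancel)
  then show ?thesis using le[OF t(1)] by (simp add: S_def)
qed

section \<open>Continuous functional calculus\<close>

text \<open>Continuity is asked on a compact interval around the spectrum rather than on the
  spectrum: polynomial approximation applies there directly, without extending \<open>f\<close> or
  proving the spectrum closed.\<close>

definition cfc :: "(real \<Rightarrow> real) \<Rightarrow> ('h::complex_hilbert \<Rightarrow>\<^sub>L 'h) \<Rightarrow> bool" where
  "cfc f T \<longleftrightarrow> self_adjoint T \<and> (\<exists>a b. real_spectrum T \<subseteq> {a..b} \<and> continuous_on {a..b} f)"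

lemma cfcI: "self_adjoint T \<Longrightarrow> real_spectrum T \<subseteq> {a..b} \<Longrightarrow> continuous_on {a..b} f \<Longrightarrow> cfc f T"
  by (auto simp: cfc_def)

lemma cfc_self_adjoint: "cfc f T \<Longrightarrow> self_adjoint T"
  by (simp add: cfc_def)

lemma cfc_continuous: "self_adjoint T \<Longrightarrow> continuous_on UNIV f \<Longrightarrow> cfc f T"
  using real_spectrum_subset[of T 0 "norm T"]
  by (auto simp: cfc_def intro: continuous_on_subset)

lemma cfc_binary:
  assumes "cfc f T" "cfc g T"
    and h: "\<And>a b. continuous_on {a..b} f \<Longrightarrow> continuous_on {a..b} g \<Longrightarrow> continuous_on {a..b} h"
  shows "cfc h T"
proof -
  obtain a b c d where "real_spectrum T \<subseteq> {a..b}" "continuous_on {a..b} f"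
    "real_spectrum T \<subseteq> {c..d}" "continuous_on {c..d} g"
    using assms by (auto simp: cfc_def)
  then have "real_spectrum T \<subseteq> {max a c..min b d}" by (auto simp: subset_iff)
  moreover have "continuous_on {max a c..min b d} f"
    "continuous_on {max a c..min b d} g"
    using \<open>continuous_on {a..b} f\<close> \<open>continuous_on {c..d} g\<close> by (auto elim: continuous_on_subset)
  ultimately show ?thesis using assms h by (intro cfcI[of T "max a c" "min b d"]) (auto simp: cfc_def)
qed

lemma cfc_add: "cfc f T \<Longrightarrow> cfc g T \<Longrightarrow> cfc (\<lambda>t. f t + g t) T"
  and cfc_diff: "cfc f T \<Longrightarrow> cfc g T \<Longrightarrow> cfc (\<lambda>t. f t - g t) T"
  and cfc_mult: "cfc f T \<Longrightarrow> cfc g T \<Longrightarrow> cfc (\<lambda>t. f t * g t) T"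
  by (erule (1) cfc_binary; intro continuous_intros; assumption)+

lemma cfc_const: "self_adjoint T \<Longrightarrow> cfc (\<lambda>t. c) T"
  and cfc_poly: "self_adjoint T \<Longrightarrow> cfc (poly q) T"
  by (intro cfc_continuous continuous_intros; assumption)+

lemma cfc_cmult: "cfc f T \<Longrightarrow> cfc (\<lambda>t. c * f t) T"
  by (intro cfc_mult cfc_const) (auto simp: cfc_def)

lemma cfc_compose:
  assumes "cfc f T" "continuous_on UNIV g"
  shows "cfc (\<lambda>t. g (f t)) T"
  by (rule cfc_binary[OF assms(1) assms(1)]) (rule continuous_on_compose2[OF assms(2)], auto)

lemma ex_poly_uniform_limit:
  fixes f :: "real \<Rightarrow> real"
  assumes "continuous_on {a..b} f"
  shows "\<exists>q. uniform_limit {a..b} (\<lambda>n. poly (q n)) f sequentially"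
proof -
  have "\<exists>q. \<forall>x\<in>{a..b}. \<bar>f x - poly q x\<bar> < e" if "e > 0" for e
  proof -
    obtain g where g: "real_polynomial_function g" "\<And>x. x \<in> {a..b} \<Longrightarrow> \<bar>f x - g x\<bar> < e"
      using Stone_Weierstrass_real_polynomial_function[OF _ assms \<open>e > 0\<close>] by auto
    then obtain c n where c: "g = (\<lambda>x. \<Sum>i\<le>n. c i * x ^ i)"
      using real_polynomial_function_iff_sum by blast
    have "poly (\<Sum>i\<le>n. monom (c i) i) x = g x" for x by (simp add: c poly_sum poly_monom)
    then show ?thesis using g by metis
  qed
  then have "\<forall>n. \<exists>q. \<forall>x\<in>{a..b}. \<bar>f x - poly q x\<bar> < inverse (real (Suc n))" by simp
  then obtain q where q: "\<And>n x. x \<in> {a..b} \<Longrightarrow> \<bar>f x - poly (q n) x\<bar> < inverse (real (Suc n))" by metis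
  have "uniform_limit {a..b} (\<lambda>n. poly (q n)) f sequentially"
  proof (rule uniform_limitI)
    fix e :: real assume "e > 0"
    then have "\<forall>\<^sub>F n in sequentially. inverse (real (Suc n)) < e"
      using LIMSEQ_inverse_real_of_nat order_tendstoD(2) by blast
    then show "\<forall>\<^sub>F n in sequentially. \<forall>x\<in>{a..b}. dist (poly (q n) x) (f x) < e"
      by eventually_elim (metis q dist_real_def abs_minus_commute order_less_trans)
  qed
  then show ?thesis by blast
qed

lemma ex_poly_limit:
  assumes "cfc f T"
  shows "\<exists>q. uniform_limit (real_spectrum T) (\<lambda>n. poly (q n)) f sequentially"
  using assms ex_poly_uniform_limit uniform_limit_on_subset unfolding cfc_def by blast

text \<open>Approximants of the same \<open>f\<close> are close on the spectrum, hence in operator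
  norm. The nested quantifiers allow the two limits to be taken one after the other.\<close>

lemma op_poly_diff_null:
  assumes T: "self_adjoint T" and q: "uniform_limit (real_spectrum T) (\<lambda>n. poly (q n)) f sequentially"
    and e: "e > 0" and r: "\<forall>\<^sub>F n in F. \<forall>t\<in>real_spectrum T. \<bar>poly (r n) t - f t\<bar> \<le> e"
  shows "\<forall>\<^sub>F m in sequentially. \<forall>\<^sub>F n in F. norm (op_poly (q m) T - op_poly (r n) T) \<le> 2 * e"
  using uniform_limitD[OF q e]
proof eventually_elim
  case (elim m)
  from r show ?case
  proof eventually_elim
    case (elim n)
    have "norm (op_poly (q m - r n) T) \<le> 2 * e"
    proof (rule norm_op_poly_le[OF T])
      fix t assume "t \<in> real_spectrum T"
      then have "\<bar>poly (q m) t - f t\<bar> < e" "\<bar>poly (r n) t - f t\<bar> \<le> e"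
        using elim \<open>\<forall>x\<in>real_spectrum T. dist (poly (q m) x) (f x) < e\<close> by (auto simp: dist_real_def)
      then show "\<bar>poly (q m - r n) t\<bar> \<le> 2 * e" by simp
    qed (use e in simp)
    then show ?case by (simp add: op_poly_diff self_adjointD[OF T])
  qed
qed

text \<open>Resolves the definite description in \<open>op_fun\<close>: the limit does not depend on
  the approximating sequence, so one sequence with a known limit identifies the operator.\<close>

lemma op_fun_eqI:
  assumes T: "self_adjoint T" and q: "uniform_limit (real_spectrum T) (\<lambda>n. poly (q n)) f sequentially"
    and S: "(\<lambda>n. op_poly (q n) T) \<longlonglongrightarrow> S"
  shows "op_fun f T = S"
  unfolding op_fun_def
proof (rule the_equality)
  show "\<exists>q. uniform_limit (real_spectrum T) (\<lambda>n. poly (q n)) f sequentially \<and> (\<lambda>n. op_poly (q n) T) \<longlonglongrightarrow> S"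
    using q S by blast
next
  fix R
  assume "\<exists>q. uniform_limit (real_spectrum T) (\<lambda>n. poly (q n)) f sequentially \<and> (\<lambda>n. op_poly (q n) T) \<longlonglongrightarrow> R"
  then obtain r where r: "uniform_limit (real_spectrum T) (\<lambda>n. poly (r n)) f sequentially"
    and R: "(\<lambda>n. op_poly (r n) T) \<longlonglongrightarrow> R" by blast
  have "norm (S - R) \<le> 2 * e" if e: "e > 0" for e
  proof -
    have "\<forall>\<^sub>F n in sequentially. \<forall>t\<in>real_spectrum T. \<bar>poly (r n) t - f t\<bar> \<le> e"
      using uniform_limitD[OF r e] by eventually_elim (auto simp: dist_real_def intro: less_imp_le)
    from op_poly_diff_null[OF T q e this]
    have "\<forall>\<^sub>F m in sequentially. norm (op_poly (q m) T - R) \<le> 2 * e"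
    proof eventually_elim
      case (elim m)
      have "(\<lambda>n. norm (op_poly (q m) T - op_poly (r n) T)) \<longlonglongrightarrow> norm (op_poly (q m) T - R)"
        by (intro tendsto_intros R)
      then show ?case using elim by (rule tendsto_upperbound) simp
    qed
    moreover have "(\<lambda>m. norm (op_poly (q m) T - R)) \<longlonglongrightarrow> norm (S - R)"
      by (intro tendsto_intros S)
    ultimately show ?thesis by (intro tendsto_upperbound) auto
  qed
  \<comment> \<open>With this \<open>e\<close> the bound says that the norm is at most half of
    itself.\<close>
  from this[of "norm (S - R) / 4"] show "R = S" by (cases "S = R") auto
qed

lemma op_fun_limit:
  assumes T: "self_adjoint T" and q: "uniform_limit (real_spectrum T) (\<lambda>n. poly (q n)) f sequentially"
  shows "(\<lambda>n. op_poly (q n) T) \<longlonglongrightarrow> op_fun f T"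
proof -
  have "Cauchy (\<lambda>n. op_poly (q n) T)"
  proof (rule CauchyI)
    fix e :: real assume e: "e > 0"
    have "\<forall>\<^sub>F n in sequentially. \<forall>t\<in>real_spectrum T. dist (poly (q n) t) (f t) < e / 3"
      using uniform_limitD[OF q, of "e / 3"] e by simp
    then obtain M where M: "\<And>n t. n \<ge> M \<Longrightarrow> t \<in> real_spectrum T \<Longrightarrow> dist (poly (q n) t) (f t) < e / 3"
      by (auto simp: eventually_sequentially)
    have "norm (op_poly (q m) T - op_poly (q n) T) < e" if mn: "m \<ge> M" "n \<ge> M" for m n
    proof -
      have "norm (op_poly (q m - q n) T) \<le> 2 * (e / 3)"
      proof (rule norm_op_poly_le[OF T])
        fix t assume t: "t \<in> real_spectrum T"
        show "\<bar>poly (q m - q n) t\<bar> \<le> 2 * (e / 3)"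
          using M[OF mn(1) t] M[OF mn(2) t] unfolding dist_real_def poly_diff by linarith
      qed (use e in simp)
      then show ?thesis using e by (simp add: op_poly_diff self_adjointD[OF T])
    qed
    then show "\<exists>M. \<forall>m\<ge>M. \<forall>n\<ge>M. norm (op_poly (q m) T - op_poly (q n) T) < e" by blast
  qed
  then obtain S where "(\<lambda>n. op_poly (q n) T) \<longlonglongrightarrow> S" using Cauchy_convergent_iff convergent_def by blast
  then show ?thesis using op_fun_eqI[OF T q] by simp
qed

lemma op_fun_cong:
  assumes "\<And>t. t \<in> real_spectrum T \<Longrightarrow> f t = g t"
  shows "op_fun f T = op_fun g T"
proof -
  have "uniform_limit (real_spectrum T) h f F \<longleftrightarrow> uniform_limit (real_spectrum T) h g F"
    for h :: "nat \<Rightarrow> real \<Rightarrow> real" and F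
    by (rule uniform_limit_cong') (auto simp: assms)
  then show ?thesis by (simp only: op_fun_def)
qed

lemma op_fun_poly: "self_adjoint T \<Longrightarrow> op_fun (poly q) T = op_poly q T"
  by (rule op_fun_eqI[of _ "\<lambda>_. q"]) (auto intro: uniform_limit_const)

lemma op_fun_const: "self_adjoint T \<Longrightarrow> op_fun (\<lambda>t. c) T = c *\<^sub>R id_blinfun"
proof -
  assume "self_adjoint T"
  moreover have "(\<lambda>t. c) = poly [:c:]" by auto
  ultimately show ?thesis by (simp only: op_fun_poly op_poly_const)
qed

lemma op_fun_ident: "self_adjoint T \<Longrightarrow> op_fun (\<lambda>t. t) T = T"
proof -
  assume T: "self_adjoint T"
  have "(\<lambda>t. t) = poly [:0, 1 :: real:]" by (intro ext) simp
  then have "op_fun (\<lambda>t. t) T = op_poly [:0, 1:] T" by (simp only: op_fun_poly[OF T])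
  also have "\<dots> = T" by (simp add: op_poly_pCons self_adjointD[OF T] op_distribs)
  finally show ?thesis .
qed

lemma op_fun_add:
  assumes "cfc f T" "cfc g T"
  shows "op_fun (\<lambda>t. f t + g t) T = op_fun f T + op_fun g T"
proof -
  have T: "self_adjoint T" using assms by (simp add: cfc_def)
  obtain q r where q: "uniform_limit (real_spectrum T) (\<lambda>n. poly (q n)) f sequentially"
    and r: "uniform_limit (real_spectrum T) (\<lambda>n. poly (r n)) g sequentially"
    using ex_poly_limit assms by metis
  have eq: "poly (q n + r n) = (\<lambda>x. poly (q n) x + poly (r n) x)" for n by (intro ext) simp
  show ?thesis
    using uniform_limit_add[OF q r] tendsto_add[OF op_fun_limit[OF T q] op_fun_limit[OF T r]]
    by (intro op_fun_eqI[OF T, of "\<lambda>n. q n + r n"]) (simp_all add: eq op_poly_add)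
qed

lemma cfc_bounded: "cfc f T \<Longrightarrow> bounded (f ` real_spectrum T)"
  unfolding cfc_def by (meson bounded_subset compact_Icc compact_continuous_image compact_imp_bounded image_mono)

lemma op_fun_mult:
  assumes "cfc f T" "cfc g T"
  shows "op_fun (\<lambda>t. f t * g t) T = op_fun f T o\<^sub>L op_fun g T"
proof -
  have T: "self_adjoint T" using assms by (simp add: cfc_def)
  obtain q r where q: "uniform_limit (real_spectrum T) (\<lambda>n. poly (q n)) f sequentially"
    and r: "uniform_limit (real_spectrum T) (\<lambda>n. poly (r n)) g sequentially"
    using ex_poly_limit assms by metis
  have eq: "poly (q n * r n) = (\<lambda>x. poly (q n) x * poly (r n) x)" for n by (intro ext) simp
  show ?thesis
    using uniform_lim_mult[OF q r cfc_bounded[OF assms(1)] cfc_bounded[OF assms(2)]]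
      blinfun_compose.tendsto[OF op_fun_limit[OF T q] op_fun_limit[OF T r]]
    by (intro op_fun_eqI[OF T, of "\<lambda>n. q n * r n"]) (simp_all add: eq op_poly_mult self_adjointD[OF T])
qed

lemma op_fun_cmult: "cfc f T \<Longrightarrow> op_fun (\<lambda>t. c * f t) T = c *\<^sub>R op_fun f T"
  using op_fun_mult[of "\<lambda>t. c" T f] by (simp add: cfc_const cfc_self_adjoint op_fun_const op_distribs)

lemma op_fun_diff:
  assumes "cfc f T" "cfc g T"
  shows "op_fun (\<lambda>t. f t - g t) T = op_fun f T - op_fun g T"
  using op_fun_add[OF assms(1) cfc_cmult[OF assms(2), of "-1"]] op_fun_cmult[OF assms(2), of "-1"]
  by simp

text \<open>A common interval for both spectra lets one polynomial sequence approximate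
  \<open>f\<close> on both, so the relation passes from polynomials to the limit.
  \<open>X = Y\<close> gives commutation.\<close>

lemma op_fun_intertwine:
  fixes X Y B :: "'h::complex_hilbert \<Rightarrow>\<^sub>L 'h"
  assumes SA: "self_adjoint X" "self_adjoint Y"
    and ab: "real_spectrum X \<subseteq> {a..b}" "real_spectrum Y \<subseteq> {a..b}" "continuous_on {a..b} f"
    and XY: "X o\<^sub>L B = B o\<^sub>L Y"
  shows "op_fun f X o\<^sub>L B = B o\<^sub>L op_fun f Y"
proof -
  obtain q where q: "uniform_limit {a..b} (\<lambda>n. poly (q n)) f sequentially"
    using ex_poly_uniform_limit[OF ab(3)] by blast
  have "(\<lambda>n. op_poly (q n) X o\<^sub>L B) \<longlonglongrightarrow> (op_fun f X o\<^sub>L B)"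
    by (intro blinfun_compose.tendsto tendsto_const op_fun_limit SA uniform_limit_on_subset[OF q] ab)
  moreover have "(\<lambda>n. B o\<^sub>L op_poly (q n) Y) \<longlonglongrightarrow> (B o\<^sub>L op_fun f Y)"
    by (intro blinfun_compose.tendsto tendsto_const op_fun_limit SA uniform_limit_on_subset[OF q] ab)
  moreover have "op_poly (q n) X o\<^sub>L B = B o\<^sub>L op_poly (q n) Y" for n
    by (intro op_poly_intertwine XY self_adjointD SA)
  ultimately show ?thesis using LIMSEQ_unique by simp
qed

lemma op_fun_commute:
  fixes T B :: "'h::complex_hilbert \<Rightarrow>\<^sub>L 'h"
  assumes "cfc f T" "T o\<^sub>L B = B o\<^sub>L T"
  shows "op_fun f T o\<^sub>L B = B o\<^sub>L op_fun f T"
  using assms op_fun_intertwine unfolding cfc_def by blast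

text \<open>Complex linearity is commutation with the scalar operators, which \<open>op_fun\<close>
  inherits from \<open>T\<close>.\<close>

lemma op_fun_bounded_ops:
  assumes "cfc f T"
  shows "op_fun f T \<in> bounded_ops"
proof -
  have "T \<in> bounded_ops" using assms cfc_self_adjoint self_adjointD by blast
  then have "op_fun f T o\<^sub>L scalar_op c = scalar_op c o\<^sub>L op_fun f T" for c
    by (intro op_fun_commute assms scalar_op_commute)
  then have "blinfun_apply (op_fun f T o\<^sub>L scalar_op c) x = blinfun_apply (scalar_op c o\<^sub>L op_fun f T) x" for c x
    by simp
  then show ?thesis by (simp add: bounded_ops_def)
qed

lemma op_fun_self_adjoint:
  assumes f: "cfc f T"
  shows "self_adjoint (op_fun f T)"
proof -
  have T: "self_adjoint T" using f by (rule cfc_self_adjoint)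
  obtain q where q: "uniform_limit (real_spectrum T) (\<lambda>n. poly (q n)) f sequentially"
    using ex_poly_limit[OF f] by blast
  note lim = op_fun_limit[OF T q]
  have "op_adj (op_fun f T) = op_fun f T"
  proof (rule op_adj_unique)
    fix x y
    have "(\<lambda>n. cinner (blinfun_apply (op_poly (q n) T) x) y) \<longlonglongrightarrow> cinner (blinfun_apply (op_fun f T) x) y"
      by (intro cinner.tendsto blinfun.tendsto tendsto_const lim)
    moreover have "(\<lambda>n. cinner x (blinfun_apply (op_poly (q n) T) y)) \<longlonglongrightarrow> cinner x (blinfun_apply (op_fun f T) y)"
      by (intro cinner.tendsto blinfun.tendsto tendsto_const lim)
    ultimately show "cinner (blinfun_apply (op_fun f T) x) y = cinner x (blinfun_apply (op_fun f T) y)"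
      using LIMSEQ_unique by (simp add: self_adjoint_cinner[OF op_poly_self_adjoint[OF T]])
  qed
  then show ?thesis using op_fun_bounded_ops[OF f] by (simp add: self_adjoint_def)
qed

lemma norm_op_fun_le:
  assumes f: "cfc f T" and e: "0 \<le> e" and le: "\<And>t. t \<in> real_spectrum T \<Longrightarrow> \<bar>f t\<bar> \<le> e"
  shows "norm (op_fun f T) \<le> e"
proof (rule field_le_epsilon)
  fix d :: real assume d: "d > 0"
  have T: "self_adjoint T" using f by (rule cfc_self_adjoint)
  obtain q where q: "uniform_limit (real_spectrum T) (\<lambda>n. poly (q n)) f sequentially"
    using ex_poly_limit[OF f] by blast
  have "\<forall>\<^sub>F n in sequentially. norm (op_poly (q n) T) \<le> e + d"
    using uniform_limitD[OF q d]
  proof eventually_elim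
    case (elim n)
    show ?case
    proof (rule norm_op_poly_le[OF T])
      fix t assume t: "t \<in> real_spectrum T"
      have "\<bar>poly (q n) t - f t\<bar> < d" using elim t by (auto simp: dist_real_def)
      then show "\<bar>poly (q n) t\<bar> \<le> e + d" using le[OF t] by linarith
    qed (use d e in simp)
  qed
  moreover have "(\<lambda>n. norm (op_poly (q n) T)) \<longlonglongrightarrow> norm (op_fun f T)"
    by (intro tendsto_intros op_fun_limit T q)
  ultimately show "norm (op_fun f T) \<le> e + d" by (intro tendsto_upperbound) auto
qed

text \<open>Subtracting the midpoint of the interval turns the enclosure into a norm bound by half
  its length.\<close>

lemma real_spectrum_op_fun:
  assumes f: "cfc f T" and le: "\<And>t. t \<in> real_spectrum T \<Longrightarrow> f t \<in> {c..d}"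
  shows "real_spectrum (op_fun f T) \<subseteq> {c..d}"
proof (cases "c \<le> d")
  case True
  have T: "self_adjoint T" using f by (rule cfc_self_adjoint)
  have "norm (op_fun (\<lambda>t. f t - (c + d) / 2) T) \<le> (d - c) / 2"
  proof (rule norm_op_fun_le)
    show "\<bar>f t - (c + d) / 2\<bar> \<le> (d - c) / 2" if "t \<in> real_spectrum T" for t
      using le[OF that] unfolding abs_le_iff by (auto simp: field_simps)
  qed (use True in \<open>auto intro!: cfc_diff f cfc_const T\<close>)
  then have "norm (op_fun f T - ((c + d) / 2) *\<^sub>R id_blinfun) \<le> (d - c) / 2"
    by (simp add: op_fun_diff f cfc_const T op_fun_const)
  from real_spectrum_subset[OF op_fun_self_adjoint[OF f] this]
  show ?thesis by (simp add: field_simps)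
next
  case False
  \<comment> \<open>Here \<open>T\<close> has no real spectral point, so \<open>op_fun f T\<close>
    is at distance zero from every multiple of the identity; the enclosures {0} and {1} together
    leave nothing.\<close>
  have "norm (op_fun f T - r *\<^sub>R id_blinfun) \<le> 0" for r
  proof -
    have "norm (op_fun (\<lambda>t. f t - r) T) \<le> 0"
    proof (rule norm_op_fun_le)
      show "\<bar>f t - r\<bar> \<le> 0" if "t \<in> real_spectrum T" for t
        using le[OF that] False by simp
    qed (intro cfc_diff f cfc_const cfc_self_adjoint[OF f], simp)
    then show ?thesis using f by (simp add: op_fun_diff cfc_const cfc_self_adjoint op_fun_const)
  qed
  from real_spectrum_subset[OF op_fun_self_adjoint[OF f] this] have "real_spectrum (op_fun f T) \<subseteq> {r..r}" for r
    by simp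
  from Int_greatest[OF this[of 0] this[of 1]] have "real_spectrum (op_fun f T) \<subseteq> {}" by simp
  then show ?thesis by blast
qed

lemma op_poly_op_fun:
  assumes f: "cfc f T"
  shows "cfc (\<lambda>t. poly q (f t)) T" "op_poly q (op_fun f T) = op_fun (\<lambda>t. poly q (f t)) T"
proof -
  have T: "self_adjoint T" using f by (rule cfc_self_adjoint)
  show c: "cfc (\<lambda>t. poly q (f t)) T" for q
    by (rule cfc_compose[OF f]) (intro continuous_intros)
  show "op_poly q (op_fun f T) = op_fun (\<lambda>t. poly q (f t)) T"
  proof (induction q)
    case 0
    then show ?case using op_fun_const[OF T, of 0] by simp
  next
    case (pCons a q)
    then show ?case
      by (simp add: op_poly_pCons op_fun_bounded_ops f op_fun_add op_fun_mult cfc_const cfc_mult T c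
          op_fun_const)
  qed
qed

text \<open>True for polynomial \<open>g\<close> by algebra. Approximants of \<open>g\<close> on
  \<open>{c..d}\<close> remain uniformly close after inserting \<open>f\<close>, because its values
  on the spectrum lie there.\<close>

lemma op_fun_op_fun:
  assumes f: "cfc f T" and fcd: "\<And>t. t \<in> real_spectrum T \<Longrightarrow> f t \<in> {c..d}"
    and g: "continuous_on {c..d} g" and gf: "cfc (\<lambda>t. g (f t)) T"
  shows "op_fun g (op_fun f T) = op_fun (\<lambda>t. g (f t)) T"
proof -
  have T: "self_adjoint T" using f by (rule cfc_self_adjoint)
  obtain q where q: "uniform_limit {c..d} (\<lambda>n. poly (q n)) g sequentially"
    using ex_poly_uniform_limit[OF g] by blast
  show ?thesis
  proof (rule op_fun_eqI[OF op_fun_self_adjoint[OF f]])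
    show "uniform_limit (real_spectrum (op_fun f T)) (\<lambda>n. poly (q n)) g sequentially"
      by (rule uniform_limit_on_subset[OF q real_spectrum_op_fun[OF f fcd]])
    show "(\<lambda>n. op_poly (q n) (op_fun f T)) \<longlonglongrightarrow> op_fun (\<lambda>t. g (f t)) T"
    proof (rule LIMSEQ_I)
      fix e :: real assume e: "e > 0"
      have "\<forall>\<^sub>F n in sequentially. norm (op_poly (q n) (op_fun f T) - op_fun (\<lambda>t. g (f t)) T) < e"
        using uniform_limitD[OF q half_gt_zero[OF e]]
      proof eventually_elim
        case (elim n)
        have "norm (op_fun (\<lambda>t. poly (q n) (f t) - g (f t)) T) \<le> e / 2"
          using elim fcd e
          by (intro norm_op_fun_le cfc_diff op_poly_op_fun f gf) (auto simp: dist_real_def less_imp_le)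
        then show ?case using e by (simp add: op_fun_diff op_poly_op_fun f gf)
      qed
      then show "\<exists>no. \<forall>n\<ge>no. norm (op_poly (q n) (op_fun f T) - op_fun (\<lambda>t. g (f t)) T) < e"
        by (simp add: eventually_sequentially)
    qed
  qed
qed

lemma positive_op_compose_adj:
  assumes "T \<in> bounded_ops"
  shows "positive_op (op_adj T o\<^sub>L T)"
  using assms by (simp add: positive_op_def cinner_op_adj_left cinner_self nonneg_Reals_of_real_iff del: of_real_power)

lemma op_fun_positive:
  assumes f: "cfc f T" and nonneg: "\<And>t. t \<in> real_spectrum T \<Longrightarrow> 0 \<le> f t"
  shows "positive_op (op_fun f T)"
proof -
  \<comment> \<open>The real function \<open>sqrt\<close> is continuous on the whole line in HOL, so
    negative values of \<open>f\<close> off the spectrum do no harm.\<close>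
  have c: "cfc (\<lambda>t. sqrt (f t)) T"
    by (rule cfc_compose[OF f]) (intro continuous_intros)
  have "op_fun f T = op_fun (\<lambda>t. sqrt (f t) * sqrt (f t)) T"
    by (rule op_fun_cong) (simp add: nonneg)
  also have "\<dots> = op_adj (op_fun (\<lambda>t. sqrt (f t)) T) o\<^sub>L op_fun (\<lambda>t. sqrt (f t)) T"
    using op_fun_mult[OF c c] self_adjointD[OF op_fun_self_adjoint[OF c]] by simp
  finally show ?thesis by (simp add: positive_op_compose_adj op_fun_bounded_ops c)
qed

lemma real_spectrum_approx_eigenvector:
  assumes T: "self_adjoint T" and t: "t \<in> real_spectrum T" and d: "d > 0"
  shows "\<exists>x. norm (blinfun_apply T x - t *\<^sub>R x) < d * norm x"
  using not_in_real_spectrum[OF T d] t by (meson not_less)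

text \<open>A spectral point \<open>t\<close> has approximate eigenvectors. Since
  \<open>q - q(t)\<close> is divisible by the linear factor at \<open>t\<close>, a polynomial
  \<open>q\<close> of the operator acts on them almost as the number \<open>q(t)\<close>, and so
  does its limit \<open>f\<close>.\<close>

lemma op_fun_eq_0_imp:
  assumes f: "cfc f T" and zero: "op_fun f T = 0" and t: "t \<in> real_spectrum T"
  shows "f t = 0"
proof -
  have T: "self_adjoint T" using f by (rule cfc_self_adjoint)
  have TB: "T \<in> bounded_ops" by (rule self_adjointD[OF T])
  obtain q where q: "uniform_limit (real_spectrum T) (\<lambda>n. poly (q n)) f sequentially"
    using ex_poly_limit[OF f] by blast
  have "\<bar>f t\<bar> \<le> 0 + e" if e: "e > 0" for e
  proof -
    have e3: "e / 3 > 0" using e by simp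
    obtain n where n: "\<And>s. s \<in> real_spectrum T \<Longrightarrow> \<bar>poly (q n) s - f s\<bar> < e / 3"
      using eventually_happens'[OF sequentially_bot uniform_limitD[OF q e3]] by (auto simp: dist_real_def)
    have "norm (op_fun (\<lambda>s. poly (q n) s - f s) T) \<le> e / 3"
      using e by (intro norm_op_fun_le cfc_diff cfc_poly f T less_imp_le[OF n]) auto
    then have qn: "norm (op_poly (q n) T) \<le> e / 3"
      by (simp add: op_fun_diff f cfc_poly T op_fun_poly zero)
    obtain r where r: "q n - [:poly (q n) t:] = [:-t, 1:] * r"
      using poly_eq_0_iff_dvd[of "q n - [:poly (q n) t:]" t] by (auto elim: dvdE)
    define R where "R = op_poly r T"
    have "op_poly (q n) T - poly (q n) t *\<^sub>R id_blinfun = op_poly (r * [:-t, 1:]) T"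
      using arg_cong[OF r, of "\<lambda>p. op_poly p T"] by (simp add: op_poly_diff TB op_poly_const mult.commute)
    also have "\<dots> = R o\<^sub>L (T - t *\<^sub>R id_blinfun)"
      unfolding op_poly_mult[OF TB] by (simp add: R_def op_poly_pCons TB op_distribs)
    finally have eq: "poly (q n) t *\<^sub>R x = blinfun_apply (op_poly (q n) T) x - blinfun_apply R (blinfun_apply T x - t *\<^sub>R x)" for x
      by (metis (no_types, lifting) blinfun.diff_left blinfun.scaleR_left blinfun_apply_blinfun_compose
          diff_diff_eq2 add_diff_cancel_left' id_blinfun.rep_eq id_apply diff_add_cancel)
    \<comment> \<open>Chosen so that \<open>norm R * d\<close> is at most \<open>e / 3\<close>; the
      other two thirds are the norm of \<open>op_poly (q n) T\<close> and the approximation error at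
      \<open>t\<close>.\<close>
    define d where "d = e / 3 / (norm R + 1)"
    have d: "d > 0" using e by (simp add: d_def add_nonneg_pos)
    obtain x where x: "norm (blinfun_apply T x - t *\<^sub>R x) < d * norm x"
      using real_spectrum_approx_eigenvector[OF T t d] by blast
    have x0: "norm x > 0" using x d
      by (metis norm_ge_zero order_le_less_trans zero_less_mult_pos)
    have "\<bar>poly (q n) t\<bar> * norm x = norm (poly (q n) t *\<^sub>R x)" by simp
    also have "\<dots> \<le> norm (blinfun_apply (op_poly (q n) T) x) + norm (blinfun_apply R (blinfun_apply T x - t *\<^sub>R x))"
      unfolding eq by (rule norm_triangle_ineq4)
    also have "\<dots> \<le> e / 3 * norm x + norm R * (d * norm x)"
    proof (rule add_mono)
      show "norm (blinfun_apply (op_poly (q n) T) x) \<le> e / 3 * norm x"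
        by (rule order_trans[OF norm_blinfun]) (intro mult_right_mono qn, simp)
      show "norm (blinfun_apply R (blinfun_apply T x - t *\<^sub>R x)) \<le> norm R * (d * norm x)"
        by (rule order_trans[OF norm_blinfun]) (use x in \<open>intro mult_left_mono, simp_all\<close>)
    qed
    also have "\<dots> = (e / 3 + norm R * d) * norm x" by (simp add: algebra_simps)
    finally have "\<bar>poly (q n) t\<bar> \<le> e / 3 + norm R * d" using x0 by simp
    also have "norm R * d \<le> e / 3"
    proof -
      have "norm R * d = e / 3 * (norm R / (norm R + 1))" by (simp add: d_def)
      also have "\<dots> \<le> e / 3 * 1" using e by (intro mult_left_mono) (auto simp: divide_simps add_nonneg_pos)
      finally show ?thesis by simp
    qed
    finally show ?thesis using n[OF t] by linarith
  qed
  then have "\<bar>f t\<bar> \<le> 0" by (rule field_le_epsilon)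
  then show ?thesis by simp
qed

lemma op_poly_eq_0_of_spectrum:
  assumes T: "self_adjoint T" and "\<And>t. t \<in> real_spectrum T \<Longrightarrow> poly q t = 0"
  shows "op_poly q T = 0"
  using norm_op_poly_le[OF T, of 0 q] assms(2) by simp

section \<open>Von Neumann algebras with a faithful trace\<close>

definition re_op :: "('h::complex_hilbert \<Rightarrow>\<^sub>L 'h) \<Rightarrow> ('h \<Rightarrow>\<^sub>L 'h)" where
  "re_op W = (1 / 2) *\<^sub>R (W + op_adj W)"

lemma re_op_self_adjoint: "W \<in> bounded_ops \<Longrightarrow> self_adjoint (re_op W)"
  by (simp add: re_op_def self_adjoint_def add.commute)

lemma re_op_of_self_adjoint: "self_adjoint W \<Longrightarrow> re_op W = W"
  by (simp add: re_op_def self_adjoint_def scaleR_2[symmetric])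

lemma re_op_minus: "W \<in> bounded_ops \<Longrightarrow> re_op (- W) = - re_op W"
  by (simp add: re_op_def scaleR_diff_right scaleR_add_right)

lemma norm_isometry_le:
  fixes W :: "'h::complex_hilbert \<Rightarrow>\<^sub>L 'h"
  assumes W: "W \<in> bounded_ops" "op_adj W o\<^sub>L W = id_blinfun"
  shows "norm W \<le> 1"
proof (rule norm_blinfun_bound)
  fix x
  have "complex_of_real ((norm (blinfun_apply W x))\<^sup>2) = cinner x (blinfun_apply (op_adj W o\<^sub>L W) x)"
    unfolding cinner_self[symmetric] by (simp add: cinner_op_adj[OF W(1)])
  also have "\<dots> = complex_of_real ((norm x)\<^sup>2)" unfolding W(2) cinner_self[symmetric] by simp
  finally have "(norm (blinfun_apply W x))\<^sup>2 = (norm x)\<^sup>2" using of_real_eq_iff by blast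
  then show "norm (blinfun_apply W x) \<le> 1 * norm x" by (simp add: power2_eq_iff_nonneg)
qed simp

lemma op_fun_scalar:
  "op_fun f (r *\<^sub>R id_blinfun) = f r *\<^sub>R (id_blinfun :: 'h::complex_hilbert \<Rightarrow>\<^sub>L 'h)"
proof -
  let ?T = "r *\<^sub>R id_blinfun :: 'h \<Rightarrow>\<^sub>L 'h"
  have T: "self_adjoint ?T" by (simp add: self_adjoint_def)
  have "real_spectrum ?T \<subseteq> {r - 0..r + 0}" by (rule real_spectrum_subset[OF T]) simp
  then have "op_fun f ?T = op_fun (\<lambda>t. f r) ?T" by (intro op_fun_cong) auto
  then show ?thesis by (simp add: op_fun_const T)
qed

locale traced_algebra =
  fixes N :: "('h::complex_hilbert \<Rightarrow>\<^sub>L 'h) set" and \<tau> :: "('h \<Rightarrow>\<^sub>L 'h) \<Rightarrow> complex"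
  assumes vN: "von_neumann_algebra N" and tr: "is_trace_of \<tau> N"
begin

lemma N_bounded [simp]: "A \<in> N \<Longrightarrow> A \<in> bounded_ops"
  using vN by (auto simp: von_neumann_algebra_def)

lemma N_basic [simp]:
  "id_blinfun \<in> N" "A \<in> N \<Longrightarrow> B \<in> N \<Longrightarrow> A + B \<in> N" "A \<in> N \<Longrightarrow> B \<in> N \<Longrightarrow> A o\<^sub>L B \<in> N"
  "A \<in> N \<Longrightarrow> scalar_op c o\<^sub>L A \<in> N" "A \<in> N \<Longrightarrow> op_adj A \<in> N"
  using vN by (auto simp: von_neumann_algebra_def)

lemma N_scalar [simp]: "scalar_op c \<in> N"
  using N_basic(4)[OF N_basic(1), of c] by simp

lemma N_scaleR [simp]: "A \<in> N \<Longrightarrow> r *\<^sub>R A \<in> N"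
  using N_basic(4)[of A "complex_of_real r"] by (simp add: scalar_op_of_real op_distribs)

lemma N_diff [simp]: "A \<in> N \<Longrightarrow> B \<in> N \<Longrightarrow> A - B \<in> N"
  using N_basic(2)[OF _ N_scaleR[of B "-1"], of A] by simp

lemma N_minus [simp]: "A \<in> N \<Longrightarrow> - A \<in> N"
  using N_scaleR[of A "-1"] by simp

lemma N_re_op [simp]: "A \<in> N \<Longrightarrow> re_op A \<in> N"
  by (simp add: re_op_def)

text \<open>The bicommutant condition as a membership test: it brings functions of elements of
  \<open>N\<close>, and support projections, back into \<open>N\<close>.\<close>

lemma in_N_iff: "T \<in> N \<longleftrightarrow> T \<in> bounded_ops \<and> (\<forall>B\<in>commutant N. T o\<^sub>L B = B o\<^sub>L T)"
  using vN unfolding von_neumann_algebra_def commutant_def by blast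

lemma op_fun_in_N:
  assumes "cfc f T" "T \<in> N"
  shows "op_fun f T \<in> N"
  unfolding in_N_iff
proof (intro conjI ballI)
  fix B assume "B \<in> commutant N"
  then show "op_fun f T o\<^sub>L B = B o\<^sub>L op_fun f T"
    using assms by (intro op_fun_commute) (auto simp: commutant_def)
qed (rule op_fun_bounded_ops[OF assms(1)])

lemma adj_in_commutant:
  assumes B: "B \<in> commutant N"
  shows "op_adj B \<in> commutant N"
proof -
  have BB: "B \<in> bounded_ops" using B by (simp add: commutant_def)
  have "op_adj B o\<^sub>L A = A o\<^sub>L op_adj B" if A: "A \<in> N" for A
  proof -
    have "B o\<^sub>L op_adj A = op_adj A o\<^sub>L B" using B A by (simp add: commutant_def)
    then have "op_adj (B o\<^sub>L op_adj A) = op_adj (op_adj A o\<^sub>L B)" by simp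
    then show ?thesis using A BB by simp
  qed
  then show ?thesis using BB by (simp add: commutant_def)
qed

text \<open>\<open>P\<close> is the support projection of the positive part of \<open>D\<close>.\<close>

lemma ex_positive_part_projection:
  assumes D: "D \<in> N" "self_adjoint D"
  shows "\<exists>P\<in>N. self_adjoint P \<and> P o\<^sub>L P = P \<and> P o\<^sub>L D = op_fun (\<lambda>t. max 0 t) D \<and>
    (\<forall>B\<in>bounded_ops. B o\<^sub>L D = D o\<^sub>L B \<longrightarrow> op_adj B o\<^sub>L D = D o\<^sub>L op_adj B \<longrightarrow> B o\<^sub>L P = P o\<^sub>L B)"
proof -
  define Dp where "Dp = op_fun (\<lambda>t. max 0 t) D"
  define Dm where "Dm = op_fun (\<lambda>t. max 0 (- t)) D"
  have cp: "cfc (\<lambda>t. max 0 t) D" and cm: "cfc (\<lambda>t. max 0 (- t)) D"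
    by (auto intro!: cfc_continuous D continuous_intros)
  have Dp: "self_adjoint Dp" "Dp \<in> bounded_ops"
    unfolding Dp_def by (rule op_fun_self_adjoint[OF cp], rule op_fun_bounded_ops[OF cp])
  have "Dp - Dm = op_fun (\<lambda>t. max 0 t - max 0 (- t)) D"
    unfolding Dp_def Dm_def by (rule op_fun_diff[OF cp cm, symmetric])
  also have "\<dots> = op_fun (\<lambda>t. t) D" by (rule op_fun_cong) auto
  finally have split: "D = Dp - Dm" by (simp add: op_fun_ident D)
  have "Dp o\<^sub>L Dm = op_fun (\<lambda>t. max 0 t * max 0 (- t)) D"
    unfolding Dp_def Dm_def by (rule op_fun_mult[OF cp cm, symmetric])
  also have "\<dots> = op_fun (\<lambda>t. 0) D" by (rule op_fun_cong) (auto simp: max_def)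
  finally have pm: "Dp o\<^sub>L Dm = 0" by (simp add: op_fun_const D)
  let ?M = "{x. blinfun_apply Dp x = 0}"
  have M: "csubspace ?M" "closed ?M"
    by (auto simp: csubspace_def blinfun.add_right bounded_opsD[OF Dp(2)]
        intro!: closed_Collect_eq continuous_intros)
  obtain Q where Q: "self_adjoint Q" "\<And>x. blinfun_apply Dp (blinfun_apply Q x) = 0"
    "\<And>x. blinfun_apply Dp x = 0 \<Longrightarrow> blinfun_apply Q x = x"
    using ex_projection_onto[OF M] by auto
  note QB = self_adjointD[OF Q(1)] and DpB = self_adjointD[OF Dp(1)]
  have QQ: "Q o\<^sub>L Q = Q" by (rule blinfun_eqI) (simp add: Q)
  have DQ: "Dp o\<^sub>L Q = 0" by (rule blinfun_eqI) (simp add: Q)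
  have "op_adj (Dp o\<^sub>L Q) = Q o\<^sub>L Dp" using QB DpB by simp
  then have QD: "Q o\<^sub>L Dp = 0" using DQ by simp
  \<comment> \<open>\<open>Dm\<close> maps into the kernel of \<open>Dp\<close>, onto which
    \<open>Q\<close> projects, so the complement of \<open>Q\<close> cuts exactly the positive part
    out of \<open>D\<close>.\<close>
  have "blinfun_apply Dp (blinfun_apply Dm x) = 0" for x
    using arg_cong[OF pm, of "\<lambda>T. blinfun_apply T x"] by simp
  then have QDm: "Q o\<^sub>L Dm = Dm" by (intro blinfun_eqI) (simp add: Q)
  define P where "P = id_blinfun - Q"
  have "P o\<^sub>L D = Dp" unfolding P_def split by (simp add: op_distribs QD QDm)
  moreover have "self_adjoint P" "P o\<^sub>L P = P"
    using QB by (auto simp: P_def self_adjoint_def op_distribs QQ)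
  moreover have comm: "B o\<^sub>L P = P o\<^sub>L B"
    if B: "B \<in> bounded_ops" "B o\<^sub>L D = D o\<^sub>L B" "op_adj B o\<^sub>L D = D o\<^sub>L op_adj B" for B
  proof -
    \<comment> \<open>An operator that commutes with \<open>D\<close> leaves the kernel of
      \<open>Dp\<close> invariant. Using this for \<open>B\<close> and for its adjoint turns
      invariance into commutation with \<open>Q\<close>.\<close>
    have inv: "Q o\<^sub>L (C o\<^sub>L Q) = C o\<^sub>L Q" if C: "C o\<^sub>L D = D o\<^sub>L C" for C
    proof (rule blinfun_eqI)
      fix x
      have "Dp o\<^sub>L C = C o\<^sub>L Dp" unfolding Dp_def by (rule op_fun_commute[OF cp C[symmetric]])
      from arg_cong[OF this, of "\<lambda>T. blinfun_apply T (blinfun_apply Q x)"]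
      have "blinfun_apply Dp (blinfun_apply C (blinfun_apply Q x)) = 0"
        by (simp add: Q blinfun.zero_right)
      then show "blinfun_apply (Q o\<^sub>L (C o\<^sub>L Q)) x = blinfun_apply (C o\<^sub>L Q) x" by (simp add: Q)
    qed
    have "op_adj (Q o\<^sub>L (op_adj B o\<^sub>L Q)) = op_adj (op_adj B o\<^sub>L Q)" by (simp only: inv[OF B(3)])
    then have "Q o\<^sub>L (B o\<^sub>L Q) = Q o\<^sub>L B" using B(1) QB by (simp add: blinfun_compose_assoc)
    then have "Q o\<^sub>L B = B o\<^sub>L Q" using inv[OF B(2)] by simp
    then show ?thesis by (simp add: P_def op_distribs)
  qed
  moreover have "P \<in> N"
    unfolding in_N_iff
  proof (intro conjI ballI)
    show "P \<in> bounded_ops" using QB by (simp add: P_def)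
    fix B assume B: "B \<in> commutant N"
    then have "B \<in> bounded_ops" "B o\<^sub>L D = D o\<^sub>L B" "op_adj B o\<^sub>L D = D o\<^sub>L op_adj B"
      using D adj_in_commutant[OF B] by (auto simp: commutant_def)
    then show "P o\<^sub>L B = B o\<^sub>L P" using comm by simp
  qed
  ultimately show ?thesis unfolding Dp_def by blast
qed

section \<open>The trace\<close>

lemma trace_add: "A \<in> N \<Longrightarrow> B \<in> N \<Longrightarrow> \<tau> (A + B) = \<tau> A + \<tau> B"
  and trace_scalar: "A \<in> N \<Longrightarrow> \<tau> (scalar_op c o\<^sub>L A) = c * \<tau> A"
  and trace_id: "\<tau> id_blinfun = 1"
  and trace_commute: "A \<in> N \<Longrightarrow> B \<in> N \<Longrightarrow> \<tau> (A o\<^sub>L B) = \<tau> (B o\<^sub>L A)"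
  using tr by (auto simp: is_trace_of_def tracial_state_def)

lemma trace_scaleR: "A \<in> N \<Longrightarrow> \<tau> (r *\<^sub>R A) = r * \<tau> A"
  using trace_scalar[of A "complex_of_real r"] by (simp add: scalar_op_of_real op_distribs)

lemma trace_diff: "A \<in> N \<Longrightarrow> B \<in> N \<Longrightarrow> \<tau> (A - B) = \<tau> A - \<tau> B"
  using trace_add[of A "(-1) *\<^sub>R B"] trace_scaleR[of B "-1"] by simp

lemma trace_nonneg: "A \<in> N \<Longrightarrow> positive_op A \<Longrightarrow> 0 \<le> Re (\<tau> A)"
  using tr by (auto simp: is_trace_of_def tracial_state_def nonneg_Reals_def)

lemma trace_faithful:
  assumes A: "A \<in> N" "positive_op A" "Re (\<tau> A) \<le> 0"
  shows "A = 0"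
proof -
  have "\<tau> A \<in> \<real>\<^sub>\<ge>\<^sub>0" using tr A by (auto simp: is_trace_of_def tracial_state_def)
  then have "\<tau> A = 0" using A(3) by (auto simp: nonneg_Reals_def)
  then show ?thesis using tr A by (auto simp: is_trace_of_def faithful_on_def)
qed

lemma trace_op_fun_nonneg:
  assumes "cfc f T" "T \<in> N" "\<And>t. t \<in> real_spectrum T \<Longrightarrow> 0 \<le> f t"
  shows "0 \<le> Re (\<tau> (op_fun f T))"
  using assms by (intro trace_nonneg op_fun_in_N op_fun_positive)

text \<open>Together with \<open>op_fun_eq_0_imp\<close> this plays the part of "a nonnegative
  function with integral zero vanishes", with the spectrum as domain.\<close>

lemma trace_op_fun_faithful:
  assumes f: "cfc f T" and T: "T \<in> N" and nonneg: "\<And>t. t \<in> real_spectrum T \<Longrightarrow> 0 \<le> f t"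
    and "Re (\<tau> (op_fun f T)) \<le> 0"
  shows "op_fun f T = 0"
  using assms by (intro trace_faithful op_fun_in_N op_fun_positive)

section \<open>Unitaries and their real parts\<close>

lemma unitaryD:
  assumes "U \<in> unitary_group N"
  shows "U \<in> N" "U \<in> bounded_ops" "op_adj U o\<^sub>L U = id_blinfun" "U o\<^sub>L op_adj U = id_blinfun"
  using assms by (auto simp: unitary_group_def)

lemma unitary_cancel:
  assumes "U \<in> unitary_group N"
  shows "op_adj U o\<^sub>L (U o\<^sub>L A) = A" "U o\<^sub>L (op_adj U o\<^sub>L A) = A"
  using unitaryD[OF assms] by (simp_all add: blinfun_compose_assoc[symmetric])

lemma unitary_compose:
  assumes "U \<in> unitary_group N" "V \<in> unitary_group N"
  shows "U o\<^sub>L V \<in> unitary_group N"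
  using unitaryD[OF assms(1)] unitaryD[OF assms(2)]
  by (simp add: unitary_group_def blinfun_compose_assoc unitary_cancel[OF assms(1)]
      unitary_cancel[OF assms(2)])

lemma unitary_adj: "U \<in> unitary_group N \<Longrightarrow> op_adj U \<in> unitary_group N"
  by (simp add: unitary_group_def)

lemma unitary_scalar: "cmod z = 1 \<Longrightarrow> scalar_op z \<in> unitary_group N"
  by (simp add: unitary_group_def scalar_op_compose complex_norm_square[symmetric] mult.commute[of "cnj z"])

lemma unitary_minus: "U \<in> unitary_group N \<Longrightarrow> - U \<in> unitary_group N"
  by (simp add: unitary_group_def op_distribs)

lemma re_op_unitary:
  assumes "W \<in> unitary_group N"
  shows "self_adjoint (re_op W)" "re_op W \<in> N" "real_spectrum (re_op W) \<subseteq> {-1..1}"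
proof -
  note W = unitaryD[OF assms]
  show sa: "self_adjoint (re_op W)" using W by (intro re_op_self_adjoint)
  show "re_op W \<in> N" using W by simp
  have "norm (re_op W) \<le> 1 / 2 * (norm W + norm (op_adj W))"
    unfolding re_op_def norm_scaleR by (intro mult_mono norm_triangle_ineq) auto
  also have "\<dots> \<le> 1 / 2 * (1 + 1)"
    using W by (intro mult_left_mono add_mono norm_isometry_le) auto
  finally show "real_spectrum (re_op W) \<subseteq> {-1..1}"
    using real_spectrum_subset[OF sa, of 0 1] by simp
qed

text \<open>For unitary \<open>W\<close>, the operator \<open>A = W - id_blinfun\<close> satisfies
  \<open>op_adj A o\<^sub>L A = 2 - (W + op_adj W)\<close>, which is zero here.\<close>

lemma re_op_eq_id:
  assumes "W \<in> unitary_group N" "re_op W = id_blinfun"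
  shows "W = id_blinfun"
proof -
  note W = unitaryD[OF assms(1)]
  have "W + op_adj W = 2 *\<^sub>R re_op W" by (simp add: re_op_def)
  then have "W + op_adj W = 2 *\<^sub>R id_blinfun" using assms(2) by simp
  moreover have "op_adj (W - id_blinfun) o\<^sub>L (W - id_blinfun) = 2 *\<^sub>R id_blinfun - (W + op_adj W)"
    using W by (simp add: op_distribs scaleR_2)
  ultimately have "op_adj (W - id_blinfun) o\<^sub>L (W - id_blinfun) = 0" by simp
  then have "W - id_blinfun = 0" by (rule op_adj_compose_self_eq_0[rotated]) (simp add: W(2))
  then show ?thesis by simp
qed

text \<open>For \<open>A = W - op_adj W\<close> unitarity gives
  \<open>op_adj A o\<^sub>L A = 4 - (W + op_adj W)^2\<close>, and the assumption makes the right
  side zero.\<close>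

lemma self_adjoint_of_re_op_square:
  assumes "W \<in> unitary_group N" "re_op W o\<^sub>L re_op W = id_blinfun"
  shows "self_adjoint W"
proof -
  note W = unitaryD[OF assms(1)]
  have "(W + op_adj W) o\<^sub>L (W + op_adj W) = 4 *\<^sub>R (re_op W o\<^sub>L re_op W)"
    by (simp add: re_op_def op_distribs scaleR_add_right)
  then have sq: "(W + op_adj W) o\<^sub>L (W + op_adj W) = 4 *\<^sub>R id_blinfun" using assms(2) by simp
  have "op_adj (W - op_adj W) o\<^sub>L (W - op_adj W)
      = 4 *\<^sub>R id_blinfun - ((W + op_adj W) o\<^sub>L (W + op_adj W))"
  proof -
    have "(1 + 1 + 1 + 1) *\<^sub>R (id_blinfun :: 'h \<Rightarrow>\<^sub>L 'h)
        = id_blinfun + id_blinfun + id_blinfun + id_blinfun"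
      by (simp only: scaleR_left_distrib scaleR_one)
    then have "4 *\<^sub>R (id_blinfun :: 'h \<Rightarrow>\<^sub>L 'h) = id_blinfun + id_blinfun + id_blinfun + id_blinfun"
      by simp
    then show ?thesis using W by (simp add: op_distribs)
  qed
  then have "op_adj (W - op_adj W) o\<^sub>L (W - op_adj W) = 0" using sq by simp
  then have "W - op_adj W = 0" by (rule op_adj_compose_self_eq_0[rotated]) (simp add: W(2))
  then show ?thesis using W by (simp add: self_adjoint_def)
qed

end

section \<open>The distance of two unitaries as a trace of a function of a real part\<close>

lemma powr_above_tangent:
  fixes s m t :: real
  assumes s: "1 \<le> s" and m: "0 < m" and t: "0 \<le> t"
  shows "m powr s + s * m powr (s - 1) * (t - m) \<le> t powr s"
\<comment> \<open>The tangent inequality for convex functions is applied on the open half-line; at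
  the endpoint the claim reduces to \<open>(1 - s) * m powr s \<le> 0\<close>.\<close>
proof (cases "t = 0")
  case True
  have "m powr (s - 1) * m = m powr s" using m by (simp add: powr_mult_base mult.commute)
  then have "m powr s + s * m powr (s - 1) * (t - m) = (1 - s) * m powr s"
    using True by (simp add: algebra_simps)
  then show ?thesis using s True by (simp add: mult_nonpos_nonneg)
next
  case False
  have "s * m powr (s - 1) * (t - m) \<le> t powr s - m powr s"
  proof (rule convex_on_imp_above_tangent[OF powr_convex[OF s]])
    show "((\<lambda>x. x powr s) has_real_derivative s * m powr (s - 1)) (at m within {0<..})"
      using m by (auto intro!: derivative_eq_intros)
  qed (use m t False in \<open>auto simp: interior_open\<close>)
  then show ?thesis by simp
qed

text \<open>The concave case is the convex one for the exponent \<open>1 / s\<close>, with tangent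
  point \<open>m powr s\<close> and argument \<open>t powr s\<close>, solved for
  \<open>t powr s\<close>.\<close>

lemma powr_below_tangent:
  fixes s m t :: real
  assumes s: "0 < s" "s \<le> 1" and m: "0 < m" and t: "0 \<le> t"
  shows "t powr s \<le> m powr s + s * m powr (s - 1) * (t - m)"
proof -
  have "(m powr s) powr (1 / s) + (1 / s) * (m powr s) powr (1 / s - 1) * (t powr s - m powr s)
      \<le> (t powr s) powr (1 / s)"
    using s m by (intro powr_above_tangent) auto
  then have "m + (1 / s) * m powr (1 - s) * (t powr s - m powr s) \<le> t"
    using s m t by (simp add: powr_powr right_diff_distrib)
  then have "s * m powr (s - 1) * ((1 / s) * m powr (1 - s) * (t powr s - m powr s))
      \<le> s * m powr (s - 1) * (t - m)"
    using s by (intro mult_left_mono) auto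
  moreover have "m powr (s - 1) * m powr (1 - s) = 1" using m by (simp flip: powr_add)
  then have "s * m powr (s - 1) * ((1 / s) * m powr (1 - s) * (t powr s - m powr s)) = t powr s - m powr s"
    using s by (simp add: mult_ac)
  ultimately show ?thesis by simp
qed

text \<open>For unitaries, \<open>|U - V|\<^sup>p\<close> is \<open>chord (p/2)\<close> of the real part of \<open>U\<^sup>*V\<close>, because
  \<open>|U - V|\<^sup>2 = 2 - 2 Re (U\<^sup>*V)\<close>.\<close>

definition chord :: "real \<Rightarrow> real \<Rightarrow> real" where
  "chord s x = (2 - 2 * x) powr s"

lemma continuous_on_chord: "0 < s \<Longrightarrow> continuous_on {-1..1} (chord s)"
  unfolding chord_def by (intro continuous_on_powr' continuous_intros) auto

lemma continuous_on_chord_minus: "0 < s \<Longrightarrow> continuous_on {-1..1} (\<lambda>x. chord s (- x))"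
  by (rule continuous_on_compose2[OF continuous_on_chord]) (auto intro: continuous_intros)

text \<open>With \<open>u = (1 - x) / 2\<close> the bracket is \<open>4 powr s\<close> times
  \<open>u powr s + (1 - u) powr s - 1\<close>. On the open unit interval \<open>u powr s\<close>
  exceeds \<open>u\<close> for \<open>s < 1\<close> and falls below it for \<open>s > 1\<close>; the
  sign in \<open>g\<close> merges the two cases.\<close>

lemma chord_add_chord_minus:
  fixes x s :: real
  assumes s: "0 < s" "s \<noteq> 1" and x: "x\<^sup>2 \<le> 1"
  defines "g \<equiv> (if s < 1 then 1 else - 1) * (chord s x + chord s (- x) - 4 powr s)"
  shows "0 \<le> g" "g = 0 \<longleftrightarrow> x\<^sup>2 = 1"
proof -
  have x1: "- 1 \<le> x" "x \<le> 1" using x by (auto simp: abs_square_le_1 abs_le_iff)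
  define u where "u = (1 - x) / 2"
  have u: "0 \<le> u" "u \<le> 1" "x = 1 - 2 * u" using x1 by (auto simp: u_def field_simps)
  have split: "chord s x + chord s (- x) - 4 powr s = 4 powr s * (u powr s + (1 - u) powr s - 1)"
  proof -
    have "2 - 2 * x = 4 * u" "2 - 2 * (- x) = 4 * (1 - u)" by (simp_all add: u(3))
    then have "chord s x = (4 * u) powr s" "chord s (- x) = (4 * (1 - u)) powr s"
      by (simp_all only: chord_def)
    moreover have "(4 * u) powr s = 4 powr s * u powr s" "(4 * (1 - u)) powr s = 4 powr s * (1 - u) powr s"
      using u(1,2) by (intro powr_mult; simp)+
    ultimately show ?thesis by (simp only:) (simp add: algebra_simps)
  qed
  have "g = 0" if "x\<^sup>2 = 1"
  proof -
    have "u = 0 \<or> u = 1" using that by (auto simp: u(3) power2_eq_1_iff)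
    then show ?thesis unfolding g_def split using s by auto
  qed
  moreover have "g > 0" if "x\<^sup>2 \<noteq> 1"
  proof -
    have u': "0 < u" "u < 1" using that u by (auto simp: less_le)
    show ?thesis
    proof (cases "s < 1")
      case True
      have "u powr 1 < u powr s" "(1 - u) powr 1 < (1 - u) powr s"
        by (rule powr_less_mono'; use u' True in simp)+
      then show ?thesis unfolding g_def split using True u' by simp
    next
      case False
      have "u powr s < u powr 1" "(1 - u) powr s < (1 - u) powr 1"
        by (rule powr_less_mono'; use u' s False in simp)+
      then have "u powr s + (1 - u) powr s - 1 < 0" using u' by simp
      then show ?thesis unfolding g_def split using False by (simp add: mult_pos_neg)
    qed
  qed
  ultimately show "0 \<le> g" "g = 0 \<longleftrightarrow> x\<^sup>2 = 1" by (cases "x\<^sup>2 = 1"; force)+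
qed

lemma chord_strict_antimono: "0 < s \<Longrightarrow> -1 \<le> x \<Longrightarrow> x < y \<Longrightarrow> y \<le> 1 \<Longrightarrow> chord s y < chord s x"
  unfolding chord_def by (intro powr_less_mono2) auto

text \<open>The inverse of \<open>F\<close> is continuous on \<open>{F a..F b}\<close>, and its
  functional calculus recovers the operator from \<open>op_fun F\<close>.\<close>

lemma op_fun_inj:
  assumes T: "self_adjoint T" "self_adjoint T'" "real_spectrum T \<subseteq> {a..b}" "real_spectrum T' \<subseteq> {a..b}"
    and F: "continuous_on {a..b} F" "strict_mono_on {a..b} F" and ab: "a \<le> b"
    and eq: "op_fun F T = op_fun F T'"
  shows "T = T'"
proof -
  define G where "G = the_inv_into {a..b} F"
  have inj: "inj_on F {a..b}" using F(2) strict_mono_on_imp_inj_on by blast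
  have GF: "G (F x) = x" if "x \<in> {a..b}" for x unfolding G_def using the_inv_into_f_f[OF inj that] .
  have "continuous_on (F ` {a..b}) G" by (rule continuous_on_inv[OF F(1)]) (auto simp: GF)
  moreover have "{F a..F b} \<subseteq> F ` {a..b}"
    using IVT'[OF _ _ ab F(1)] by fastforce
  ultimately have G: "continuous_on {F a..F b} G" by (rule continuous_on_subset)
  have mono: "F x \<in> {F a..F b}" if "x \<in> {a..b}" for x
    using that F(2) strict_mono_on_leD[OF F(2), of a x] strict_mono_on_leD[OF F(2), of x b] ab by auto
  have "op_fun G (op_fun F R) = R" if R: "self_adjoint R" "real_spectrum R \<subseteq> {a..b}" for R
  proof -
    have "op_fun G (op_fun F R) = op_fun (\<lambda>t. G (F t)) R"
    proof (rule op_fun_op_fun[OF _ _ G])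
      show "cfc F R" by (rule cfcI[OF R F(1)])
      show "cfc (\<lambda>t. G (F t)) R"
        by (rule cfcI[OF R]) (rule continuous_on_compose2[OF G F(1)], use mono in auto)
    qed (use mono R in blast)
    also have "\<dots> = op_fun (\<lambda>t. t) R" by (rule op_fun_cong) (use GF R in blast)
    finally show ?thesis by (simp add: op_fun_ident R)
  qed
  then show ?thesis using T eq by metis
qed

lemma op_fun_uminus:
  assumes c: "self_adjoint c" "real_spectrum c \<subseteq> {-1..1}" and f: "continuous_on {-1..1} f"
  shows "op_fun f (- c) = op_fun (\<lambda>x. f (- x)) c" "real_spectrum (- c) \<subseteq> {-1..1}"
proof -
  have neg: "op_fun (\<lambda>x. (- 1) * x) c = - c"
    using op_fun_cmult[of "\<lambda>x. x" c "- 1"] c by (simp add: op_fun_ident cfc_continuous)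
  have cn: "cfc (\<lambda>x. (- 1) * x) c" by (rule cfc_continuous[OF c(1)]) (intro continuous_intros)
  have "op_fun f (op_fun (\<lambda>x. (- 1) * x) c) = op_fun (\<lambda>x. f ((- 1) * x)) c"
  proof (rule op_fun_op_fun[OF cn _ f])
    show "cfc (\<lambda>x. f ((- 1) * x)) c"
      by (rule cfcI[OF c]) (rule continuous_on_compose2[OF f], auto intro: continuous_intros)
  qed (use c in force)
  then show "op_fun f (- c) = op_fun (\<lambda>x. f (- x)) c" unfolding neg by simp
  have "real_spectrum (op_fun (\<lambda>x. (- 1) * x) c) \<subseteq> {-1..1}"
    by (rule real_spectrum_op_fun[OF cn]) (use c in force)
  then show "real_spectrum (- c) \<subseteq> {-1..1}" by (simp only: neg)
qed

lemma op_fun_affine: "self_adjoint T \<Longrightarrow> op_fun (\<lambda>x. a + b * x) T = a *\<^sub>R id_blinfun + b *\<^sub>R T"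
  by (simp add: op_fun_add op_fun_cmult cfc_const cfc_cmult cfc_continuous op_fun_const op_fun_ident)

section \<open>Distances between unitaries\<close>

context traced_algebra
begin

text \<open>An affine function contributes only through \<open>\<tau> T\<close>; this is what a
  comparison of a function with its tangent line needs.\<close>

lemma trace_op_fun_minus_affine:
  assumes f: "cfc f T" and T: "T \<in> N"
  shows "Re (\<tau> (op_fun (\<lambda>x. f x - (a + b * x)) T)) = Re (\<tau> (op_fun f T)) - a - b * Re (\<tau> T)"
proof -
  have sa: "self_adjoint T" using f by (rule cfc_self_adjoint)
  have "cfc (\<lambda>x. a + b * x) T" by (rule cfc_continuous[OF sa]) (intro continuous_intros)
  then show ?thesis
    by (simp add: op_fun_diff f op_fun_affine sa trace_diff trace_add trace_scaleR trace_id op_fun_in_N T)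
qed

text \<open>The real part of \<open>W\<close> is at most 1, so 1 minus it is positive with trace at
  most zero, hence zero.\<close>

lemma eq_id_of_trace:
  assumes W: "W \<in> unitary_group N" and tr1: "1 \<le> Re (\<tau> (re_op W))"
  shows "W = id_blinfun"
proof -
  note c = re_op_unitary[OF W]
  have "op_fun (\<lambda>x. 1 + (- 1) * x) (re_op W) = 0"
  proof (rule trace_op_fun_faithful[OF _ c(2)])
    show "cfc (\<lambda>x. 1 + (- 1) * x) (re_op W)" by (rule cfc_continuous[OF c(1)]) (intro continuous_intros)
    show "Re (\<tau> (op_fun (\<lambda>x. 1 + (- 1) * x) (re_op W))) \<le> 0"
      unfolding op_fun_affine[OF c(1)] using tr1 c(2) by (simp add: trace_diff trace_id)
  qed (use c in force)
  then have "id_blinfun = re_op W" unfolding op_fun_affine[OF c(1)] by simp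
  from this[symmetric] show ?thesis by (rule re_op_eq_id[OF W])
qed

text \<open>For \<open>s = p / 2\<close> this is the \<open>p\<close>-th power of the
  \<open>p\<close>-norm distance. Passing to the power makes the quantity linear in the trace, so
  distances can be added and compared inside the functional calculus.\<close>

definition udist :: "real \<Rightarrow> ('h \<Rightarrow>\<^sub>L 'h) \<Rightarrow> ('h \<Rightarrow>\<^sub>L 'h) \<Rightarrow> real" where
  "udist s U V = Re (\<tau> (op_fun (chord s) (re_op (op_adj U o\<^sub>L V))))"

lemma cfc_chord:
  assumes "W \<in> unitary_group N" "0 < s"
  shows "cfc (chord s) (re_op W)" "cfc (\<lambda>x. chord s (- x)) (re_op W)"
  using assms re_op_unitary by (blast intro: cfcI continuous_on_chord continuous_on_chord_minus)+

lemma Lp_norm_unitary_diff: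
  assumes p: "0 < p" and U: "U \<in> unitary_group N" and V: "V \<in> unitary_group N"
  shows "Lp_norm \<tau> p (U - V) = udist (p / 2) U V powr (1 / p)" "0 \<le> udist (p / 2) U V"
proof -
  define W where "W = op_adj U o\<^sub>L V"
  have W: "W \<in> unitary_group N" unfolding W_def by (intro unitary_compose unitary_adj U V)
  note c = re_op_unitary[OF W]
  note UB = unitaryD[OF U] and VB = unitaryD[OF V]
  have "op_adj (U - V) o\<^sub>L (U - V) = 2 *\<^sub>R id_blinfun + (- 2) *\<^sub>R re_op W"
    using UB VB by (simp add: W_def re_op_def op_distribs scaleR_2 scaleR_add_right)
  also have "\<dots> = op_fun (\<lambda>x. 2 + (- 2) * x) (re_op W)" by (rule op_fun_affine[OF c(1), symmetric])
  finally have sq: "op_adj (U - V) o\<^sub>L (U - V) = op_fun (\<lambda>x. 2 + (- 2) * x) (re_op W)" .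
  have aff: "cfc (\<lambda>x. 2 + (- 2) * x) (re_op W)" by (rule cfc_continuous[OF c(1)]) (intro continuous_intros)
  have root: "cfc (\<lambda>x. sqrt (2 + (- 2) * x)) (re_op W)"
    by (rule cfc_continuous[OF c(1)]) (intro continuous_intros)
  \<comment> \<open>The intervals [0,4] here and [0,2] below contain the values of
    \<open>2 - 2 * x\<close> and of its square root for \<open>x\<close> in [-1,1].\<close>
  have abs: "op_abs (U - V) = op_fun (\<lambda>x. sqrt (2 + (- 2) * x)) (re_op W)"
    unfolding op_abs_def sq
    by (rule op_fun_op_fun[OF aff _ _ root, of 0 4]) (use c in \<open>force intro: continuous_intros\<close>)+
  have powr: "continuous_on {0..2} (\<lambda>t. t powr p)"
    using p by (intro continuous_on_powr' continuous_intros) auto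
  have "op_abs_powr (U - V) p = op_fun (\<lambda>x. sqrt (2 + (- 2) * x) powr p) (re_op W)"
    unfolding op_abs_powr_def abs
  proof (rule op_fun_op_fun[OF root _ powr])
    fix t assume "t \<in> real_spectrum (re_op W)"
    then have "t \<in> {-1..1}" using c by blast
    then have "sqrt (2 + (- 2) * t) \<le> sqrt 4" by (intro real_sqrt_le_mono) auto
    then show "sqrt (2 + (- 2) * t) \<in> {0..2}" using \<open>t \<in> {-1..1}\<close> by auto
  next
    show "cfc (\<lambda>x. sqrt (2 + (- 2) * x) powr p) (re_op W)"
      using p by (intro cfcI[OF c(1,3)] continuous_on_powr' continuous_intros) auto
  qed
  also have "\<dots> = op_fun (chord (p / 2)) (re_op W)"
  proof (rule op_fun_cong)
    fix t assume "t \<in> real_spectrum (re_op W)"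
    then have t: "t \<in> {-1..1}" using c by blast
    then have "sqrt (2 + (- 2) * t) = (2 - 2 * t) powr (1 / 2)" by (simp add: powr_half_sqrt)
    then show "sqrt (2 + (- 2) * t) powr p = chord (p / 2) t" by (simp add: chord_def powr_powr)
  qed
  finally show "Lp_norm \<tau> p (U - V) = udist (p / 2) U V powr (1 / p)"
    by (simp add: Lp_norm_def udist_def W_def)
  show "0 \<le> udist (p / 2) U V"
    unfolding udist_def W_def[symmetric]
    using p by (intro trace_op_fun_nonneg cfc_chord W c) (auto simp: chord_def)
qed

lemma udist_eq_of_Lp_norm_eq:
  assumes p: "0 < p" and U: "U \<in> unitary_group N" "V \<in> unitary_group N"
    "U' \<in> unitary_group N" "V' \<in> unitary_group N"
    and eq: "Lp_norm \<tau> p (U - V) = Lp_norm \<tau> p (U' - V')"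
  shows "udist (p / 2) U V = udist (p / 2) U' V'"
proof -
  have "(x powr (1 / p)) powr p = x" if "0 \<le> x" for x :: real
    using p that by (simp add: powr_powr)
  then show ?thesis
    using eq Lp_norm_unitary_diff[OF p U(1,2)] Lp_norm_unitary_diff[OF p U(3,4)] by metis
qed

lemma udist_minus:
  assumes s: "0 < s" and U: "U \<in> unitary_group N" and V: "V \<in> unitary_group N"
  shows "udist s U (- V) = Re (\<tau> (op_fun (\<lambda>x. chord s (- x)) (re_op (op_adj U o\<^sub>L V))))"
proof -
  have W: "op_adj U o\<^sub>L V \<in> unitary_group N" by (intro unitary_compose unitary_adj U V)
  then have "re_op (op_adj U o\<^sub>L - V) = - re_op (op_adj U o\<^sub>L V)"
    by (simp add: op_distribs re_op_minus unitaryD)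
  then show ?thesis
    using op_fun_uminus(1)[OF re_op_unitary(1,3)[OF W] continuous_on_chord[OF s]]
    by (simp add: udist_def)
qed

text \<open>\<open>4 powr s\<close> is the maximum of \<open>chord s\<close> on [-1,1], attained
  only at -1. Equality of traces therefore puts the whole spectrum of the real part at -1.\<close>

lemma udist_antipode:
  assumes s: "0 < s" and U: "U \<in> unitary_group N" and V: "V \<in> unitary_group N"
  shows "udist s U V = 4 powr s \<longleftrightarrow> V = - U"
proof
  assume "V = - U"
  then have "re_op (op_adj U o\<^sub>L V) = (- 1) *\<^sub>R id_blinfun"
    using unitaryD[OF U] by (simp add: op_distribs re_op_minus re_op_of_self_adjoint self_adjoint_def)
  then show "udist s U V = 4 powr s"
    by (simp only: udist_def op_fun_scalar) (simp add: trace_scaleR trace_id chord_def)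
next
  assume eq: "udist s U V = 4 powr s"
  define W where "W = op_adj U o\<^sub>L V"
  have W: "W \<in> unitary_group N" unfolding W_def by (intro unitary_compose unitary_adj U V)
  note c = re_op_unitary[OF W]
  have bound: "chord s t \<le> 4 powr s" if "t \<in> real_spectrum (re_op W)" for t
    unfolding chord_def using c(3) that s by (intro powr_mono2) auto
  have cf: "cfc (\<lambda>x. 4 powr s - chord s x) (re_op W)" by (intro cfc_diff cfc_const cfc_chord W s c)
  have "op_fun (\<lambda>x. 4 powr s - chord s x) (re_op W) = 0"
  proof (rule trace_op_fun_faithful[OF cf c(2)])
    show "Re (\<tau> (op_fun (\<lambda>x. 4 powr s - chord s x) (re_op W))) \<le> 0"
      using eq c by (simp add: op_fun_diff cfc_const cfc_chord W s op_fun_const trace_diff op_fun_in_N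
          trace_scaleR trace_id udist_def W_def[symmetric])
  qed (use bound in simp)
  then have "4 powr s = chord s t" if "t \<in> real_spectrum (re_op W)" for t
    using op_fun_eq_0_imp[OF cf _ that] by simp
  then have "t = - 1" if "t \<in> real_spectrum (re_op W)" for t
    using that c(3) chord_strict_antimono[OF s, of "- 1" t] by (force simp: chord_def)
  then have "op_poly [:1, 1:] (re_op W) = 0" by (intro op_poly_eq_0_of_spectrum c) force
  then have "id_blinfun + re_op W = 0" using c by (simp add: op_poly_pCons op_distribs)
  then have "- re_op W = id_blinfun" by (metis add_eq_0_iff2)
  then have "re_op (- W) = id_blinfun" using W by (simp add: re_op_minus unitaryD)
  then have "- W = id_blinfun" by (rule re_op_eq_id[OF unitary_minus[OF W]])
  then have "U o\<^sub>L (- W) = U" by simp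
  then have "- V = U" by (simp add: unitary_cancel[OF U] W_def op_distribs)
  then show "V = - U" by auto
qed

text \<open>The difference of the two sides is, up to sign, the trace of the nonnegative function
  \<open>g\<close>, whose zeros are the points with \<open>x\<^sup>2 = 1\<close>. So equality means
  that the real part of \<open>W\<close> squares to 1, that is, \<open>W\<close> is
  self-adjoint.\<close>

lemma udist_symmetry_iff:
  assumes s: "0 < s" "s \<noteq> 1" and U: "U \<in> unitary_group N" and V: "V \<in> unitary_group N"
  shows "udist s U V + udist s U (- V) = 4 powr s \<longleftrightarrow> self_adjoint (op_adj U o\<^sub>L V)"
proof -
  define W where "W = op_adj U o\<^sub>L V"
  have W: "W \<in> unitary_group N" unfolding W_def by (intro unitary_compose unitary_adj U V)
  note c = re_op_unitary[OF W]
  define g where "g = (\<lambda>x. (if s < 1 then 1 else - 1) * (chord s x + chord s (- x) - 4 powr s))"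
  have cf: "cfc g (re_op W)" unfolding g_def
    by (intro cfc_cmult cfc_diff cfc_add cfc_const cfc_chord W s c)
  have sp: "x\<^sup>2 \<le> 1" if "x \<in> real_spectrum (re_op W)" for x
    using subsetD[OF c(3) that] by (auto simp: abs_square_le_1 abs_le_iff)
  have trg: "Re (\<tau> (op_fun g (re_op W)))
      = (if s < 1 then 1 else - 1) * (udist s U V + udist s U (- V) - 4 powr s)"
    unfolding g_def udist_minus[OF s(1) U V]
    unfolding udist_def W_def[symmetric]
    by (simp add: op_fun_cmult op_fun_diff op_fun_add cfc_diff cfc_add cfc_const cfc_chord W s c
        trace_scaleR trace_diff trace_add op_fun_in_N op_fun_const trace_id)
  show ?thesis
    unfolding W_def[symmetric]
  proof
    assume "udist s U V + udist s U (- V) = 4 powr s"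
    then have "op_fun g (re_op W) = 0"
    proof (intro trace_op_fun_faithful[OF cf c(2)])
      show "0 \<le> g t" if "t \<in> real_spectrum (re_op W)" for t
        unfolding g_def by (rule chord_add_chord_minus(1)[OF s sp[OF that]])
    qed (simp add: trg)
    then have "x\<^sup>2 = 1" if "x \<in> real_spectrum (re_op W)" for x
      using op_fun_eq_0_imp[OF cf _ that] chord_add_chord_minus(2)[OF s sp[OF that]] by (simp add: g_def)
    then have "op_poly [:- 1, 0, 1:] (re_op W) = 0"
      by (intro op_poly_eq_0_of_spectrum c) (simp add: power2_eq_square)
    then have "re_op W o\<^sub>L re_op W = id_blinfun" using c by (simp add: op_poly_pCons op_distribs)
    then show "self_adjoint W" by (rule self_adjoint_of_re_op_square[OF W])
  next
    assume sa: "self_adjoint W"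
    then have re: "re_op W = W" by (rule re_op_of_self_adjoint)
    have "W o\<^sub>L W = id_blinfun" using unitaryD(3)[OF W] self_adjointD(2)[OF sa] by simp
    then have "op_poly [:- 1, 0, 1:] W = 0" using unitaryD(2)[OF W] by (simp add: op_poly_pCons op_distribs)
    then have "x\<^sup>2 = 1" if "x \<in> real_spectrum (re_op W)" for x
      using op_fun_eq_0_imp[OF cfc_poly[OF sa], of "[:- 1, 0, 1:]" x] that
      by (simp add: re op_fun_poly[OF sa] power2_eq_square)
    then have "op_fun g (re_op W) = op_fun (\<lambda>x. 0) (re_op W)"
      using chord_add_chord_minus(2)[OF s sp] by (intro op_fun_cong) (simp add: g_def)
    then have "op_fun g (re_op W) = 0" using c by (simp add: op_fun_const)
    \<comment> \<open>The factor 0 in the instance of \<open>trace_scaleR\<close> yields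
      \<open>\<tau> 0 = 0\<close>.\<close>
    then show "udist s U V + udist s U (- V) = 4 powr s"
      using trg trace_scaleR[OF N_basic(1), of 0] by (auto split: if_splits)
  qed
qed

section \<open>Symmetries and the tangent argument\<close>

definition symmetry :: "('h \<Rightarrow>\<^sub>L 'h) \<Rightarrow> bool" where
  "symmetry S \<longleftrightarrow> S \<in> unitary_group N \<and> self_adjoint S"

lemma symmetryD:
  assumes "symmetry S"
  shows "S \<in> unitary_group N" "S \<in> N" "S \<in> bounded_ops" "op_adj S = S" "S o\<^sub>L S = id_blinfun"
    "S o\<^sub>L (S o\<^sub>L A) = A"
proof -
  show S: "S \<in> unitary_group N" "op_adj S = S" using assms by (auto simp: symmetry_def self_adjoint_def)
  show "S \<in> N" "S \<in> bounded_ops" "S o\<^sub>L S = id_blinfun" using unitaryD[OF S(1)] S(2) by auto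
  then show "S o\<^sub>L (S o\<^sub>L A) = A" by (simp add: blinfun_compose_assoc[symmetric])
qed

lemma udist_left_mult:
  assumes "A \<in> unitary_group N" "U \<in> unitary_group N" "V \<in> unitary_group N"
  shows "udist s (A o\<^sub>L U) (A o\<^sub>L V) = udist s U V"
  using unitaryD[OF assms(1)] unitaryD[OF assms(2)]
  by (simp add: udist_def blinfun_compose_assoc unitary_cancel[OF assms(1)])

text \<open>The tangent of the chord function at \<open>Re z\<close> gives an inequality between the two sides of
  the hypotheses which is strict unless \<open>\<tau>(ST) = 1\<close>. The chord function is convex for
  \<open>s \<ge> 1\<close> and concave for \<open>s \<le> 1\<close>; accordingly the distance to \<open>S\<close> or the one to \<open>-S\<close>
  is used.\<close>

lemma symmetry_eq_of_udist_eq: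
  assumes s: "0 < s" and S: "symmetry S" and T: "symmetry T"
    and z: "cmod z = 1" "0 < Re z" "Re z < 1"
    and eq: "udist s (scalar_op z o\<^sub>L T) S = udist s (scalar_op z o\<^sub>L S) S"
    and eqm: "udist s (scalar_op z o\<^sub>L T) (- S) = udist s (scalar_op z o\<^sub>L S) (- S)"
  shows "T = S"
proof -
  note SD = symmetryD[OF S] and TD = symmetryD[OF T]
  define r where "r = Re z"
  have ST: "T o\<^sub>L S \<in> unitary_group N" by (intro unitary_compose SD TD)
  have zT: "scalar_op z o\<^sub>L T \<in> unitary_group N" and zS: "scalar_op z o\<^sub>L S \<in> unitary_group N"
    by (intro unitary_compose unitary_scalar z SD TD)+
  have adj: "op_adj (scalar_op z o\<^sub>L A) o\<^sub>L S = scalar_op (cnj z) o\<^sub>L (A o\<^sub>L S)"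
    if "symmetry A" for A
    using symmetryD(3,4)[OF that] by (simp add: scalar_op_commute blinfun_compose_assoc)
  define W where "W = scalar_op (cnj z) o\<^sub>L (T o\<^sub>L S)"
  have W: "W \<in> unitary_group N" unfolding W_def by (intro unitary_compose unitary_scalar SD TD) (simp add: z)
  note c = re_op_unitary[OF W]
  define k where "k = Re (\<tau> (T o\<^sub>L S))"
  have adjW: "op_adj W = scalar_op z o\<^sub>L (S o\<^sub>L T)"
    using SD TD by (simp add: W_def scalar_op_commute scalar_op_left_commute blinfun_compose_assoc)
  \<comment> \<open>By traciality S T and T S have the same trace, so the imaginary part of
    \<open>z\<close> cancels and only \<open>r\<close> times this trace is left.\<close>
  have "\<tau> (re_op W) = 1 / 2 * (cnj z * \<tau> (T o\<^sub>L S) + z * \<tau> (S o\<^sub>L T))"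
    unfolding re_op_def adjW using SD TD
    by (simp add: W_def trace_scaleR trace_add trace_scalar)
  also have "\<tau> (S o\<^sub>L T) = \<tau> (T o\<^sub>L S)" by (rule trace_commute[OF SD(2) TD(2)])
  also have "cnj z * \<tau> (T o\<^sub>L S) + z * \<tau> (T o\<^sub>L S) = complex_of_real (2 * r) * \<tau> (T o\<^sub>L S)"
    by (simp add: complex_eq_iff r_def algebra_simps)
  finally have trW: "Re (\<tau> (re_op W)) = r * k" by (simp add: k_def)
  have "op_adj (T o\<^sub>L S) = S o\<^sub>L T" using SD TD by simp
  then have trST: "Re (\<tau> (re_op (T o\<^sub>L S))) = k"
    using SD TD trace_commute[OF SD(2) TD(2)]
    by (simp add: re_op_def trace_scaleR trace_add k_def)
  have "re_op (scalar_op (cnj z) o\<^sub>L (S o\<^sub>L S)) = (1 / 2) *\<^sub>R scalar_op (cnj z + z)"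
    using SD by (simp add: re_op_def scalar_op_add)
  also have "cnj z + z = complex_of_real (2 * r)" using complex_add_cnj[of z] by (simp add: r_def add.commute)
  finally have reS: "re_op (scalar_op (cnj z) o\<^sub>L (S o\<^sub>L S)) = r *\<^sub>R id_blinfun"
    by (simp only: scalar_op_of_real) simp
  have dS: "udist s (scalar_op z o\<^sub>L S) S = chord s r" "udist s (scalar_op z o\<^sub>L S) (- S) = chord s (- r)"
    unfolding udist_minus[OF s zS SD(1)] unfolding udist_def adj[OF S] reS op_fun_scalar
    by (simp_all add: trace_scaleR trace_id)
  have dT: "Re (\<tau> (op_fun (chord s) (re_op W))) = chord s r"
    "Re (\<tau> (op_fun (\<lambda>x. chord s (- x)) (re_op W))) = chord s (- r)"
    using eq eqm unfolding dS udist_minus[OF s zT SD(1)] unfolding udist_def adj[OF T] W_def by auto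
  have "1 \<le> k"
  proof (cases "1 \<le> s")
    case True
    \<comment> \<open>The slope of \<open>chord s\<close> at \<open>r\<close>. The tangent
      inequality then reads \<open>0 \<le> b * r * (1 - k)\<close>, and \<open>b < 0 < r\<close>
      forces \<open>1 \<le> k\<close>.\<close>
    define b where "b = - (2 * s * (2 - 2 * r) powr (s - 1))"
    have b: "b < 0" using s z by (simp add: b_def r_def)
    define f where "f = (\<lambda>x. chord s x - ((chord s r - b * r) + b * x))"
    have "0 \<le> Re (\<tau> (op_fun f (re_op W)))"
    proof (rule trace_op_fun_nonneg[OF _ c(2)])
      show "cfc f (re_op W)"
        unfolding f_def by (rule cfc_diff[OF cfc_chord(1)[OF W s]], rule cfc_continuous[OF c(1)]) (intro continuous_intros)
      fix x assume "x \<in> real_spectrum (re_op W)"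
      then have "x \<in> {-1..1}" using c by blast
      then show "0 \<le> f x"
        using powr_above_tangent[OF True, of "2 - 2 * r" "2 - 2 * x"] z
        by (simp add: f_def b_def chord_def r_def algebra_simps)
    qed
    also have "\<dots> = b * r * (1 - k)"
      unfolding f_def trace_op_fun_minus_affine[OF cfc_chord(1)[OF W s] c(2)] dT trW
      by (simp add: algebra_simps)
    finally show ?thesis using b z by (simp add: zero_le_mult_iff r_def not_less)
  next
    case False
    \<comment> \<open>The slope at \<open>r\<close> of the distance function to -S. Concavity
      reverses the tangent inequality, so a positive slope is wanted; the decreasing function for S
      would only give \<open>k \<le> 1\<close>.\<close>
    define b where "b = 2 * s * (2 + 2 * r) powr (s - 1)"
    have b: "b > 0" using s z by (simp add: b_def r_def)
    define f where "f = (\<lambda>x. chord s (- x) - ((chord s (- r) - b * r) + b * x))"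
    have cf: "cfc f (re_op W)"
      unfolding f_def by (rule cfc_diff[OF cfc_chord(2)[OF W s]], rule cfc_continuous[OF c(1)]) (intro continuous_intros)
    have "0 \<le> Re (\<tau> (op_fun (\<lambda>x. (- 1) * f x) (re_op W)))"
    proof (rule trace_op_fun_nonneg[OF cfc_cmult[OF cf] c(2)])
      fix x assume "x \<in> real_spectrum (re_op W)"
      then have "x \<in> {-1..1}" using c by blast
      then show "0 \<le> (- 1) * f x"
        using powr_below_tangent[of s "2 + 2 * r" "2 + 2 * x"] z s False
        by (simp add: f_def b_def chord_def r_def algebra_simps)
    qed
    also have "\<dots> = - Re (\<tau> (op_fun f (re_op W)))"
      unfolding op_fun_cmult[OF cf] trace_scaleR[OF op_fun_in_N[OF cf c(2)]] by simp
    also have "\<dots> = b * r * (k - 1)"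
      unfolding f_def trace_op_fun_minus_affine[OF cfc_chord(2)[OF W s] c(2)] dT trW
      by (simp add: algebra_simps)
    finally have "0 \<le> b * r * (k - 1)" .
    moreover have "0 < b * r" using b z by (simp add: r_def)
    ultimately show ?thesis using mult_pos_neg[of "b * r" "k - 1"] by linarith
  qed
  then have "T o\<^sub>L S = id_blinfun" using eq_id_of_trace[OF ST] trST by simp
  then have "T o\<^sub>L (T o\<^sub>L S) = T" by simp
  then show ?thesis unfolding TD(6) by (rule sym)
qed

section \<open>Commuting unitaries with equal distances to all symmetries\<close>

lemma commute_re_op:
  assumes "B o\<^sub>L V = V o\<^sub>L B" "B o\<^sub>L op_adj V = op_adj V o\<^sub>L B"
  shows "re_op V o\<^sub>L B = B o\<^sub>L re_op V"
  using assms by (simp add: re_op_def op_distribs)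

text \<open>\<open>X\<close> acts as \<open>- c\<close> on the range of \<open>P\<close> and as
  \<open>c\<close> on its complement; intertwining with the two projections computes
  \<open>op_fun f X\<close> block by block.\<close>

lemma op_fun_times_symmetry:
  assumes c: "self_adjoint c" "c \<in> N" "real_spectrum c \<subseteq> {-1..1}"
    and f: "continuous_on {-1..1} f"
    and P: "P \<in> N" "self_adjoint P" "P o\<^sub>L P = P" "c o\<^sub>L P = P o\<^sub>L c"
    and X: "self_adjoint X" "real_spectrum X \<subseteq> {-1..1}" "X = c o\<^sub>L (id_blinfun - 2 *\<^sub>R P)"
  shows "op_fun f X = op_fun f c + (P o\<^sub>L op_fun (\<lambda>x. f (- x) - f x) c)"
proof -
  have cf: "cfc f c" "cfc (\<lambda>x. f (- x)) c"
    by (auto intro!: cfcI[OF c(1,3)] f continuous_on_compose2[OF f] continuous_intros)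
  have nc: "self_adjoint (- c)" using c by (simp add: self_adjoint_def)
  have PP: "P o\<^sub>L (P o\<^sub>L A) = P o\<^sub>L A" for A using P(3) by (simp add: blinfun_compose_assoc[symmetric])
  have "op_fun f X o\<^sub>L P = P o\<^sub>L op_fun f (- c)"
    by (rule op_fun_intertwine[OF X(1) nc X(2) op_fun_uminus(2)[OF c(1,3) f] f])
      (simp add: X(3) op_distribs P PP scaleR_2)
  moreover have "op_fun f X o\<^sub>L (id_blinfun - P) = (id_blinfun - P) o\<^sub>L op_fun f c"
    by (rule op_fun_intertwine[OF X(1) c(1) X(2) c(3) f]) (simp add: X(3) op_distribs P PP scaleR_2)
  moreover have "op_fun f X = (op_fun f X o\<^sub>L P) + (op_fun f X o\<^sub>L (id_blinfun - P))"
    by (simp add: op_distribs)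
  ultimately show ?thesis
    using op_fun_uminus(1)[OF c(1,3) f] by (simp add: op_distribs op_fun_diff cf)
qed

text \<open>Distances to the symmetries \<open>1 - 2P\<close> thus test the function
  \<open>chord s (- x) - chord s x\<close> of the real part of \<open>V\<close> against every
  projection commuting with \<open>V\<close>.\<close>

lemma udist_projection:
  assumes s: "0 < s" and V: "V \<in> unitary_group N"
    and P: "P \<in> N" "self_adjoint P" "P o\<^sub>L P = P" "V o\<^sub>L P = P o\<^sub>L V"
  shows "symmetry (id_blinfun - 2 *\<^sub>R P)"
    "udist s V (id_blinfun - 2 *\<^sub>R P) = udist s V id_blinfun
       + Re (\<tau> (P o\<^sub>L op_fun (\<lambda>x. chord s (- x) - chord s x) (re_op V)))"
proof -
  let ?S = "id_blinfun - 2 *\<^sub>R P"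
  note VD = unitaryD[OF V] and PD = self_adjointD[OF P(2)]
  have SS: "?S o\<^sub>L ?S = id_blinfun" by (simp add: op_distribs P scaleR_2)
  show sym: "symmetry ?S"
    using P PD SS by (simp add: symmetry_def unitary_group_def self_adjoint_def)
  note SD = symmetryD[OF sym]
  note c = re_op_unitary[OF V]
  have "op_adj (V o\<^sub>L P) = op_adj (P o\<^sub>L V)" by (simp only: P(4))
  then have VP: "P o\<^sub>L op_adj V = op_adj V o\<^sub>L P" using VD PD by simp
  have cP: "re_op V o\<^sub>L P = P o\<^sub>L re_op V" by (rule commute_re_op[OF P(4)[symmetric] VP])
  have W: "op_adj V o\<^sub>L ?S \<in> unitary_group N" by (intro unitary_compose unitary_adj V SD)
  have X: "re_op (op_adj V o\<^sub>L ?S) = re_op V o\<^sub>L ?S"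
  proof -
    have "op_adj (op_adj V o\<^sub>L ?S) = ?S o\<^sub>L V" using VD SD by simp
    also have "\<dots> = V o\<^sub>L ?S" by (simp add: op_distribs P)
    finally show ?thesis by (simp add: re_op_def op_distribs scaleR_add_right scaleR_diff_right add.commute)
  qed
  have F: "cfc (\<lambda>x. chord s (- x) - chord s x) (re_op V)" by (intro cfc_diff cfc_chord V s)
  have "op_fun (chord s) (re_op (op_adj V o\<^sub>L ?S))
      = op_fun (chord s) (re_op V) + (P o\<^sub>L op_fun (\<lambda>x. chord s (- x) - chord s x) (re_op V))"
    by (rule op_fun_times_symmetry[OF c continuous_on_chord[OF s] P(1-3) cP re_op_unitary(1,3)[OF W] X])
  moreover have "re_op (op_adj V) = re_op V" using VD by (simp add: re_op_def add.commute)
  ultimately show "udist s V ?S = udist s V id_blinfun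
      + Re (\<tau> (P o\<^sub>L op_fun (\<lambda>x. chord s (- x) - chord s x) (re_op V)))"
    using c P by (simp add: udist_def trace_add op_fun_in_N F cfc_chord V s)
qed

text \<open>Let \<open>P\<close> be the support of the positive part of \<open>D\<close>.
  Commutation of \<open>V\<close> and \<open>W\<close> makes \<open>P\<close> commute with both, so
  the symmetry \<open>1 - 2P\<close> is an admissible test; equal distances give the positive part
  of \<open>D\<close> trace zero.\<close>

lemma op_fun_chord_diff_positive:
  assumes s: "0 < s" and V: "V \<in> unitary_group N" and W: "W \<in> unitary_group N"
    and comm: "V o\<^sub>L W = W o\<^sub>L V" and eq: "\<And>S. symmetry S \<Longrightarrow> udist s V S = udist s W S"
  defines "F \<equiv> \<lambda>x. chord s (- x) - chord s x"
  shows "positive_op (op_fun F (re_op W) - op_fun F (re_op V))"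
proof -
  note VD = unitaryD[OF V] and WD = unitaryD[OF W]
  note c = re_op_unitary[OF V] and c' = re_op_unitary[OF W]
  have F: "cfc F (re_op V)" "cfc F (re_op W)" unfolding F_def by (intro cfc_diff cfc_chord V W s)+
  define D where "D = op_fun F (re_op V) - op_fun F (re_op W)"
  have D: "D \<in> N" "self_adjoint D"
    using op_fun_in_N F c c' op_fun_self_adjoint[OF F(1)] op_fun_self_adjoint[OF F(2)]
    by (auto simp: D_def self_adjoint_def)
  \<comment> \<open>Multiplying \<open>comm\<close> by the adjoint of \<open>V\<close> from both
    sides moves the commutation to the adjoint.\<close>
  have VW': "W o\<^sub>L op_adj V = op_adj V o\<^sub>L W"
  proof -
    have "op_adj V o\<^sub>L ((V o\<^sub>L W) o\<^sub>L op_adj V) = op_adj V o\<^sub>L ((W o\<^sub>L V) o\<^sub>L op_adj V)" by (simp only: comm)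
    then show ?thesis using VD by (simp add: blinfun_compose_assoc unitary_cancel[OF V])
  qed
  have "op_adj (W o\<^sub>L op_adj V) = op_adj (op_adj V o\<^sub>L W)" by (simp only: VW')
  then have V'W: "V o\<^sub>L op_adj W = op_adj W o\<^sub>L V" using VD WD by simp
  have "op_adj (V o\<^sub>L W) = op_adj (W o\<^sub>L V)" by (simp only: comm)
  then have V'W': "op_adj W o\<^sub>L op_adj V = op_adj V o\<^sub>L op_adj W" using VD WD by simp
  have DB: "D o\<^sub>L B = B o\<^sub>L D"
    if "B o\<^sub>L V = V o\<^sub>L B" "B o\<^sub>L op_adj V = op_adj V o\<^sub>L B" "B o\<^sub>L W = W o\<^sub>L B" "B o\<^sub>L op_adj W = op_adj W o\<^sub>L B" for B
    using op_fun_commute[OF F(1) commute_re_op] op_fun_commute[OF F(2) commute_re_op] that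
    by (simp add: D_def op_distribs)
  have DV: "D o\<^sub>L V = V o\<^sub>L D" "D o\<^sub>L op_adj V = op_adj V o\<^sub>L D"
    and DW: "D o\<^sub>L W = W o\<^sub>L D" "D o\<^sub>L op_adj W = op_adj W o\<^sub>L D"
    by (rule DB; simp add: VD WD comm VW' V'W V'W')+
  obtain P where P: "P \<in> N" "self_adjoint P" "P o\<^sub>L P = P" "P o\<^sub>L D = op_fun (\<lambda>t. max 0 t) D"
    and PB: "\<And>B. B \<in> bounded_ops \<Longrightarrow> B o\<^sub>L D = D o\<^sub>L B \<Longrightarrow> op_adj B o\<^sub>L D = D o\<^sub>L op_adj B \<Longrightarrow> B o\<^sub>L P = P o\<^sub>L B"
    using ex_positive_part_projection[OF D] by blast
  have VP: "V o\<^sub>L P = P o\<^sub>L V" and WP: "W o\<^sub>L P = P o\<^sub>L W" using DV DW VD WD by (auto intro!: PB)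
  \<comment> \<open>Comparing distances to the identity removes the terms
    \<open>udist s V id_blinfun\<close> and \<open>udist s W id_blinfun\<close>, leaving only the
    traces against \<open>P\<close>.\<close>
  have id: "symmetry id_blinfun" by (simp add: symmetry_def unitary_group_def self_adjoint_def)
  have "Re (\<tau> (P o\<^sub>L op_fun F (re_op V))) = Re (\<tau> (P o\<^sub>L op_fun F (re_op W)))"
    using udist_projection[OF s V P(1-3) VP] udist_projection[OF s W P(1-3) WP] eq eq[OF id]
    unfolding F_def by simp
  then have "Re (\<tau> (P o\<^sub>L D)) = 0"
    using P(1) c c' F by (simp add: D_def blinfun_compose.diff_right trace_diff op_fun_in_N)
  moreover have cm: "cfc (\<lambda>t. max 0 t) D" by (auto intro!: cfc_continuous D continuous_intros)
  ultimately have z: "op_fun (\<lambda>t. max 0 t) D = 0"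
    unfolding P(4) by (intro trace_op_fun_faithful D) auto
  have neg: "t \<le> 0" if "t \<in> real_spectrum D" for t using op_fun_eq_0_imp[OF cm z that] by simp
  have "positive_op (op_fun (\<lambda>t. (- 1) * t) D)"
    by (rule op_fun_positive) (use neg D in \<open>auto intro!: cfc_continuous continuous_intros\<close>)
  moreover have "op_fun (\<lambda>t. (- 1) * t) D = - D"
    using op_fun_cmult[of "\<lambda>t. t" D "- 1"] D by (simp add: op_fun_ident cfc_continuous)
  ultimately show ?thesis by (simp add: D_def)
qed

text \<open>Exchanging \<open>V\<close> and \<open>W\<close> in the preceding lemma shows the
  difference of the two functions to be both positive and negative. \<open>F\<close> is strictly
  increasing on [-1,1], so the real parts can be recovered.\<close>

lemma re_op_eq_of_udist_eq:
  assumes s: "0 < s" and V: "V \<in> unitary_group N" and W: "W \<in> unitary_group N"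
    and comm: "V o\<^sub>L W = W o\<^sub>L V" and eq: "\<And>S. symmetry S \<Longrightarrow> udist s V S = udist s W S"
  shows "re_op V = re_op W"
proof -
  define F where "F = (\<lambda>x. chord s (- x) - chord s x)"
  note c = re_op_unitary[OF V] and c' = re_op_unitary[OF W]
  have F: "cfc F (re_op V)" "cfc F (re_op W)" unfolding F_def by (intro cfc_diff cfc_chord V W s)+
  define D where "D = op_fun F (re_op V) - op_fun F (re_op W)"
  have D: "D \<in> N" using op_fun_in_N F c c' by (simp add: D_def)
  have "positive_op (- D)" "positive_op D"
    using op_fun_chord_diff_positive[OF s V W comm eq] op_fun_chord_diff_positive[OF s W V comm[symmetric] eq[symmetric]]
    by (simp_all add: D_def F_def)
  then have "- D = 0"
    using trace_nonneg[of D] trace_nonneg[of "- D"] trace_scaleR[of D "- 1"] D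
    by (intro trace_faithful) auto
  then have "op_fun F (re_op V) = op_fun F (re_op W)" by (simp add: D_def)
  then show ?thesis
  proof (rule op_fun_inj[OF c(1) c'(1) c(3) c'(3), rotated -1])
    show "continuous_on {-1..1} F"
      unfolding F_def by (intro continuous_on_diff continuous_on_chord continuous_on_chord_minus s)
    show "strict_mono_on {-1..1} F"
    proof (rule strict_mono_onI)
      fix x y :: real assume xy: "x \<in> {-1..1}" "y \<in> {-1..1}" "x < y"
      then show "F x < F y"
        using chord_strict_antimono[OF s, of x y] chord_strict_antimono[OF s, of "- y" "- x"]
        by (simp add: F_def)
    qed
  qed simp
qed

end

section \<open>Isometries fixing the symmetries and the unimodular scalars\<close>

context traced_algebra
begin

text \<open>Stated in a form that translates by suitable unitaries satisfy again, and through
  \<open>udist\<close> so that the trace calculus applies without roots.\<close>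

definition fixing_isometry :: "real \<Rightarrow> (('h \<Rightarrow>\<^sub>L 'h) \<Rightarrow> ('h \<Rightarrow>\<^sub>L 'h)) \<Rightarrow> bool" where
  "fixing_isometry s \<psi> \<longleftrightarrow> \<psi> \<in> unitary_group N \<rightarrow> unitary_group N \<and>
     (\<forall>U\<in>unitary_group N. \<forall>V\<in>unitary_group N. udist s (\<psi> U) (\<psi> V) = udist s U V) \<and>
     (\<forall>S. symmetry S \<longrightarrow> \<psi> S = S) \<and> (\<forall>z. cmod z = 1 \<longrightarrow> \<psi> (scalar_op z) = scalar_op z)"

context
  fixes s :: real and \<psi> :: "('h \<Rightarrow>\<^sub>L 'h) \<Rightarrow> ('h \<Rightarrow>\<^sub>L 'h)"
  assumes s: "0 < s" "s \<noteq> 1" and \<psi>: "fixing_isometry s \<psi>"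
begin

lemma isometry_unitary: "U \<in> unitary_group N \<Longrightarrow> \<psi> U \<in> unitary_group N"
  and isometry_udist: "U \<in> unitary_group N \<Longrightarrow> V \<in> unitary_group N \<Longrightarrow> udist s (\<psi> U) (\<psi> V) = udist s U V"
  and isometry_symmetry: "symmetry S \<Longrightarrow> \<psi> S = S"
  and isometry_scalar: "cmod z = 1 \<Longrightarrow> \<psi> (scalar_op z) = scalar_op z"
  using \<psi> by (auto simp: fixing_isometry_def)

lemma isometry_minus:
  assumes U: "U \<in> unitary_group N"
  shows "\<psi> (- U) = - \<psi> U"
proof -
  have "udist s (\<psi> U) (\<psi> (- U)) = 4 powr s"
    using udist_antipode[OF s(1) U unitary_minus[OF U]] by (simp add: isometry_udist U unitary_minus)
  then show ?thesis using udist_antipode[OF s(1)] isometry_unitary U unitary_minus by blast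
qed

lemma isometry_preserves_symmetry_relation:
  assumes U: "U \<in> unitary_group N" and V: "V \<in> unitary_group N" and "self_adjoint (op_adj U o\<^sub>L V)"
  shows "self_adjoint (op_adj (\<psi> U) o\<^sub>L \<psi> V)"
proof -
  have "udist s U V + udist s U (- V) = 4 powr s" using udist_symmetry_iff[OF s U V] assms by blast
  then have "udist s (\<psi> U) (\<psi> V) + udist s (\<psi> U) (- \<psi> V) = 4 powr s"
    by (simp add: isometry_minus[symmetric] isometry_udist U V unitary_minus)
  then show ?thesis using udist_symmetry_iff[OF s isometry_unitary[OF U] isometry_unitary[OF V]] by blast
qed

text \<open>The scalar \<open>z\<close> is fixed and is related to zS, since the quotient S is a
  symmetry. So the image of zS is \<open>z\<close> times a symmetry T, and its distances to the
  fixed points S and -S identify T.\<close>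

lemma isometry_scalar_symmetry_pos:
  assumes S: "symmetry S" and z: "cmod z = 1" "0 < Re z"
  shows "\<psi> (scalar_op z o\<^sub>L S) = scalar_op z o\<^sub>L S"
\<comment> \<open>Separated because the tangent argument needs \<open>Re z < 1\<close>: at
  \<open>z = 1\<close> the base \<open>2 - 2 * Re z\<close> is zero.\<close>
proof (cases "z = 1")
  case True
  then show ?thesis using isometry_symmetry[OF S] by simp
next
  case False
  note SD = symmetryD[OF S]
  have "Re z < 1"
  proof (rule ccontr)
    assume "\<not> ?thesis"
    then have "Re z = 1" using complex_Re_le_cmod[of z] z by simp
    moreover have "(Re z)\<^sup>2 + (Im z)\<^sup>2 = 1" using z(1) by (simp add: cmod_def)
    ultimately show False using False by (simp add: complex_eq_iff)
  qed
  have zz: "cnj z * z = 1" "z * cnj z = 1"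
    using z(1) by (simp_all add: complex_norm_square[symmetric] mult.commute[of "cnj z"])
  define V where "V = scalar_op z o\<^sub>L S"
  have V: "V \<in> unitary_group N" unfolding V_def by (intro unitary_compose unitary_scalar z SD)
  have zU: "scalar_op z \<in> unitary_group N" by (rule unitary_scalar[OF z(1)])
  define T where "T = scalar_op (cnj z) o\<^sub>L \<psi> V"
  have "self_adjoint (op_adj (scalar_op z) o\<^sub>L V)"
    using S by (simp add: V_def scalar_op_compose zz symmetry_def flip: blinfun_compose_assoc)
  then have "self_adjoint T"
    using isometry_preserves_symmetry_relation[OF zU V] by (simp add: isometry_scalar z T_def)
  moreover have "T \<in> unitary_group N"
    unfolding T_def by (intro unitary_compose unitary_scalar isometry_unitary V) (simp add: z)
  ultimately have T: "symmetry T" by (simp add: symmetry_def)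
  have \<psi>V: "\<psi> V = scalar_op z o\<^sub>L T"
    by (simp add: T_def scalar_op_compose zz flip: blinfun_compose_assoc)
  have "udist s (\<psi> V) (\<psi> S) = udist s V S" "udist s (\<psi> V) (\<psi> (- S)) = udist s V (- S)"
    by (intro isometry_udist V SD unitary_minus)+
  then have "udist s (scalar_op z o\<^sub>L T) S = udist s V S" "udist s (scalar_op z o\<^sub>L T) (- S) = udist s V (- S)"
    unfolding \<psi>V by (simp_all add: isometry_symmetry S isometry_minus SD)
  then have "T = S" unfolding V_def by (rule symmetry_eq_of_udist_eq[OF s(1) S T z \<open>Re z < 1\<close>])
  then show ?thesis using \<psi>V by (simp add: V_def)
qed

lemma isometry_scalar_symmetry_nonzero:
  assumes S: "symmetry S" and z: "cmod z = 1" "Re z \<noteq> 0"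
  shows "\<psi> (scalar_op z o\<^sub>L S) = scalar_op z o\<^sub>L S"
proof (cases "0 < Re z")
  case False
  then have "\<psi> (scalar_op (- z) o\<^sub>L S) = scalar_op (- z) o\<^sub>L S"
    using S z by (intro isometry_scalar_symmetry_pos) auto
  then show ?thesis
    using isometry_minus[OF unitary_compose[OF unitary_scalar[OF z(1)] symmetryD(1)[OF S]]]
    by (simp add: scalar_op_minus op_distribs)
qed (rule isometry_scalar_symmetry_pos[OF S z(1)])

text \<open>The two conditions are what the translate needs in order to fix symmetries and scalars;
  left invariance of \<open>udist\<close> gives the rest. Translation removes a factor from a
  product and moves a scalar off the imaginary axis.\<close>

lemma fixing_isometry_translate:
  assumes A: "A \<in> unitary_group N"
    and fixS: "\<And>S. symmetry S \<Longrightarrow> \<psi> (A o\<^sub>L S) = A o\<^sub>L S"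
    and fixz: "\<And>z. cmod z = 1 \<Longrightarrow> \<psi> (A o\<^sub>L scalar_op z) = A o\<^sub>L scalar_op z"
  shows "fixing_isometry s (\<lambda>V. op_adj A o\<^sub>L \<psi> (A o\<^sub>L V))"
  using A fixS fixz unfolding fixing_isometry_def
  by (auto intro!: unitary_compose unitary_adj isometry_unitary
      simp: udist_left_mult unitary_adj unitary_compose isometry_unitary isometry_udist unitary_cancel)

end

text \<open>A scalar with vanishing real part is a product of \<open>cis (\<pi>/4)\<close> and a scalar with
  nonvanishing real part, and translation by \<open>cis (\<pi>/4)\<close> gives another fixing isometry.\<close>

lemma isometry_scalar_symmetry:
  assumes s: "0 < s" "s \<noteq> 1" and \<psi>: "fixing_isometry s \<psi>" and S: "symmetry S" and z: "cmod z = 1"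
  shows "\<psi> (scalar_op z o\<^sub>L S) = scalar_op z o\<^sub>L S"
proof (cases "Re z = 0")
  case False
  then show ?thesis by (intro isometry_scalar_symmetry_nonzero[OF s \<psi> S z])
next
  case True
  \<comment> \<open>Any unimodular number off both axes would do: \<open>Re w \<noteq> 0\<close>
    makes the translate a fixing isometry, and for \<open>Re z = 0\<close> the real part of
    \<open>z * cnj w\<close> is \<open>Im z * Im w\<close>.\<close>
  define w where "w = cis (pi / 4)"
  have w: "cmod w = 1" "Re w \<noteq> 0" "Im w \<noteq> 0" by (simp_all add: w_def cos_45 sin_45)
  have ww: "w * (z * cnj w) = z"
    using w(1) complex_norm_square[of w] by (simp add: mult_ac)
  have wU: "scalar_op w \<in> unitary_group N" by (rule unitary_scalar[OF w(1)])
  have \<psi>': "fixing_isometry s (\<lambda>V. op_adj (scalar_op w) o\<^sub>L \<psi> (scalar_op w o\<^sub>L V))"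
  proof (rule fixing_isometry_translate[OF s \<psi> wU])
    show "\<psi> (scalar_op w o\<^sub>L S) = scalar_op w o\<^sub>L S" if "symmetry S" for S
      by (rule isometry_scalar_symmetry_nonzero[OF s \<psi> that w(1,2)])
    show "\<psi> (scalar_op w o\<^sub>L scalar_op z) = scalar_op w o\<^sub>L scalar_op z" if "cmod z = 1" for z
      using isometry_scalar[OF s \<psi>, of "w * z"] that w by (simp add: scalar_op_compose norm_mult)
  qed
  have "Im z \<noteq> 0" using True z by (metis complex_eq_0 norm_zero power2_eq_square zero_neq_one
        complex_eq_iff zero_complex.simps)
  then have "Re (z * cnj w) \<noteq> 0" using True w by simp
  moreover have "cmod (z * cnj w) = 1" using z w by (simp add: norm_mult)
  ultimately have "op_adj (scalar_op w) o\<^sub>L \<psi> (scalar_op w o\<^sub>L (scalar_op (z * cnj w) o\<^sub>L S))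
      = scalar_op (z * cnj w) o\<^sub>L S"
    by (intro isometry_scalar_symmetry_nonzero[OF s \<psi>' S])
  then have "scalar_op w o\<^sub>L (op_adj (scalar_op w) o\<^sub>L \<psi> (scalar_op w o\<^sub>L (scalar_op (z * cnj w) o\<^sub>L S)))
      = scalar_op w o\<^sub>L (scalar_op (z * cnj w) o\<^sub>L S)" by simp
  then have "\<psi> (scalar_op w o\<^sub>L (scalar_op (z * cnj w) o\<^sub>L S)) = scalar_op w o\<^sub>L (scalar_op (z * cnj w) o\<^sub>L S)"
    unfolding unitary_cancel[OF wU] .
  then show ?thesis by (simp only: blinfun_compose_assoc[symmetric] scalar_op_compose ww)
qed

text \<open>Both symmetries invert \<open>\<psi> (S\<^sub>1S\<^sub>2)\<close> by conjugation, so it commutes with \<open>S\<^sub>1S\<^sub>2\<close>. The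
  distances to \<open>S\<close> and to \<open>iS\<close>, for all symmetries \<open>S\<close>, then determine its real and imaginary
  part.\<close>

lemma isometry_symmetry_product:
  assumes s: "0 < s" "s \<noteq> 1" and \<psi>: "fixing_isometry s \<psi>" and S: "symmetry S1" "symmetry S2"
  shows "\<psi> (S1 o\<^sub>L S2) = S1 o\<^sub>L S2"
proof -
  note D1 = symmetryD[OF S(1)] and D2 = symmetryD[OF S(2)]
  define V where "V = S1 o\<^sub>L S2"
  define W where "W = \<psi> V"
  have V: "V \<in> unitary_group N" unfolding V_def by (intro unitary_compose D1 D2)
  have W: "W \<in> unitary_group N" unfolding W_def by (rule isometry_unitary[OF s \<psi> V])
  note VD = unitaryD[OF V] and WD = unitaryD[OF W]
  have "self_adjoint (op_adj S1 o\<^sub>L V)" using S(2) by (simp add: V_def D1 symmetry_def)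
  then have "self_adjoint (S1 o\<^sub>L W)"
    using isometry_preserves_symmetry_relation[OF s \<psi> D1(1) V] isometry_symmetry[OF s \<psi> S(1)]
    by (simp add: W_def D1)
  then have W1: "op_adj W o\<^sub>L S1 = S1 o\<^sub>L W" using self_adjointD(2) WD D1 by fastforce
  have "self_adjoint (op_adj S2 o\<^sub>L V)"
    using D1 D2 by (simp add: V_def self_adjoint_def blinfun_compose_assoc)
  then have "self_adjoint (S2 o\<^sub>L W)"
    using isometry_preserves_symmetry_relation[OF s \<psi> D2(1) V] isometry_symmetry[OF s \<psi> S(2)]
    by (simp add: W_def D2)
  then have W2: "op_adj W o\<^sub>L S2 = S2 o\<^sub>L W" using self_adjointD(2) WD D2 by fastforce
  have W1': "S1 o\<^sub>L op_adj W = W o\<^sub>L S1"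
  proof -
    have "S1 o\<^sub>L ((op_adj W o\<^sub>L S1) o\<^sub>L S1) = S1 o\<^sub>L ((S1 o\<^sub>L W) o\<^sub>L S1)" by (simp only: W1)
    then show ?thesis by (simp add: blinfun_compose_assoc D1)
  qed
  have comm: "V o\<^sub>L W = W o\<^sub>L V"
  proof -
    have "V o\<^sub>L W = (S1 o\<^sub>L op_adj W) o\<^sub>L S2" by (simp add: V_def blinfun_compose_assoc W2)
    also have "\<dots> = W o\<^sub>L V" by (simp add: W1' V_def blinfun_compose_assoc)
    finally show ?thesis .
  qed
  have "udist s V R = udist s W R" if "symmetry R" for R
    using isometry_udist[OF s \<psi> V symmetryD(1)[OF that]] isometry_symmetry[OF s \<psi> that]
    by (simp add: W_def)
  then have re: "re_op V = re_op W" by (rule re_op_eq_of_udist_eq[OF s(1) V W comm])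
  \<comment> \<open>The adjoint of \<open>j\<close> is multiplication by \<i>, so distances from
    \<open>j A\<close> to \<open>R\<close> are distances from \<open>A\<close> to
    \<open>\<i> R\<close>; the real part of \<open>j A\<close> is the imaginary part of
    \<open>A\<close>.\<close>
  define j :: "'h \<Rightarrow>\<^sub>L 'h" where "j = scalar_op (- \<i>)"
  have j: "j \<in> unitary_group N" unfolding j_def by (rule unitary_scalar) simp
  have jadj: "op_adj j = scalar_op \<i>" by (simp add: j_def)
  have jV: "j o\<^sub>L V \<in> unitary_group N" and jW: "j o\<^sub>L W \<in> unitary_group N"
    by (intro unitary_compose j V W)+
  have ud: "udist s (j o\<^sub>L A) R = udist s A (scalar_op \<i> o\<^sub>L R)" if "A \<in> unitary_group N" for A R
    using unitaryD[OF that] unitaryD(2)[OF j]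
    by (simp add: udist_def jadj blinfun_compose_assoc)
  have "udist s (j o\<^sub>L V) R = udist s (j o\<^sub>L W) R" if R: "symmetry R" for R
    using isometry_udist[OF s \<psi> V, of "scalar_op \<i> o\<^sub>L R"] isometry_scalar_symmetry[OF s \<psi> R, of \<i>]
    by (simp add: ud V W W_def[symmetric] unitary_compose unitary_scalar symmetryD[OF R])
  moreover have "(j o\<^sub>L V) o\<^sub>L (j o\<^sub>L W) = (j o\<^sub>L W) o\<^sub>L (j o\<^sub>L V)"
    by (simp only: j_def blinfun_compose_assoc scalar_op_left_commute[OF VD(2)]
        scalar_op_left_commute[OF WD(2)] comm)
  ultimately have im: "re_op (j o\<^sub>L V) = re_op (j o\<^sub>L W)"
    by (intro re_op_eq_of_udist_eq[OF s(1) jV jW]) auto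
  have decomp: "A = re_op A + (op_adj j o\<^sub>L re_op (j o\<^sub>L A))" if "A \<in> unitary_group N" for A
  proof -
    note AD = unitaryD[OF that]
    have "op_adj (j o\<^sub>L A) = scalar_op \<i> o\<^sub>L op_adj A"
      using AD unitaryD(2)[OF j] by (simp add: jadj scalar_op_commute)
    then have "re_op A + (op_adj j o\<^sub>L re_op (j o\<^sub>L A))
        = (1 / 2) *\<^sub>R (A + op_adj A) + (1 / 2) *\<^sub>R (A + (scalar_op (\<i> * \<i>) o\<^sub>L op_adj A))"
      using AD by (simp add: re_op_def op_distribs unitary_cancel[OF j])
        (simp add: jadj scalar_op_compose flip: blinfun_compose_assoc)
    also have "\<dots> = A" by (simp add: scalar_op_minus op_distribs algebra_simps flip: scaleR_left_distrib)
    finally show ?thesis by simp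
  qed
  have "W = V" using decomp[OF V] decomp[OF W] re im by metis
  then show ?thesis by (simp add: W_def V_def)
qed

text \<open>The induction ranges over all fixing isometries at once, because the hypothesis for the
  tail is applied to the translate by the first factor. The empty product is the case of a
  scalar.\<close>

lemma isometry_symmetry_products:
  assumes s: "0 < s" "s \<noteq> 1" and z: "cmod z = 1"
    and "fixing_isometry s \<psi>" "\<forall>U\<in>set Us. symmetry U"
  shows "\<psi> (scalar_op z o\<^sub>L op_prod_list Us) = scalar_op z o\<^sub>L op_prod_list Us"
  using assms(4,5)
proof (induction Us arbitrary: \<psi>)
  case Nil
  then show ?case using isometry_scalar[OF s, of \<psi> z] z by (simp add: op_prod_list_def)
next
  case (Cons U Us)
  have U: "symmetry U" using Cons.prems by simp
  note UD = symmetryD[OF U]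
  have "fixing_isometry s (\<lambda>V. op_adj U o\<^sub>L \<psi> (U o\<^sub>L V))"
  proof (rule fixing_isometry_translate[OF s Cons.prems(1) UD(1)])
    show "\<psi> (U o\<^sub>L S) = U o\<^sub>L S" if "symmetry S" for S
      by (rule isometry_symmetry_product[OF s Cons.prems(1) U that])
    show "\<psi> (U o\<^sub>L scalar_op z) = U o\<^sub>L scalar_op z" if "cmod z = 1" for z
      unfolding scalar_op_commute[OF UD(3)]
      by (rule isometry_scalar_symmetry[OF s Cons.prems(1) U that])
  qed
  from Cons.IH[OF this] have "U o\<^sub>L \<psi> (U o\<^sub>L (scalar_op z o\<^sub>L op_prod_list Us)) = scalar_op z o\<^sub>L op_prod_list Us"
    using Cons.prems(2) UD by simp
  then have "U o\<^sub>L (U o\<^sub>L \<psi> (U o\<^sub>L (scalar_op z o\<^sub>L op_prod_list Us))) = U o\<^sub>L (scalar_op z o\<^sub>L op_prod_list Us)"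
    by (simp only:)
  then show ?case
    by (simp add: op_prod_list_def scalar_op_left_commute UD)
qed

end

theorem lemma2p9:
  fixes p :: real
    and N :: "('h::complex_hilbert \<Rightarrow>\<^sub>L 'h) set"
    and \<tau> :: "('h \<Rightarrow>\<^sub>L 'h) \<Rightarrow> complex"
    and \<psi> :: "('h \<Rightarrow>\<^sub>L 'h) \<Rightarrow> ('h \<Rightarrow>\<^sub>L 'h)"
  assumes "0 < p" and "p \<noteq> 2"
    and "II1_factor N" and "is_trace_of \<tau> N"
    and "Lp_isometry \<tau> p N \<psi>" and "\<psi> ` unitary_group N = unitary_group N"
    and "\<And>U. U \<in> unitary_group N \<Longrightarrow> self_adjoint U \<Longrightarrow> \<psi> U = U"
    and "\<And>\<theta>::real. \<psi> (scalar_op (cis \<theta>)) = scalar_op (cis \<theta>)"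
  shows "\<forall>(n::nat) (Us :: ('h \<Rightarrow>\<^sub>L 'h) list) (\<theta>::real).
    1 \<le> n \<and> length Us = n \<and> (\<forall>U\<in>set Us. U \<in> unitary_group N \<and> self_adjoint U) \<longrightarrow>
    \<psi> (scalar_op (cis \<theta>) o\<^sub>L op_prod_list Us) = scalar_op (cis \<theta>) o\<^sub>L op_prod_list Us"
proof -
  interpret traced_algebra N \<tau>
    using assms(3,4) by unfold_locales (auto simp: II1_factor_def factor_def)
  have "fixing_isometry (p / 2) \<psi>"
    unfolding fixing_isometry_def
  proof (intro conjI ballI allI impI)
    show maps: "\<psi> \<in> unitary_group N \<rightarrow> unitary_group N" using assms(5) by (simp add: Lp_isometry_def)
    show "udist (p / 2) (\<psi> U) (\<psi> V) = udist (p / 2) U V"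
      if "U \<in> unitary_group N" "V \<in> unitary_group N" for U V
      using that maps assms(5) by (intro udist_eq_of_Lp_norm_eq[OF assms(1)]) (auto simp: Lp_isometry_def)
    show "\<psi> S = S" if "symmetry S" for S using that assms(7) by (simp add: symmetry_def)
    show "\<psi> (scalar_op z) = scalar_op z" if "cmod z = 1" for z
    proof -
      have "z = cis (Arg z)" using that cis_Arg[of z] by (metis norm_zero sgn_eq div_by_1 of_real_1 zero_neq_one)
      then show ?thesis using assms(8) by metis
    qed
  qed
  then show ?thesis
    using assms(1,2) isometry_symmetry_products[of "p / 2"] by (simp add: symmetry_def)
qed

end
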